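(* Let $K$ be large, and let $w$ be smooth with compact support in $[K,2K]$ with $|w^{(j)}(x)|\le C_jK^{-j}$ for all $j\ge0$. For positive reals $\alpha,\beta$ define $$S(\alpha,\beta)=\sum_{k\ \mathrm{odd}}i^kJ_k(4\pi\alpha)J_{2k-1}(4\pi\beta)w(k).$$ If $\alpha<K/100$ or $\beta<K/100$, then $S(\alpha,\beta)\ll\exp(-\tfrac12K)$. Otherwise, suppose $\alpha\ll K^{2+\varepsilon}$ and $\beta\ll K^{1+\varepsilon}$, and let $\gamma=\frac{\beta}{4\alpha}$. If $\gamma\ge1$ then $S(\alpha,\beta)\ll K^{-1}$. If $\gamma<1$ then $$S(\alpha,\beta)=\sum_{\pm}\frac{H_\pm(\beta\sqrt{1-\gamma^2},\gamma)}{\sqrt{\alpha}}\,e\!\left(\pm\Big(2\alpha+\frac{\beta^2}{4\alpha}\Big)\right)+O(K^{-1+\varepsilon}),$$ where $H_\pm(x,y)$ are complex-valued functions vanishing unless $K\le2\pi x\le2K$ and $0\le y\le1$, and satisfying $\frac{\partial^{i}}{\partial x^i}\frac{\partial^j}{\partial y^j}H_\pm(x,y)\ll\frac{\beta}{K}K^{-i}$ for all $i,j\in\{0,1,2,\dots\}$.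
   Context: $e(x)=e^{2\pi ix}$; $J_\nu$ is the $J$-Bessel function. $\varepsilon>0$ denotes an arbitrarily small constant; implied constants depend on $\varepsilon$, on the constants $C_j$, and (for the derivative bounds) on $i,j$. *)

theory Defs
  imports "HOL-Analysis.Analysis"
begin

definition e :: "real \<Rightarrow> complex" where
  "e x = exp (2 * of_real pi * \<i> * of_real x)"

(* Meant for x > 0; rGamma = 1 / Gamma is extended by 0 to the poles of Gamma. *)
definition bessel_J :: "real \<Rightarrow> real \<Rightarrow> real" where
  "bessel_J \<nu> x =
     (\<Sum>m. (-1) ^ m / fact m * rGamma (real m + \<nu> + 1) * (x / 2) powr (2 * real m + \<nu>))"

(* The derivative w^(j) of a complex-valued function of a real variable. *)
definition vderiv :: "nat \<Rightarrow> (real \<Rightarrow> complex) \<Rightarrow> real \<Rightarrow> complex" where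
  "vderiv j w = ((\<lambda>f x. vector_derivative f (at x)) ^^ j) w"

definition smooth_fun :: "(real \<Rightarrow> complex) \<Rightarrow> bool" where
  "smooth_fun w \<longleftrightarrow> (\<forall>j x. vderiv j w differentiable (at x))"

definition weight :: "(nat \<Rightarrow> real) \<Rightarrow> real \<Rightarrow> (real \<Rightarrow> complex) \<Rightarrow> bool" where
  "weight C K w \<longleftrightarrow>
     smooth_fun w \<and>
     (\<forall>x. x \<notin> {K..2 * K} \<longrightarrow> w x = 0) \<and>
     (\<forall>j x. norm (vderiv j w x) \<le> C j * K powr (- real j))"

(* For a weight supported in [K, 2K] with K > 0 only finitely many terms are nonzero,
   and negative k do not contribute. *)
definition S :: "(real \<Rightarrow> complex) \<Rightarrow> real \<Rightarrow> real \<Rightarrow> complex" where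
  "S w \<alpha> \<beta> =
     (\<Sum>\<^sub>\<infinity>k\<in>{k::nat. odd k}.
        \<i> ^ k * of_real (bessel_J (real k) (4 * pi * \<alpha>))
              * of_real (bessel_J (2 * real k - 1) (4 * pi * \<beta>)) * w (real k))"

(* Derivatives of a function H x y on the strip 0 \<le> y \<le> 1, one-sided in y on the two
   boundary lines.  H is extended by 0 outside the strip and need not be continuous
   across its boundary. *)
definition d_x :: "(real \<Rightarrow> real \<Rightarrow> complex) \<Rightarrow> real \<Rightarrow> real \<Rightarrow> complex" where
  "d_x H x y = vector_derivative (\<lambda>s. H s y) (at x)"

definition d_y :: "(real \<Rightarrow> real \<Rightarrow> complex) \<Rightarrow> real \<Rightarrow> real \<Rightarrow> complex" where
  "d_y H x y = vector_derivative (\<lambda>t. H x t) (at y within {0..1})"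

definition partial :: "nat \<Rightarrow> nat \<Rightarrow> (real \<Rightarrow> real \<Rightarrow> complex) \<Rightarrow> real \<Rightarrow> real \<Rightarrow> complex" where
  "partial i j H = (d_x ^^ i) ((d_y ^^ j) H)"

definition smooth_on_strip :: "(real \<Rightarrow> real \<Rightarrow> complex) \<Rightarrow> bool" where
  "smooth_on_strip H \<longleftrightarrow>
     (\<forall>i j. continuous_on (UNIV \<times> {0..1}) (\<lambda>(x, y). partial i j H x y) \<and>
        (\<forall>x. \<forall>y\<in>{0..1}.
           (\<lambda>s. partial i j H s y) differentiable (at x) \<and>
           (\<lambda>t. partial i j H x t) differentiable (at y within {0..1})))"

(* The conditions on H_+ and H_-; B i j are the implied constants. *)
definition amplitude ::
  "(nat \<Rightarrow> nat \<Rightarrow> real) \<Rightarrow> real \<Rightarrow> real \<Rightarrow> (real \<Rightarrow> real \<Rightarrow> complex) \<Rightarrow> bool" where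
  "amplitude B K \<beta> H \<longleftrightarrow>
     smooth_on_strip H \<and>
     (\<forall>x y. H x y \<noteq> 0 \<longrightarrow> K \<le> 2 * pi * x \<and> 2 * pi * x \<le> 2 * K \<and> 0 \<le> y \<and> y \<le> 1) \<and>
     (\<forall>i j x. \<forall>y\<in>{0..1}. norm (partial i j H x y) \<le> B i j * (\<beta> / K) * K powr (- real i))"

end

theory Submission
  imports Defs "HOL-Probability.Characteristic_Functions" "HOL-Probability.Sinc_Integral"
begin

text \<open>
  Put \<open>a = 4 \<pi> \<alpha>\<close> and \<open>b = 4 \<pi> \<beta>\<close>. By the Jacobi--Anger expansion,
  \<open>4 \<pi> S\<close> is the difference over \<open>\<sigma> = \<plusminus>1\<close> of the integrals of \<open>cis (\<sigma> a cos 2\<theta>) U \<theta>\<close>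
  over a period, where \<open>U\<close> arises from \<open>cis (b sin \<theta> + \<theta>)\<close> by multiplying the Fourier coefficient of
  frequency \<open>n\<close> with \<open>w (n / 2)\<close>. Fourier inversion for \<open>w\<close> turns this multiplier into a superposition of
  translations, and a second order Taylor expansion replaces \<open>U \<theta>\<close> by
  \<open>cis (b sin \<theta> + \<theta>) w (b cos \<theta> / 2)\<close> up to terms whose integral is \<open>O(1 / K)\<close>; here one uses that
  \<open>w'' (b cos \<theta> / 2)\<close> is supported on a set of measure \<open>O(K / b)\<close>.
  After the substitution \<open>y = sin \<theta>\<close> the phase is exactly quadratic, with stationary point
  \<open>\<sigma> b / (4 a) = \<sigma> \<gamma>\<close>, so that stationary phase gives the main term with an explicit amplitude, which
  vanishes when \<open>\<gamma> \<ge> 1\<close>, and an error \<open>O((\<beta> / K) ^ 5 \<alpha> powr (-3/2))\<close>. The value of the Fresnel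
  integral only enters as a constant factor of the amplitude.
\<close>

section \<open>Bessel functions of integer order\<close>

text \<open>The factor \<open>cis \<theta>\<close> in \<open>bphase\<close> moves the coefficient
  J_(2k-1)(b) to frequency 2k, where \<open>cos (2 * \<theta>)\<close> has its frequencies; J_k(-a)
  = (-1)^k J_k(a) makes the difference over the signs select the odd k. The obstacle is uniformity:
  beta/K may reach K^epsilon, while the case gamma >= 1 asks for 1/K without loss. The transform of
  w lives at |t| of order 1/K. In the shifted phase the linear term b t cos(theta)/2 has size b/K,
  is not small and stays in the exponent; this is what evaluates w at b cos(theta)/2. The quadratic
  term gives b w''/8, of size b/K^2, which misses 1/K pointwise by the factor b/K that the measure
  of the support returns. In stationary phase each power of 1/cos(theta) in the second derivative
  costs beta/K, five in all. As alpha^(-3/2) is O(K^(-3/2)), a factor K^(1/2) is left to absorb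
  them: hence 5 epsilon <= 1/2 and the range epsilon < 1/10. At the stationary point put x = beta
  cos(theta) and y = gamma. Then tan(theta) is plus or minus beta y / x, so H is affine in y, free
  of alpha, and beta/K is the size of beta/x.\<close>

definition bessel_int :: "nat \<Rightarrow> real \<Rightarrow> real" where
  "bessel_int k s = (\<Sum>p. (-1) ^ p / (fact p * fact (p + k)) * (s / 2) ^ (2 * p + k))"

text \<open>Since (p + k)! >= k! (k + 1)^p, the series is dominated by an exponential series in s^2
  / (4 (k + 1)); the extra k + 1 keeps that exponential small compared with (s/2)^k / k! when s is
  small against k.\<close>

lemma bessel_int_term_le:
  "norm ((-1) ^ p / (fact p * fact (p + k)) * (s / 2) ^ (2 * p + k))
     \<le> (\<bar>s\<bar> / 2) ^ k / fact k * ((s\<^sup>2 / (4 * (real k + 1))) ^ p / fact p)"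
proof -
  have "fact k * real (k + 1) ^ p \<le> fact (p + k)"
  proof (induction p)
    case (Suc p)
    have "fact k * real (k + 1) ^ Suc p = (fact k * real (k + 1) ^ p) * real (k + 1)" by simp
    also have "\<dots> \<le> fact (p + k) * real (Suc p + k)"
      by (intro mult_mono Suc.IH) auto
    finally show ?case by (simp add: mult.commute)
  qed simp
  then have "1 / fact (p + k) \<le> 1 / (fact k * real (k + 1) ^ p)"
    by (intro divide_left_mono) auto
  then have "(\<bar>s\<bar> / 2) ^ (2 * p + k) / fact p * (1 / fact (p + k))
      \<le> (\<bar>s\<bar> / 2) ^ (2 * p + k) / fact p * (1 / (fact k * real (k + 1) ^ p))"
    by (intro mult_left_mono) auto
  moreover have "(\<bar>s\<bar> / 2) ^ (2 * p + k) = (\<bar>s\<bar> / 2) ^ k * (s\<^sup>2 / 4) ^ p"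
    by (simp only: power_add power_mult) (simp add: power_divide mult.commute)
  moreover have "(s\<^sup>2 / (4 * (real k + 1))) ^ p = (s\<^sup>2 / 4) ^ p / real (k + 1) ^ p"
  proof -
    have "s\<^sup>2 / (4 * (real k + 1)) = (s\<^sup>2 / 4) / real (k + 1)" by simp
    then show ?thesis by (simp only: power_divide)
  qed
  moreover have "norm ((-1) ^ p / (fact p * fact (p + k)) * (s / 2) ^ (2 * p + k))
      = (\<bar>s\<bar> / 2) ^ (2 * p + k) / fact p * (1 / fact (p + k))"
    by (simp add: abs_mult power_abs)
  ultimately show ?thesis
    by (simp add: mult_ac del: power_divide)
qed

lemma summable_bessel_int:
  "summable (\<lambda>p. (-1) ^ p / (fact p * fact (p + k)) * (s / 2) ^ (2 * p + k) :: real)"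
proof (rule summable_comparison_test'[OF _ bessel_int_term_le])
  show "summable (\<lambda>p. (\<bar>s\<bar> / 2) ^ k / fact k * ((s\<^sup>2 / (4 * (real k + 1))) ^ p / fact p))"
    using summable_exp[of "s\<^sup>2 / (4 * (real k + 1))"]
    by (intro summable_mult) (simp add: divide_inverse mult.commute)
qed

lemma abs_bessel_int_le:
  "\<bar>bessel_int k s\<bar> \<le> (\<bar>s\<bar> / 2) ^ k / fact k * exp (s\<^sup>2 / (4 * (real k + 1)))"
proof -
  have e: "(\<lambda>p. (\<bar>s\<bar> / 2) ^ k / fact k * ((s\<^sup>2 / (4 * (real k + 1))) ^ p / fact p))
      sums ((\<bar>s\<bar> / 2) ^ k / fact k * exp (s\<^sup>2 / (4 * (real k + 1))))"
    using exp_converges[of "s\<^sup>2 / (4 * (real k + 1))"]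
    by (intro sums_mult) (simp add: divide_inverse mult.commute)
  show ?thesis
    using norm_suminf_le[OF bessel_int_term_le[where s = s and k = k] sums_summable[OF e]]
    unfolding bessel_int_def sums_unique[OF e, symmetric] real_norm_def .
qed

lemma bessel_J_nat:
  assumes "x > 0"
  shows "bessel_J (real k) x = bessel_int k x"
proof -
  have "rGamma (real m + real k + 1) = 1 / fact (m + k)" for m
    using Gamma_fact[of "m + k", where 'a = real]
    by (simp add: rGamma_inverse_Gamma divide_inverse algebra_simps)
  moreover have "(x / 2) powr (2 * real m + real k) = (x / 2) ^ (2 * m + k)" for m
    using assms powr_realpow[of "x / 2" "2 * m + k"] by simp
  ultimately show ?thesis
    unfolding bessel_J_def bessel_int_def by simp
qed

lemma bessel_int_minus: "bessel_int k (- x) = (-1) ^ k * bessel_int k x"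
proof -
  have *: "(-1) ^ p / (fact p * fact (p + k)) * (- x / 2) ^ (2 * p + k)
     = (-1) ^ k * ((-1) ^ p / (fact p * fact (p + k)) * (x / 2) ^ (2 * p + k))" for p
    by (simp add: power_add power_mult power_minus[of "x/2" k])
  show ?thesis
    unfolding bessel_int_def * by (rule suminf_mult[OF summable_bessel_int])
qed

text \<open>With x <= n/7 the leading factor is at most (n/14)^n / n! <= (e/14)^n, and the
  exponential factor is at most e^(n/4). The product is at most e^(-n) because e^(9/4) <=
  14.\<close>

lemma abs_bessel_int_le_exp:
  assumes "0 \<le> x" "7 * x \<le> real n"
  shows "\<bar>bessel_int n x\<bar> \<le> exp (- real n)"
proof (cases "n = 0")
  case True
  with assms have "x = 0" by simp
  moreover have "bessel_int 0 0 = (\<Sum>p. (if p = 0 then 1 else 0))"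
    unfolding bessel_int_def by (intro suminf_cong) auto
  moreover have "(\<Sum>p. (if p = (0::nat) then 1 else 0)) = (1::real)"
    using sums_single[of 0 "\<lambda>_. 1::real"] by (simp add: sums_iff)
  ultimately show ?thesis using True by simp
next
  case False
  have nn: "real n ^ n / fact n \<le> exp (real n)"
  proof -
    have "(\<lambda>p. real n ^ p / fact p) sums exp (real n)"
      using exp_converges[of "real n"] by (simp add: divide_inverse mult.commute)
    then show ?thesis
      using sum_le_suminf[of "\<lambda>p. real n ^ p / fact p" "{n}"] by (simp add: sums_iff)
  qed
  have e1: "exp 1 \<le> (3::real)" using e_less_272 by simp
  have "x\<^sup>2 / (4 * (real n + 1)) \<le> real n * real n / (4 * real n)"
    unfolding power2_eq_square using assms False by (intro frac_le mult_mono) auto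
  then have e4: "exp (x\<^sup>2 / (4 * (real n + 1))) \<le> exp (real n / 4)"
    using False by simp
  have "(\<bar>x\<bar> / 2) ^ n / fact n \<le> (real n / 14) ^ n / fact n"
    using assms by (intro divide_right_mono power_mono) auto
  also have "\<dots> = (1 / 14) ^ n * (real n ^ n / fact n)"
    by (simp add: power_divide)
  also have "\<dots> \<le> (1 / 14) ^ n * exp (real n)"
    using nn by (intro mult_left_mono) auto
  finally have "\<bar>bessel_int n x\<bar> \<le> (1 / 14) ^ n * exp (real n) * exp (real n / 4)"
    using abs_bessel_int_le[of n x] e4
    by (smt (verit) exp_ge_zero mult_mono abs_ge_zero zero_le_divide_iff fact_ge_zero zero_le_power)
  also have "\<dots> = ((1 / 14) * exp (5 / 4)) ^ n"
  proof -
    have "exp (real n) * exp (real n / 4) = exp (real n * (5 / 4))" by (simp add: mult_exp_exp)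
    then show ?thesis by (simp only: exp_of_nat_mult power_mult_distrib mult.assoc)
  qed
  also have "\<dots> \<le> (exp (- 1)) ^ n"
  proof (intro power_mono)
      \<comment> \<open>In fourth powers the crude bound e <= 3 suffices: 3^9 = 19683 is below 14^4
        = 38416.\<close>
      have "exp (9 / 4 :: real) ^ 4 = exp 1 ^ 9"
      using exp_of_nat_mult[of 4 "9 / 4 :: real"] exp_of_nat_mult[of 9 "1 :: real"] by simp
    also have "\<dots> \<le> 3 ^ 9" by (intro power_mono e1) simp
    also have "\<dots> \<le> 14 ^ 4" by simp
    finally have "exp (9 / 4) \<le> (14::real)" by (rule power_le_imp_le_base[where n=3, simplified]) simp
    then have "exp (9/4) / 14 \<le> (1::real)" by simp
    moreover have "exp (5/4) = exp (9/4) * exp (-1 :: real)" by (simp add: mult_exp_exp)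
    ultimately show "1 / 14 * exp (5 / 4) \<le> exp (- 1 :: real)"
      by (simp add: mult_le_cancel_right1)
  qed simp
  also have "\<dots> = exp (- real n)" using exp_of_nat_mult[of n "- 1 :: real"] by simp
  finally show ?thesis .
qed


section \<open>Jacobi-Anger expansion and Bessel's integral\<close>

lemma sums_integral_uniform:
  fixes f :: "nat \<Rightarrow> real \<Rightarrow> complex"
  assumes cont: "\<And>n. continuous_on {a..b} (f n)"
    and bound: "\<And>n x. x \<in> {a..b} \<Longrightarrow> norm (f n x) \<le> M n" and M: "summable M"
  shows "(\<lambda>n. integral {a..b} (f n)) sums integral {a..b} (\<lambda>x. \<Sum>n. f n x)"
proof -
  have "uniform_limit {a..b} (\<lambda>N x. \<Sum>n<N. f n x) (\<lambda>x. \<Sum>n. f n x) sequentially"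
    by (rule Weierstrass_m_test[OF bound M])
  then obtain I J where I: "\<And>N. ((\<lambda>x. \<Sum>n<N. f n x) has_integral I N) {a..b}"
    and J: "((\<lambda>x. \<Sum>n. f n x) has_integral J) {a..b}" and lim: "I \<longlonglongrightarrow> J"
    by (rule uniform_limit_integral) (auto intro!: continuous_intros cont)
  have "I N = (\<Sum>n<N. integral {a..b} (f n))" for N
    using integral_unique[OF I[of N]]
    by (subst (asm) integral_sum) (auto intro: integrable_continuous_real cont)
  then have "I = (\<lambda>N. \<Sum>n<N. integral {a..b} (f n))" by (rule ext)
  then show ?thesis
    using lim integral_unique[OF J] by (simp only: sums_def)
qed

lemma cos_power_expand:
  "(2 * complex_of_real (cos t)) ^ n
     = (\<Sum>p\<le>n. of_nat (n choose p) * cis (of_int (2 * int p - int n) * t))"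
proof -
  have "2 * complex_of_real (cos t) = cis t + cis (- t)"
    by (simp add: complex_eq_iff)
  then have "(2 * complex_of_real (cos t)) ^ n
      = (\<Sum>p\<le>n. of_nat (n choose p) * cis t ^ p * cis (- t) ^ (n - p))"
    by (simp add: binomial_ring)
  also have "\<dots> = (\<Sum>p\<le>n. of_nat (n choose p) * cis (of_int (2 * int p - int n) * t))"
  proof (intro sum.cong refl)
    fix p assume "p \<in> {..n}"
    then have "real p * t + real (n - p) * - t = of_int (2 * int p - int n) * t"
      by (simp add: of_nat_diff algebra_simps)
    then have "cis t ^ p * cis (- t) ^ (n - p) = cis (of_int (2 * int p - int n) * t)"
      unfolding Complex.DeMoivre cis_mult by (rule arg_cong)
    then show "of_nat (n choose p) * cis t ^ p * cis (- t) ^ (n - p)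
        = of_nat (n choose p) * cis (of_int (2 * int p - int n) * t)"
      by (simp only: mult.assoc)
  qed
  finally show ?thesis .
qed

text \<open>The expansion of exp(i s cos psi) is used only after integration against a
  \<open>U\<close> all of whose frequencies outside a finite set are annihilated. Then the
  exponential series can be integrated term by term and regrouped into finitely many Bessel series,
  without an infinite sum over orders. A general \<open>\<psi>\<close> serves two purposes: Bessel's
  integral (a single order) and the representation of S (phase 2 theta).\<close>

lemma jacobi_anger_integral:
  fixes \<psi> :: "real \<Rightarrow> real" and U :: "real \<Rightarrow> complex"
  assumes \<psi>: "continuous_on {a..b} \<psi>" and U: "continuous_on {a..b} U" and N: "finite N"
    and zero: "\<And>m::int. m \<notin> (\<lambda>k. - int k) ` N \<Longrightarrow>
                 integral {a..b} (\<lambda>\<theta>. cis (of_int m * \<psi> \<theta>) * U \<theta>) = 0"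
  shows "integral {a..b} (\<lambda>\<theta>. cis (s * cos (\<psi> \<theta>)) * U \<theta>)
     = (\<Sum>k\<in>N. \<i> ^ k * of_real (bessel_int k s)
          * integral {a..b} (\<lambda>\<theta>. cis (- (real k * \<psi> \<theta>)) * U \<theta>))"
proof -
  define \<mu> where "\<mu> m = integral {a..b} (\<lambda>\<theta>. cis (of_int m * \<psi> \<theta>) * U \<theta>)" for m
  define f where "f n \<theta> = (\<i> * of_real (s * cos (\<psi> \<theta>))) ^ n / fact n * U \<theta>" for n \<theta>
  \<comment> \<open>\<open>h k n\<close> is the share of the n-th exponential term that belongs to
    order k; it can be nonzero only for n = 2p + k.\<close>
  define h where "h k n = (\<i> * of_real (s / 2)) ^ n *
      (\<Sum>p\<le>n. if n = 2 * p + k then \<mu> (- int k) / (fact p * fact (n - p)) else 0)" for k n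
  obtain B where "0 < B" "\<forall>x\<in>U ` {a..b}. norm x \<le> B"
    using compact_imp_bounded[OF compact_continuous_image[OF U compact_Icc]]
    unfolding bounded_pos by blast
  then have B: "\<And>\<theta>. \<theta> \<in> {a..b} \<Longrightarrow> norm (U \<theta>) \<le> B" "0 < B" by auto
  have cf: "continuous_on {a..b} (f n)" for n
    unfolding f_def by (intro continuous_intros \<psi> U) auto
  have bf: "norm (f n \<theta>) \<le> \<bar>s\<bar> ^ n / fact n * B" if "\<theta> \<in> {a..b}" for n \<theta>
  proof -
    have "\<bar>s * cos (\<psi> \<theta>)\<bar> \<le> \<bar>s\<bar> * 1"
      unfolding abs_mult by (intro mult_left_mono) auto
    then have "\<bar>s * cos (\<psi> \<theta>)\<bar> ^ n / fact n * norm (U \<theta>) \<le> \<bar>s\<bar> ^ n / fact n * B"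
      using B that by (intro mult_mono divide_right_mono power_mono) auto
    then show ?thesis
      by (simp add: f_def norm_mult norm_divide norm_power abs_mult)
  qed
  have "summable (\<lambda>n. \<bar>s\<bar> ^ n / fact n * B)"
    using summable_exp[of "\<bar>s\<bar>"] by (intro summable_mult2) (simp add: divide_inverse mult.commute)
  then have "(\<lambda>n. integral {a..b} (f n)) sums integral {a..b} (\<lambda>\<theta>. \<Sum>n. f n \<theta>)"
    by (intro sums_integral_uniform[OF cf bf])
  moreover have "(\<Sum>n. f n \<theta>) = cis (s * cos (\<psi> \<theta>)) * U \<theta>" for \<theta>
  proof -
    have "(\<lambda>n. f n \<theta>) sums (exp (\<i> * of_real (s * cos (\<psi> \<theta>))) * U \<theta>)"
      unfolding f_def using exp_converges[of "\<i> * of_real (s * cos (\<psi> \<theta>))"]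
      by (intro sums_mult2) (simp add: scaleR_conv_of_real divide_inverse mult.commute)
    then show ?thesis by (simp add: sums_iff cis_conv_exp)
  qed
  moreover have "integral {a..b} (f n) = (\<Sum>k\<in>N. h k n)" for n
  proof -
    have "f n \<theta> = (\<Sum>p\<le>n. (\<i> * of_real (s / 2)) ^ n / (fact p * fact (n - p))
             * (cis (of_int (2 * int p - int n) * \<psi> \<theta>) * U \<theta>))" for \<theta>
    proof -
      have "f n \<theta> = (\<i> * of_real (s / 2)) ^ n * (2 * complex_of_real (cos (\<psi> \<theta>))) ^ n / fact n * U \<theta>"
      proof -
        have "\<i> * of_real (s * cos (\<psi> \<theta>)) = (\<i> * of_real (s / 2)) * (2 * complex_of_real (cos (\<psi> \<theta>)))"
          by simp
        then show ?thesis unfolding f_def by (simp only: power_mult_distrib)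
      qed
      also have "\<dots> = (\<Sum>p\<le>n. (\<i> * of_real (s / 2)) ^ n * (of_nat (n choose p) / fact n)
             * (cis (of_int (2 * int p - int n) * \<psi> \<theta>) * U \<theta>))"
        unfolding cos_power_expand by (simp add: sum_distrib_left sum_distrib_right sum_divide_distrib mult_ac)
      also have "\<dots> = (\<Sum>p\<le>n. (\<i> * of_real (s / 2)) ^ n / (fact p * fact (n - p))
             * (cis (of_int (2 * int p - int n) * \<psi> \<theta>) * U \<theta>))"
        by (intro sum.cong refl) (simp add: binomial_fact)
      finally show ?thesis .
    qed
    then have fn: "f n = (\<lambda>\<theta>. \<Sum>p\<le>n. (\<i> * of_real (s / 2)) ^ n / (fact p * fact (n - p))
             * (cis (of_int (2 * int p - int n) * \<psi> \<theta>) * U \<theta>))"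
      by (rule ext)
    have "integral {a..b} (f n) = (\<Sum>p\<le>n. (\<i> * of_real (s / 2)) ^ n / (fact p * fact (n - p))
             * \<mu> (2 * int p - int n))"
      unfolding fn \<mu>_def
      by (subst integral_sum, auto intro!: integrable_continuous_real continuous_intros \<psi> U)
    also have "\<dots> = (\<Sum>p\<le>n. (\<i> * of_real (s / 2)) ^ n / (fact p * fact (n - p))
             * (\<Sum>k\<in>N. if n = 2 * p + k then \<mu> (- int k) else 0))"
    proof (intro sum.cong refl arg_cong2[of _ _ _ _ "(*)"])
      fix p
      show "\<mu> (2 * int p - int n) = (\<Sum>k\<in>N. if n = 2 * p + k then \<mu> (- int k) else 0)"
      proof (cases "2 * int p - int n \<in> (\<lambda>k. - int k) ` N")
        case True
        then obtain k where k: "k \<in> N" "2 * int p - int n = - int k" by auto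
        then have "(n = 2 * p + k') = (k' = k)" for k' by auto
        then show ?thesis using N k by simp
      next
        case False
        then have "(\<Sum>k\<in>N. if n = 2 * p + k then \<mu> (- int k) else 0) = 0"
          by (intro sum.neutral) (auto simp: image_iff)
        then show ?thesis using zero[OF False] by (simp add: \<mu>_def)
      qed
    qed
    also have "\<dots> = (\<Sum>p\<le>n. \<Sum>k\<in>N. (\<i> * of_real (s / 2)) ^ n *
        (if n = 2 * p + k then \<mu> (- int k) / (fact p * fact (n - p)) else 0))"
      unfolding sum_distrib_left by (intro sum.cong refl) auto
    also have "\<dots> = (\<Sum>k\<in>N. h k n)"
      unfolding h_def sum_distrib_left by (rule sum.swap)
    finally show ?thesis .
  qed
  moreover have "(\<lambda>n. \<Sum>k\<in>N. h k n) sums (\<Sum>k\<in>N. \<i> ^ k * of_real (bessel_int k s) * \<mu> (- int k))"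
  proof (rule sums_sum)
    fix k assume "k \<in> N"
    have hk: "h k (2 * p + k) = \<i> ^ k * \<mu> (- int k) *
        of_real ((-1) ^ p / (fact p * fact (p + k)) * (s / 2) ^ (2 * p + k))" for p
    proof -
      have "(\<Sum>q\<le>2 * p + k. if 2 * p + k = 2 * q + k
                 then \<mu> (- int k) / (fact q * fact (2 * p + k - q)) else 0)
          = (\<Sum>q\<le>2 * p + k. if q = p then \<mu> (- int k) / (fact p * fact (p + k)) else 0)"
        by (intro sum.cong refl) (auto simp: algebra_simps)
      moreover have "(\<i> * of_real (s / 2)) ^ (2 * p + k) = \<i> ^ k * ((-1) ^ p * of_real ((s / 2) ^ (2 * p + k)))"
        unfolding power_mult_distrib of_real_power by (simp add: power_add power_mult)
      ultimately show ?thesis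
        unfolding h_def by simp
    qed
    have "(\<lambda>p. h k (2 * p + k)) sums (\<i> ^ k * \<mu> (- int k) * of_real (bessel_int k s))"
      unfolding hk bessel_int_def
      by (intro sums_mult sums_of_real summable_sums summable_bessel_int)
    \<comment> \<open>Reindexing along n = 2p + k loses nothing, since \<open>h k\<close> vanishes
      at all other n.\<close>
    then show "h k sums (\<i> ^ k * of_real (bessel_int k s) * \<mu> (- int k))"
      by (subst (asm) sums_mono_reindex)
         (auto simp: strict_mono_def h_def image_iff mult_ac intro!: sum.neutral)
  qed
  ultimately show ?thesis
    using sums_unique2 unfolding \<mu>_def by simp
qed

lemma has_vector_derivative_cis [derivative_intros]:
  assumes "(f has_real_derivative f') (at x within A)"
  shows "((\<lambda>x. cis (f x)) has_vector_derivative \<i> * of_real f' * cis (f x)) (at x within A)"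
  using has_derivative_cis[OF assms[unfolded has_field_derivative_def]]
  by (simp add: has_vector_derivative_def scaleR_conv_of_real mult_ac)

lemma integral_cis_period:
  "integral {-pi..pi} (\<lambda>\<theta>. cis (of_int m * \<theta> + c)) = (if m = 0 then 2 * of_real pi * cis c else 0)"
proof (cases "m = 0")
  case False
  have "((\<lambda>\<theta>. cis (of_int m * \<theta> + c) / (\<i> * of_int m)) has_vector_derivative
         cis (of_int m * \<theta> + c)) (at \<theta> within {-pi..pi})" for \<theta>
    by (rule has_vector_derivative_eq_rhs[OF has_vector_derivative_divide[OF has_vector_derivative_cis]])
       (use False in \<open>auto intro!: derivative_eq_intros\<close>)
  then have "((\<lambda>\<theta>. cis (of_int m * \<theta> + c)) has_integral
      cis (of_int m * pi + c) / (\<i> * of_int m) - cis (of_int m * - pi + c) / (\<i> * of_int m)) {-pi..pi}"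
    by (intro fundamental_theorem_of_calculus) auto
  moreover have "cis (of_int m * pi + c) = cis (of_int m * - pi + c) * cis (2 * pi * of_int m)"
    by (simp add: cis_mult algebra_simps)
  ultimately show ?thesis
    using False by (auto dest: integral_unique)
qed (simp add: scaleR_conv_of_real)

text \<open>Bessel's integral: with psi = pi/2 - theta, so that cos psi = sin theta, and U =
  \<open>cis (- (n * \<theta>))\<close> only the order n survives. The factor i^n cancels against
  the phase \<open>cis (- n * pi / 2)\<close> coming from the shift by pi/2.\<close>

lemma bessel_int_integral:
  "integral {-pi..pi} (\<lambda>\<theta>. cis (x * sin \<theta> - real n * \<theta>)) = 2 * of_real pi * of_real (bessel_int n x)"
proof -
  have 1: "cis (of_int m * (pi / 2 - \<theta>)) * cis (- (real n * \<theta>))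
      = cis (of_int (- m - int n) * \<theta> + of_int m * pi / 2)" for m \<theta>
    by (simp add: cis_mult algebra_simps)
  have "integral {-pi..pi} (\<lambda>\<theta>. cis (x * cos (pi / 2 - \<theta>)) * cis (- (real n * \<theta>)))
     = (\<Sum>k\<in>{n}. \<i> ^ k * of_real (bessel_int k x)
          * integral {-pi..pi} (\<lambda>\<theta>. cis (- (real k * (pi / 2 - \<theta>))) * cis (- (real n * \<theta>))))"
    by (intro jacobi_anger_integral)
       (auto intro!: continuous_intros simp only: 1 integral_cis_period, auto)
  also have "\<dots> = \<i> ^ n * of_real (bessel_int n x) * (2 * of_real pi * cis (- real n * pi / 2))"
    using 1[of "- int n"] integral_cis_period[of 0 "- real n * pi / 2"] by simp
  also have "\<i> ^ n * cis (- real n * pi / 2) = 1"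
  proof -
    have "\<i> ^ n = cis (real n * (pi / 2))" unfolding Complex.DeMoivre[symmetric] by simp
    then show ?thesis by (simp add: cis_mult)
  qed
  then have "\<i> ^ n * of_real (bessel_int n x) * (2 * of_real pi * cis (- real n * pi / 2))
     = 2 * of_real pi * of_real (bessel_int n x)"
    by (metis (no_types, lifting) mult.assoc mult.commute mult_1)
  finally show ?thesis
    by (simp add: cis_mult cos_diff)
qed

lemma abs_bessel_int_le_1: "\<bar>bessel_int n x\<bar> \<le> 1"
proof -
  have "norm (integral {-pi..pi} (\<lambda>\<theta>. cis (x * sin \<theta> - real n * \<theta>))) \<le> 1 * (pi - - pi)"
    by (rule integral_bound) (auto intro!: continuous_intros)
  then show ?thesis by (simp add: bessel_int_integral norm_mult)
qed

section \<open>Fourier inversion\<close>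

definition fourier_Icc :: "real \<Rightarrow> real \<Rightarrow> (real \<Rightarrow> complex) \<Rightarrow> real \<Rightarrow> complex" where
  "fourier_Icc a b u t = integral {a..b} (\<lambda>y. u y * cis (- (t * y))) / (2 * of_real pi)"

lemma continuous_fourier_Icc:
  assumes "continuous_on {a..b} u"
  shows "continuous_on A (fourier_Icc a b u)"
proof -
  have "continuous_on (UNIV \<times> {a..b}) (\<lambda>p. u (snd p))"
    by (rule continuous_on_compose2[OF assms]) (auto intro!: continuous_intros)
  then have "continuous_on (UNIV \<times> {a..b}) (\<lambda>(t, y). u y * cis (- (t * y)))"
    unfolding case_prod_beta by (intro continuous_intros)
  then have "continuous_on UNIV (\<lambda>t. integral {a..b} (\<lambda>y. u y * cis (- (t * y))))"
    using integral_continuous_on_param[of UNIV a b "\<lambda>t y. u y * cis (- (t * y))"] by simp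
  then have "continuous_on UNIV (fourier_Icc a b u)"
    unfolding fourier_Icc_def by (intro continuous_intros) auto
  then show ?thesis using continuous_on_subset by blast
qed

lemma norm_fourier_Icc_le:
  assumes "a \<le> b" "continuous_on {a..b} u" "\<And>y. y \<in> {a..b} \<Longrightarrow> norm (u y) \<le> B"
  shows "norm (fourier_Icc a b u t) \<le> B * (b - a) / (2 * pi)"
proof -
  have "norm (integral {a..b} (\<lambda>y. u y * cis (- (t * y)))) \<le> B * (b - a)"
    using assms by (intro integral_bound continuous_intros) (auto simp: norm_mult)
  then show ?thesis
    unfolding fourier_Icc_def by (simp add: norm_divide norm_mult divide_right_mono)
qed

text \<open>Integration by parts; the boundary terms vanish because u is 0 at both ends.\<close>

lemma fourier_Icc_deriv:
  assumes "a \<le> b" and u: "\<And>y. y \<in> {a..b} \<Longrightarrow> (u has_vector_derivative u' y) (at y within {a..b})"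
    and u': "continuous_on {a..b} u'" and "u a = 0" "u b = 0"
  shows "fourier_Icc a b u' t = \<i> * of_real t * fourier_Icc a b u t"
proof -
  have "((\<lambda>y. u y * (\<i> * of_real (- t) * cis (- (t * y))) + u' y * cis (- (t * y))) has_integral
      u b * cis (- (t * b)) - u a * cis (- (t * a))) {a..b}"
    by (intro fundamental_theorem_of_calculus assms(1) has_vector_derivative_mult u has_vector_derivative_cis)
       (auto intro!: derivative_eq_intros)
  moreover have "(\<lambda>y. u y * cis (- (t * y))) integrable_on {a..b}"
    by (intro integrable_continuous_real continuous_intros continuous_on_vector_derivative[OF u])
  then have "((\<lambda>y. \<i> * of_real t * (u y * cis (- (t * y)))) has_integral
      \<i> * of_real t * integral {a..b} (\<lambda>y. u y * cis (- (t * y)))) {a..b}"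
    by (intro has_integral_mult_right) (auto simp: has_integral_integral)
  ultimately have "((\<lambda>y. (u y * (\<i> * of_real (- t) * cis (- (t * y))) + u' y * cis (- (t * y)))
       + \<i> * of_real t * (u y * cis (- (t * y)))) has_integral
      (u b * cis (- (t * b)) - u a * cis (- (t * a)))
       + \<i> * of_real t * integral {a..b} (\<lambda>y. u y * cis (- (t * y)))) {a..b}"
    by (rule has_integral_add)
  then have "((\<lambda>y. u' y * cis (- (t * y))) has_integral
       \<i> * of_real t * integral {a..b} (\<lambda>y. u y * cis (- (t * y)))) {a..b}"
    using assms(4,5) by (simp add: algebra_simps)
  then show ?thesis
    unfolding fourier_Icc_def by (simp add: integral_unique)
qed

text \<open>Bridges a gauge integral over [a, b] and a Lebesgue integral over the line: multiplying
  by the indicator of [a, b] makes both Lebesgue integrals, and |phi| B is an integrable majorant.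
  It is used with a Gaussian phi in the inversion formula and with the transform of w in the Fourier
  coefficients of \<open>multiplier\<close>.\<close>

lemma fubini_Icc_lborel:
  fixes k :: "real \<Rightarrow> real \<Rightarrow> complex" and \<phi> :: "real \<Rightarrow> complex"
  assumes \<phi>: "integrable lborel \<phi>" and k: "continuous_on UNIV (\<lambda>(y, t). k y t)"
    and B: "\<And>y t. y \<in> {a..b} \<Longrightarrow> norm (k y t) \<le> B"
  shows "integral {a..b} (\<lambda>y. LINT t|lborel. \<phi> t * k y t)
       = (LINT t|lborel. \<phi> t * integral {a..b} (\<lambda>y. k y t))"
proof -
  define F where "F y t = indicator {a..b} y *\<^sub>R (\<phi> t * k y t)" for y t
  have mk [measurable]: "(\<lambda>(y, t). k y t) \<in> borel_measurable (borel \<Otimes>\<^sub>M borel)"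
    using borel_measurable_continuous_onI[OF k] by (simp add: borel_prod)
  have [measurable]: "\<phi> \<in> borel_measurable borel" using \<phi> by auto
  have mF [measurable]: "(\<lambda>(y, t). F y t) \<in> borel_measurable (borel \<Otimes>\<^sub>M borel)"
    unfolding F_def by measurable
  have mky [measurable]: "k y \<in> borel_measurable borel" for y
    by (intro borel_measurable_continuous_onI continuous_on_compose2[OF k, of _ "\<lambda>t. (y, t)", simplified])
       (auto intro!: continuous_intros)
  have bF: "norm (F y t) \<le> norm (\<phi> t * of_real B)" for y t
    using B[of y t] by (auto simp: F_def norm_mult indicator_def intro!: mult_left_mono)
  have iF: "integrable lborel (F y)" for y
  proof (rule Bochner_Integration.integrable_bound[OF integrable_mult_left[OF \<phi>, of "of_real B"]])
    show "F y \<in> borel_measurable lborel" unfolding F_def by measurable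
  qed (intro AE_I2 bF)
  have "integrable lborel (\<lambda>y. LINT t|lborel. norm (F y t))"
  proof (rule Bochner_Integration.integrable_bound)
    show "integrable lborel (\<lambda>y. indicator {a..b} y * (LINT t|lborel. norm (\<phi> t * of_real B)))"
      by (intro integrable_mult_left) (auto intro!: integrable_real_indicator simp: emeasure_lborel_Icc_eq)
    show "AE y in lborel. norm (LINT t|lborel. norm (F y t))
        \<le> norm (indicator {a..b} y * (LINT t|lborel. norm (\<phi> t * of_real B)))"
    proof (rule AE_I2)
      fix y
      show "norm (LINT t|lborel. norm (F y t))
        \<le> norm (indicator {a..b} y * (LINT t|lborel. norm (\<phi> t * of_real B)))"
      proof (cases "y \<in> {a..b}")
        case True
        have "(LINT t|lborel. norm (F y t)) \<le> (LINT t|lborel. norm (\<phi> t * of_real B))"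
          by (intro integral_mono integrable_norm iF integrable_mult_left[OF \<phi>] bF)
        then show ?thesis using True by (simp add: abs_of_nonneg Bochner_Integration.integral_nonneg)
      qed (simp add: F_def)
    qed
  qed measurable
  then have int: "integrable (lborel \<Otimes>\<^sub>M lborel) (\<lambda>(y, t). F y t)"
    by (intro lborel_pair.Fubini_integrable) (auto simp: iF)
  have "set_integrable lborel {a..b} (\<lambda>y. LINT t|lborel. \<phi> t * k y t)"
    using lborel_pair.integrable_fst[OF int] unfolding set_integrable_def F_def by simp
  then have "integral {a..b} (\<lambda>y. LINT t|lborel. \<phi> t * k y t) = (LINT y:{a..b}|lborel. LINT t|lborel. \<phi> t * k y t)"
    by (rule set_borel_integral_eq_integral(2)[symmetric])
  also have "\<dots> = (LINT y|lborel. LINT t|lborel. F y t)"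
    unfolding set_lebesgue_integral_def
    by (intro Bochner_Integration.integral_cong refl) (simp add: F_def indicator_def)
  also have "\<dots> = (LINT t|lborel. LINT y|lborel. F y t)"
    by (rule lborel_pair.Fubini_integral[OF int, symmetric])
  also have "\<dots> = (LINT t|lborel. \<phi> t * integral {a..b} (\<lambda>y. k y t))"
  proof (intro Bochner_Integration.integral_cong refl)
    fix t
    have "continuous_on {a..b} (\<lambda>y. k y t)"
      by (rule continuous_on_compose2[OF k, of _ "\<lambda>y. (y, t)", simplified]) (auto intro!: continuous_intros)
    then have "set_integrable lborel {a..b} (\<lambda>y. k y t)" by (rule borel_integrable_atLeastAtMost')
    then have "integral {a..b} (\<lambda>y. k y t) = (LINT y|lborel. indicator {a..b} y *\<^sub>R k y t)"
      by (simp add: set_borel_integral_eq_integral(2)[symmetric] set_lebesgue_integral_def)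
    then show "(LINT y|lborel. F y t) = \<phi> t * integral {a..b} (\<lambda>y. k y t)"
      unfolding F_def by (simp flip: mult_scaleR_right)
  qed
  finally show ?thesis .
qed

text \<open>The characteristic function of the standard normal distribution, rescaled by s = d t.
  Written as 2 pi times a normal density, the result shows at once that the regularised inverse
  transform is an average against a probability density.\<close>

lemma gaussian_fourier:
  assumes d: "0 < d"
  shows "integrable lborel (\<lambda>t. of_real (exp (- (d * t)\<^sup>2 / 2)) * cis (t * v))" (is ?i)
    and "(LINT t|lborel. of_real (exp (- (d * t)\<^sup>2 / 2)) * cis (t * v))
      = of_real (2 * pi * normal_density 0 d v)" (is ?e)
proof -
  let ?h = "\<lambda>s. of_real (exp (- s\<^sup>2 / 2)) * cis (s * (v / d)) :: complex"
  have h: "?h s = of_real (sqrt (2 * pi)) * (std_normal_density s *\<^sub>R iexp (v / d * s))" for s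
    by (simp add: normal_density_def scaleR_conv_of_real cis_conv_exp mult_ac)
  have ih: "integrable lborel ?h"
  proof -
    have "integrable lborel (\<lambda>s. std_normal_density s *\<^sub>R iexp (v / d * s))"
      by (rule Bochner_Integration.integrable_bound[OF integrable_normal_density[of 1 0]]) auto
    then show ?thesis unfolding h by (intro integrable_mult_right)
  qed
  have "(LINT s|lborel. std_normal_density s *\<^sub>R iexp (v / d * s)) = char std_normal_distribution (v / d)"
    unfolding char_def by (subst integral_density) auto
  then have eh: "(LINT s|lborel. ?h s) = of_real (sqrt (2 * pi) * exp (- (v / d)\<^sup>2 / 2))"
    unfolding h integral_mult_right_zero by (simp add: char_std_normal_distribution)
  have sub: "of_real (exp (- (d * t)\<^sup>2 / 2)) * cis (t * v) = ?h (0 + d * t)" for t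
    using d by simp
  show ?i
    unfolding sub using lborel_integrable_real_affine[OF ih, of d 0] d by simp
  have "(LINT s|lborel. ?h s) = \<bar>d\<bar> *\<^sub>R (LINT t|lborel. ?h (0 + d * t))"
    by (rule lborel_integral_real_affine) (use d in auto)
  then have "(LINT t|lborel. ?h (0 + d * t)) = of_real (sqrt (2 * pi) * exp (- (v / d)\<^sup>2 / 2) / d)"
    unfolding eh using d by (simp add: scaleR_conv_of_real field_simps)
  moreover have "sqrt (2 * pi) * exp (- (v / d)\<^sup>2 / 2) / d = 2 * pi * normal_density 0 d v"
    using d by (simp add: normal_density_def real_sqrt_mult power_divide field_simps)
  ultimately show ?e unfolding sub by (simp only:)
qed

text \<open>The inverse transform is compared with its Gaussian regularisation of width \<open>d\<close>, which is the
  average of \<open>u\<close> over a normal distribution with standard deviation \<open>d\<close> around \<open>x\<close>.\<close>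

lemma fourier_inversion:
  assumes u: "continuous_on UNIV u" and zero: "\<And>y. y \<notin> {a..b} \<Longrightarrow> u y = 0"
    and lip: "\<And>x y. norm (u x - u y) \<le> \<Lambda> * \<bar>x - y\<bar>"
    and int: "integrable lborel (fourier_Icc a b u)"
    and int2: "integrable lborel (\<lambda>t. t\<^sup>2 * norm (fourier_Icc a b u t))"
  shows "(LINT t|lborel. fourier_Icc a b u t * cis (t * x)) = u x"
proof -
  define m where "m = (LINT t|lborel. t\<^sup>2 * norm (fourier_Icc a b u t)) / 2"
  \<comment> \<open>Two errors are added. Inserting the Gaussian costs at most (d t)^2 / 2 at
    frequency t, hence d^2 m by the second moment of the transform. Replacing the average of u by u
    x costs at most Lambda times the mean distance from x, which is d sqrt(2/pi) <= d. Finally d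
    tends to 0.\<close>
  have key: "norm ((LINT t|lborel. fourier_Icc a b u t * cis (t * x)) - u x) \<le> d\<^sup>2 * m + \<Lambda> * d"
    if d: "0 < d" for d
  proof -
    define J where "J = (LINT t|lborel. fourier_Icc a b u t * cis (t * x) * of_real (exp (- (d * t)\<^sup>2 / 2)))"
    have [measurable]: "fourier_Icc a b u \<in> borel_measurable borel" using int by auto
    have [measurable]: "u \<in> borel_measurable borel" using u by (rule borel_measurable_continuous_onI)
    have cism [measurable]: "(\<lambda>t. cis (t * c)) \<in> borel_measurable borel" for c
      by (intro borel_measurable_continuous_onI continuous_intros)
    have i1: "integrable lborel (\<lambda>t. fourier_Icc a b u t * cis (t * x))"
      by (rule Bochner_Integration.integrable_bound[OF int]) (auto simp: norm_mult)
    have i2: "integrable lborel (\<lambda>t. fourier_Icc a b u t * cis (t * x) * of_real (exp (- (d * t)\<^sup>2 / 2)))"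
      by (rule Bochner_Integration.integrable_bound[OF int])
         (auto simp: norm_mult intro!: mult_left_le)
    have "norm ((LINT t|lborel. fourier_Icc a b u t * cis (t * x)) - J)
       = norm (LINT t|lborel. fourier_Icc a b u t * cis (t * x) * of_real (1 - exp (- (d * t)\<^sup>2 / 2)))"
      unfolding J_def by (subst Bochner_Integration.integral_diff[OF i1 i2, symmetric])
        (simp add: algebra_simps)
    also have "\<dots> \<le> (LINT t|lborel. d\<^sup>2 / 2 * (t\<^sup>2 * norm (fourier_Icc a b u t)))"
    proof (rule Bochner_Integration.integral_norm_bound_integral)
      show "integrable lborel (\<lambda>t. fourier_Icc a b u t * cis (t * x) * of_real (1 - exp (- (d * t)\<^sup>2 / 2)))"
        using Bochner_Integration.integrable_diff[OF i1 i2] by (simp add: algebra_simps)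
      show "integrable lborel (\<lambda>t. d\<^sup>2 / 2 * (t\<^sup>2 * norm (fourier_Icc a b u t)))"
        by (intro integrable_mult_right int2)
      fix t
      have "1 + (- (d * t)\<^sup>2 / 2) \<le> exp (- (d * t)\<^sup>2 / 2)" by (rule exp_ge_add_one_self)
      then have "\<bar>1 - exp (- (d * t)\<^sup>2 / 2)\<bar> \<le> d\<^sup>2 / 2 * t\<^sup>2" by (simp add: power_mult_distrib)
      from mult_left_mono[OF this norm_ge_zero[of "fourier_Icc a b u t"]]
      show "norm (fourier_Icc a b u t * cis (t * x) * of_real (1 - exp (- (d * t)\<^sup>2 / 2)))
        \<le> d\<^sup>2 / 2 * (t\<^sup>2 * norm (fourier_Icc a b u t))"
        by (simp only: norm_mult norm_cis norm_of_real mult_1_right mult_1_left mult_ac)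
    qed
    also have "\<dots> = d\<^sup>2 * m" by (simp add: m_def)
    finally have 1: "norm ((LINT t|lborel. fourier_Icc a b u t * cis (t * x)) - J) \<le> d\<^sup>2 * m" .

    obtain B where "\<forall>y\<in>u ` {a..b}. norm y \<le> B"
      using compact_imp_bounded[OF compact_continuous_image[OF continuous_on_subset[OF u] compact_Icc]]
      unfolding bounded_iff by blast
    then have B: "norm (u y * cis c) \<le> B" if "y \<in> {a..b}" for y c
      using that by (auto simp: norm_mult)
    have "J = (LINT t|lborel. (of_real (exp (- (d * t)\<^sup>2 / 2)) * cis (t * x)) / (2 * of_real pi)
        * integral {a..b} (\<lambda>y. u y * cis (- (t * y))))"
      unfolding J_def fourier_Icc_def by (simp add: mult_ac)
    also have "\<dots> = integral {a..b} (\<lambda>y. LINT t|lborel. (of_real (exp (- (d * t)\<^sup>2 / 2)) * cis (t * x)) / (2 * of_real pi)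
        * (u y * cis (- (t * y))))"
      by (rule fubini_Icc_lborel[OF integrable_divide[OF gaussian_fourier(1)[OF d]] _ B, symmetric])
         (auto simp: case_prod_beta intro!: continuous_intros continuous_on_compose2[OF u])
    also have "\<dots> = integral {a..b} (\<lambda>y. normal_density x d y *\<^sub>R u y)"
    proof (intro integral_cong)
      fix y
      have "(LINT t|lborel. (of_real (exp (- (d * t)\<^sup>2 / 2)) * cis (t * x)) / (2 * of_real pi) * (u y * cis (- (t * y))))
         = (LINT t|lborel. u y / (2 * of_real pi) * (of_real (exp (- (d * t)\<^sup>2 / 2)) * cis (t * (x - y))))"
      proof (intro Bochner_Integration.integral_cong refl)
        fix t
        have "cis (t * (x - y)) = cis (t * x) * cis (- (t * y))"
          unfolding cis_mult by (rule arg_cong) (simp add: algebra_simps)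
        then show "(of_real (exp (- (d * t)\<^sup>2 / 2)) * cis (t * x)) / (2 * of_real pi) * (u y * cis (- (t * y)))
            = u y / (2 * of_real pi) * (of_real (exp (- (d * t)\<^sup>2 / 2)) * cis (t * (x - y)))"
          by simp
      qed
      also have "\<dots> = normal_density x d y *\<^sub>R u y"
        unfolding integral_mult_right_zero gaussian_fourier(2)[OF d]
        by (simp add: scaleR_conv_of_real normal_density_def power2_commute)
      finally show "(LINT t|lborel. (of_real (exp (- (d * t)\<^sup>2 / 2)) * cis (t * x)) / (2 * of_real pi) * (u y * cis (- (t * y))))
         = normal_density x d y *\<^sub>R u y" .
    qed
    also have "\<dots> = (LINT y|lborel. normal_density x d y *\<^sub>R u y)"
    proof -
      have "set_integrable lborel {a..b} (\<lambda>y. normal_density x d y *\<^sub>R u y)"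
        by (intro borel_integrable_atLeastAtMost' continuous_intros continuous_on_subset[OF u])
           (use d in \<open>auto simp: normal_density_def intro!: continuous_intros\<close>)
      then have "integral {a..b} (\<lambda>y. normal_density x d y *\<^sub>R u y)
          = (LINT y|lborel. indicator {a..b} y *\<^sub>R (normal_density x d y *\<^sub>R u y))"
        by (simp add: set_borel_integral_eq_integral(2)[symmetric] set_lebesgue_integral_def)
      also have "\<dots> = (LINT y|lborel. normal_density x d y *\<^sub>R u y)"
        by (intro Bochner_Integration.integral_cong refl) (use zero in \<open>auto simp: indicator_def\<close>)
      finally show ?thesis .
    qed
    finally have J: "J = (LINT y|lborel. normal_density x d y *\<^sub>R u y)" .
    have in1: "integrable lborel (\<lambda>y. normal_density x d y * \<bar>y - x\<bar>)"
      using integrable_normal_moment_abs[OF d, of x 1] by simp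
    have bnd: "norm (normal_density x d y *\<^sub>R (u y - u x)) \<le> \<Lambda> * (normal_density x d y * \<bar>y - x\<bar>)" for y
      using mult_left_mono[OF lip[of y x] normal_density_nonneg[of x d y]] by (simp add: mult.left_commute)
    have in2: "integrable lborel (\<lambda>y. normal_density x d y *\<^sub>R (u y - u x))"
    proof (rule Bochner_Integration.integrable_bound[OF integrable_mult_right[OF in1, of \<Lambda>]])
      show "AE y in lborel. norm (normal_density x d y *\<^sub>R (u y - u x))
          \<le> norm (\<Lambda> * (normal_density x d y * \<bar>y - x\<bar>))"
        by (intro AE_I2) (use bnd abs_ge_self order_trans in \<open>fastforce simp only: real_norm_def\<close>)
    qed measurable
    have in3: "integrable lborel (\<lambda>y. normal_density x d y *\<^sub>R u x)"
      using integrable_normal_density[OF d] by (intro integrable_scaleR_left) auto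
    have "J = (LINT y|lborel. normal_density x d y *\<^sub>R (u y - u x) + normal_density x d y *\<^sub>R u x)"
      unfolding J by (simp add: algebra_simps)
    also have "\<dots> = (LINT y|lborel. normal_density x d y *\<^sub>R (u y - u x)) + u x"
      using d by (subst Bochner_Integration.integral_add[OF in2 in3]) simp
    finally have "norm (J - u x) = norm (LINT y|lborel. normal_density x d y *\<^sub>R (u y - u x))" by simp
    also have "\<dots> \<le> (LINT y|lborel. \<Lambda> * (normal_density x d y * \<bar>y - x\<bar>))"
      by (rule Bochner_Integration.integral_norm_bound_integral[OF in2 integrable_mult_right[OF in1] bnd])
    also have "\<dots> = \<Lambda> * (d * sqrt (2 / pi))"
      using integral_normal_moment_abs_odd[OF d, of x 0] by simp
    also have "\<dots> \<le> \<Lambda> * (d * 1)"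
    proof (intro mult_left_mono)
      show "0 \<le> \<Lambda>" using order_trans[OF norm_ge_zero lip[of 1 0]] by simp
    qed (use d pi_ge_two in auto)
    finally have 2: "norm (J - u x) \<le> \<Lambda> * d" by simp
    show ?thesis
      using norm_triangle_mono[OF 1 2] by simp
  qed
  have "((\<lambda>d. d\<^sup>2 * m + \<Lambda> * d) \<longlongrightarrow> 0\<^sup>2 * m + \<Lambda> * 0) (at_right 0)"
    by (intro tendsto_intros)
  then have "norm ((LINT t|lborel. fourier_Icc a b u t * cis (t * x)) - u x) \<le> 0\<^sup>2 * m + \<Lambda> * 0"
    by (rule tendsto_lowerbound)
       (auto intro: eventually_mono[OF eventually_at_right_less[of 0] key])
  then show ?thesis by simp
qed

section \<open>Stationary phase\<close>

text \<open>The sign in the exponent is that of the quadratic phase for sigma = 1; the case sigma =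
  -1 is reduced to it by conjugation.\<close>

definition fresnel :: "real \<Rightarrow> complex" where
  "fresnel s = integral {0..s} (\<lambda>r. cis (- r\<^sup>2))"

lemma fresnel_deriv:
  assumes "0 \<le> s" 
  shows "(fresnel has_vector_derivative cis (- s\<^sup>2)) (at s within {0..})"
proof -
  have "(fresnel has_vector_derivative cis (- s\<^sup>2)) (at s within {0..s + 1})"
    unfolding fresnel_def
    by (rule integral_has_vector_derivative) (use assms in \<open>auto intro!: continuous_intros\<close>)
  moreover have "at s within {0..s + 1} = at s within {0..}"
    by (rule at_within_nhd[of _ "{..< s + 1}"]) auto
  ultimately show ?thesis by simp
qed

text \<open>The correction is the start of the tail expansion obtained by integrating by parts
  twice. It leaves an error of order s^(-3), so that one more antiderivative of the tail still
  decays like s^(-2) once its leading oscillation is removed, and is integrable.\<close>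

lemma fresnel_limit:
  obtains L where "norm L \<le> 2"
    "\<And>s. 1 \<le> s \<Longrightarrow> norm (fresnel s - L + cis (- s\<^sup>2) * (1 / (2 * \<i> * of_real s) + 1 / (4 * of_real s ^ 3)))
        \<le> 1 / (4 * s ^ 3)"
proof -
  \<comment> \<open>the first two terms of the asymptotic expansion of the tail; adding them makes the derivative integrable\<close>
  define q where "q s = cis (- s\<^sup>2) * (1 / (2 * \<i> * of_real s) + 1 / (4 * of_real s ^ 3))" for s :: real
  define d where "d s = fresnel s + q s" for s
  have dd: "(d has_vector_derivative - (3 / 4) * cis (- s\<^sup>2) / of_real s ^ 4) (at s within {1..})"
    if "1 \<le> s" for s
  proof -
    have r: "((\<lambda>s. 1 / (2 * \<i> * of_real s) + 1 / (4 * of_real s ^ 3) :: complex) has_vector_derivative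
        (- (1 / (2 * \<i> * of_real s ^ 2)) - 3 / (4 * of_real s ^ 4))) (at s within {1..})"
    proof -
      have "((\<lambda>z. 1 / (2 * \<i> * z) + 1 / (4 * z ^ 3) :: complex) has_field_derivative
        (- (1 / (2 * \<i> * of_real s ^ 2)) - 3 / (4 * of_real s ^ 4))) (at (of_real s))"
        using that by (auto intro!: derivative_eq_intros simp: field_simps power2_eq_square power4_eq_xxxx power3_eq_cube)
      from has_vector_derivative_real_field[OF this] show ?thesis by simp
    qed
    have c: "((\<lambda>s. cis (- s\<^sup>2)) has_vector_derivative \<i> * of_real (- (2 * s)) * cis (- s\<^sup>2)) (at s within {1..})"
      by (auto intro!: has_vector_derivative_cis derivative_eq_intros)
    have f: "(fresnel has_vector_derivative cis (- s\<^sup>2)) (at s within {1..})"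
      by (rule has_vector_derivative_within_subset[OF fresnel_deriv]) (use that in auto)
    show ?thesis
      unfolding d_def q_def
      by (rule has_vector_derivative_eq_rhs[OF has_vector_derivative_add[OF f has_vector_derivative_mult[OF c r]]])
         (use that in \<open>auto simp: field_simps power2_eq_square power4_eq_xxxx power3_eq_cube\<close>)
  qed
  have step: "norm (d t - d s) \<le> 1 / (4 * s ^ 3)" if "1 \<le> s" "s \<le> t" for s t
  proof -
    have I1: "((\<lambda>r. - (3 / 4) * cis (- r\<^sup>2) / of_real r ^ 4) has_integral d t - d s) {s..t}"
      by (intro fundamental_theorem_of_calculus has_vector_derivative_within_subset[OF dd])
         (use that in auto)
    have I2: "((\<lambda>r. 3 / 4 / r ^ 4) has_integral (- 1 / (4 * t ^ 3)) - (- 1 / (4 * s ^ 3))) {s..t}"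
    proof (intro fundamental_theorem_of_calculus)
      fix r assume r: "r \<in> {s..t}"
      have "((\<lambda>r. - 1 / (4 * r ^ 3)) has_real_derivative 3 / 4 / r ^ 4) (at r within {s..t})"
        using r that by (auto intro!: derivative_eq_intros simp: field_simps power4_eq_xxxx power3_eq_cube)
      then show "((\<lambda>r. - 1 / (4 * r ^ 3)) has_vector_derivative 3 / 4 / r ^ 4) (at r within {s..t})"
        by (simp add: has_real_derivative_iff_has_vector_derivative)
    qed (use that in auto)
    have "norm (integral {s..t} (\<lambda>r. - (3 / 4) * cis (- r\<^sup>2) / of_real r ^ 4)) \<le> integral {s..t} (\<lambda>r. 3 / 4 / r ^ 4)"
      using that by (intro integral_norm_bound_integral has_integral_integrable[OF I1] has_integral_integrable[OF I2])
        (simp add: norm_mult norm_divide norm_power)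
    then have "norm (d t - d s) \<le> (- 1 / (4 * t ^ 3)) - (- 1 / (4 * s ^ 3))"
      unfolding integral_unique[OF I1] integral_unique[OF I2] .
    then show ?thesis using that by (smt (verit) divide_nonneg_nonneg minus_divide_left zero_le_power)
  qed
  have "Cauchy (\<lambda>n. d (real n + 1))"
  proof (rule CauchyI')
    fix e :: real assume e: "0 < e"
    obtain M where M: "1 / e < real M" using reals_Archimedean2 by blast
    show "\<exists>M. \<forall>m\<ge>M. \<forall>n>m. dist (d (real m + 1)) (d (real n + 1)) < e"
    proof (rule exI[of _ M], intro allI impI)
      fix m n assume mn: "m \<ge> M" "n > m"
      have "norm (d (real n + 1) - d (real m + 1)) \<le> 1 / (4 * (real m + 1) ^ 3)"
        using mn by (intro step) auto
      also have "\<dots> \<le> 1 / (real m + 1)"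
        using self_le_power[of "real m + 1" 3] by (intro divide_left_mono) auto
      also have "\<dots> < e" using M mn e by (simp add: field_simps) (smt (verit) mult_left_mono of_nat_mono)
      finally show "dist (d (real m + 1)) (d (real n + 1)) < e" by (simp add: dist_norm norm_minus_commute)
    qed
  qed
  then obtain L where L: "(\<lambda>n. d (real n + 1)) \<longlonglongrightarrow> L"
    using Cauchy_convergent convergent_def by blast
  have *: "norm (d s - L) \<le> 1 / (4 * s ^ 3)" if "1 \<le> s" for s
  proof (rule tendsto_upperbound)
    show "(\<lambda>n. norm (d s - d (real n + 1))) \<longlonglongrightarrow> norm (d s - L)"
      by (intro tendsto_intros L)
    show "\<forall>\<^sub>F n in sequentially. norm (d s - d (real n + 1)) \<le> 1 / (4 * s ^ 3)"
      using eventually_ge_at_top[of "nat \<lceil>s\<rceil>"]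
    proof eventually_elim
      case (elim n)
      then have "s \<le> real n + 1" by linarith
      then show ?case using step[OF that, of "real n + 1"] by (simp add: norm_minus_commute)
    qed
  qed simp
  \<comment> \<open>The constant 2 is 1 + 3/4 + 1/4: the integral up to 1, the correction at 1, and
    the error at 1.\<close>
  have "norm (fresnel 1) \<le> 1 * (1 - 0)"
    unfolding fresnel_def by (intro integral_bound continuous_intros) auto
  moreover have "norm (q 1) \<le> 3 / 4"
    unfolding q_def norm_mult by (rule order_trans[OF mult_left_mono[OF norm_triangle_ineq]])
      (auto simp: norm_divide norm_mult)
  moreover have "L = fresnel 1 + q 1 - (d 1 - L)" by (simp add: d_def)
  then have "norm L \<le> norm (fresnel 1) + norm (q 1) + norm (d 1 - L)"
    by (metis norm_triangle_ineq4 norm_triangle_ineq add_right_mono order_trans)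
  ultimately have "norm L \<le> 2"
    using *[of 1] by simp
  with * show ?thesis by (intro that[of L]) (auto simp: d_def q_def algebra_simps)
qed

text \<open>The limit of \<open>fresnel\<close> at infinity, i.e. sqrt(pi)/2 times exp(-i pi/4). The
  description operator fixes it through the tail estimate, which determines it uniquely, without
  evaluating the integral.\<close>

definition fresnel_end :: complex where
  "fresnel_end = (SOME L. norm L \<le> 2 \<and> (\<forall>s\<ge>1.
     norm (fresnel s - L + cis (- s\<^sup>2) * (1 / (2 * \<i> * of_real s) + 1 / (4 * of_real s ^ 3)))
        \<le> 1 / (4 * s ^ 3)))"

lemma fresnel_end:
  "norm fresnel_end \<le> 2"
  "1 \<le> s \<Longrightarrow> norm (fresnel s - fresnel_end + cis (- s\<^sup>2) * (1 / (2 * \<i> * of_real s) + 1 / (4 * of_real s ^ 3)))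
        \<le> 1 / (4 * s ^ 3)"
proof -
  have "norm fresnel_end \<le> 2 \<and> (\<forall>s\<ge>1.
     norm (fresnel s - fresnel_end + cis (- s\<^sup>2) * (1 / (2 * \<i> * of_real s) + 1 / (4 * of_real s ^ 3)))
        \<le> 1 / (4 * s ^ 3))"
    unfolding fresnel_end_def by (rule someI_ex) (use fresnel_limit in metis)
  then show "norm fresnel_end \<le> 2"
    "1 \<le> s \<Longrightarrow> norm (fresnel s - fresnel_end + cis (- s\<^sup>2) * (1 / (2 * \<i> * of_real s) + 1 / (4 * of_real s ^ 3)))
        \<le> 1 / (4 * s ^ 3)" by auto
qed

text \<open>The second antiderivative of \<open>cis (- s\<^sup>2)\<close>, normalised so that both
  it and its derivative \<open>fresnel s - fresnel_end\<close> vanish at infinity. These are the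
  kernels for integrating by parts twice.\<close>

definition fresnel2 :: "real \<Rightarrow> complex" where
  "fresnel2 s = of_real s * (fresnel s - fresnel_end) + cis (- s\<^sup>2) / (2 * \<i>)"

lemma fresnel2_deriv:
  assumes "0 \<le> s"
  shows "(fresnel2 has_vector_derivative fresnel s - fresnel_end) (at s within {0..})"
proof -
  have f: "((\<lambda>s. fresnel s - fresnel_end) has_vector_derivative cis (- s\<^sup>2) - 0) (at s within {0..})"
    by (intro has_vector_derivative_diff fresnel_deriv assms has_vector_derivative_const)
  have c: "((\<lambda>s. cis (- s\<^sup>2)) has_vector_derivative \<i> * of_real (- (2 * s)) * cis (- s\<^sup>2)) (at s within {0..})"
    by (auto intro!: has_vector_derivative_cis derivative_eq_intros)
  have i: "(complex_of_real has_vector_derivative 1) (at s within {0..})"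
    using has_vector_derivative_of_real[OF has_vector_derivative_id[THEN iffD2[OF has_real_derivative_iff_has_vector_derivative]]]
    by (simp add: )
  show ?thesis
    unfolding fresnel2_def
    by (rule has_vector_derivative_eq_rhs[OF has_vector_derivative_add[OF has_vector_derivative_mult[OF i f]
          has_vector_derivative_divide[OF c]]]) (auto simp: field_simps)
qed

text \<open>For s <= 1 the bound is 3 + 1/2 = 7/2, and 1 + s^2 <= 2 gives the constant 7. For s > 1
  the correction in \<open>fresnel_end\<close> cancels the leading oscillation and leaves two terms
  of size 1/(4 s^2).\<close>

lemma norm_fresnel2_le:
  assumes "0 \<le> s"
  shows "norm (fresnel2 s) \<le> 7 / (1 + s\<^sup>2)"
proof (cases "s \<le> 1")
  case True
  have "norm (fresnel s) \<le> 1 * (s - 0)"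
    unfolding fresnel_def using assms by (intro integral_bound continuous_intros) auto
  then have "norm (fresnel s - fresnel_end) \<le> 3"
    using fresnel_end(1) True norm_triangle_ineq4[of "fresnel s" fresnel_end] by simp
  then have "s * norm (fresnel s - fresnel_end) \<le> 1 * 3"
    using assms True by (intro mult_mono) auto
  then have "norm (fresnel2 s) \<le> 7 / 2"
    using norm_triangle_ineq[of "of_real s * (fresnel s - fresnel_end)" "cis (- s\<^sup>2) / (2 * \<i>)"] assms
    unfolding fresnel2_def by (simp add: norm_mult norm_divide)
  also have "7 / 2 \<le> 7 / (1 + s\<^sup>2)"
    using True assms by (intro divide_left_mono) (auto simp: power_le_one add_pos_nonneg)
  finally show ?thesis .
next
  case False
  then have s: "1 < s" by simp
  define d where "d = fresnel s - fresnel_end + cis (- s\<^sup>2) * (1 / (2 * \<i> * of_real s) + 1 / (4 * of_real s ^ 3))"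
  have "fresnel2 s = of_real s * d - cis (- s\<^sup>2) / (4 * of_real s ^ 2)"
    using s unfolding fresnel2_def d_def by (simp add: field_simps power2_eq_square power3_eq_cube)
  then have "norm (fresnel2 s) \<le> s * norm d + 1 / (4 * s ^ 2)"
    using norm_triangle_ineq4[of "of_real s * d" "cis (- s\<^sup>2) / (4 * of_real s ^ 2)"] s
    by (simp add: norm_mult norm_divide norm_power)
  also have "\<dots> \<le> s * (1 / (4 * s ^ 3)) + 1 / (4 * s ^ 2)"
    using fresnel_end(2)[of s] s unfolding d_def by (intro add_right_mono mult_left_mono) auto
  also have "\<dots> = 1 / (s\<^sup>2 + s\<^sup>2)"
    using s by (simp add: field_simps power2_eq_square power3_eq_cube)
  also have "\<dots> \<le> 7 / (1 + s\<^sup>2)"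
    using s by (intro frac_le) (auto simp: add_pos_nonneg one_le_power)
  finally show ?thesis .
qed

text \<open>The term with \<open>g' c\<close> cancels against the other half-line.\<close>

lemma stationary_phase_half_line:
  fixes g g' g'' :: "real \<Rightarrow> complex"
  assumes l: "0 < l" and cR: "c \<le> R"
    and g: "\<And>y. (g has_vector_derivative g' y) (at y)"
    and g': "\<And>y. (g' has_vector_derivative g'' y) (at y)"
    and cont: "continuous_on UNIV g''" and G: "\<And>y. norm (g'' y) \<le> G"
    and R: "g R = 0" "g' R = 0"
  shows "norm (integral {c..R} (\<lambda>y. cis (- l * (y - c)\<^sup>2) * g y)
      - (fresnel_end / sqrt l * g c + fresnel2 0 / l * g' c)) \<le> 7 * pi / 2 * G / (l * sqrt l)"
proof -
  \<comment> \<open>\<open>e1\<close> and \<open>e2\<close> are the first and second antiderivatives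
    of the oscillating factor in y, rescaled from the Fresnel kernels by sqrt l. Hence
    \<open>\<Psi>\<close> is an antiderivative of the integrand up to \<open>g'' y * e2 y\<close>;
    it vanishes at R, and at c it produces the main term.\<close>
  define e1 where "e1 y = (fresnel (sqrt l * (y - c)) - fresnel_end) / of_real (sqrt l)" for y
  define e2 where "e2 y = fresnel2 (sqrt l * (y - c)) / of_real l" for y
  define \<Psi> where "\<Psi> y = g y * e1 y - g' y * e2 y" for y
  have l': "sqrt l > 0" "sqrt l * sqrt l = l" "(sqrt l)\<^sup>2 = l" using l by auto
  have sub: "(F has_vector_derivative f) (at x within {0..}) \<Longrightarrow> x = sqrt l * (y - c) \<Longrightarrow> c \<le> y \<Longrightarrow>
     ((\<lambda>y. F (sqrt l * (y - c))) has_vector_derivative of_real (sqrt l) * f) (at y within {c..R})"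
    for F :: "real \<Rightarrow> complex" and f x y
  proof -
    assume F: "(F has_vector_derivative f) (at x within {0..})" and x: "x = sqrt l * (y - c)" and "c \<le> y"
    have "((\<lambda>y. sqrt l * (y - c)) has_vector_derivative sqrt l) (at y within {c..R})"
      by (auto intro!: derivative_eq_intros simp flip: has_real_derivative_iff_has_vector_derivative)
    moreover have "(F has_vector_derivative f) (at (sqrt l * (y - c)) within (\<lambda>y. sqrt l * (y - c)) ` {c..R})"
      using F unfolding x by (rule has_vector_derivative_within_subset) (use l in auto)
    ultimately show ?thesis
      using vector_diff_chain_within[of "\<lambda>y. sqrt l * (y - c)" "sqrt l" y "{c..R}" F f]
      by (simp add: o_def scaleR_conv_of_real)
  qed
  have d1: "(e1 has_vector_derivative cis (- l * (y - c)\<^sup>2)) (at y within {c..R})" if "c \<le> y" for y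
  proof -
    have "((\<lambda>y. fresnel (sqrt l * (y - c)) - fresnel_end) has_vector_derivative
        of_real (sqrt l) * cis (- l * (y - c)\<^sup>2) - 0) (at y within {c..R})"
      by (rule has_vector_derivative_diff[OF sub[OF fresnel_deriv, THEN has_vector_derivative_eq_rhs]])
         (use l that in \<open>auto simp: power_mult_distrib\<close>)
    from has_vector_derivative_divide[OF this, of "of_real (sqrt l)"] show ?thesis
      using l unfolding e1_def by simp
  qed
  have d2: "(e2 has_vector_derivative e1 y) (at y within {c..R})" if "c \<le> y" for y
  proof -
    have "((\<lambda>y. fresnel2 (sqrt l * (y - c))) has_vector_derivative
        of_real (sqrt l) * (fresnel (sqrt l * (y - c)) - fresnel_end)) (at y within {c..R})"
      by (rule sub[OF fresnel2_deriv]) (use l that in auto)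
    from has_vector_derivative_divide[OF this, of "of_real l"] show ?thesis
      using l' unfolding e1_def e2_def
      by (auto simp: field_simps elim!: has_vector_derivative_eq_rhs simp flip: of_real_mult)
  qed
  have ce1: "continuous_on {c..R} e1" and ce2: "continuous_on {c..R} e2"
    by (auto intro!: continuous_on_vector_derivative d1 d2)
  have cg: "continuous_on A g" "continuous_on A g'" for A
    by (auto intro!: continuous_at_imp_continuous_on has_vector_derivative_continuous g g')
  have "((\<lambda>y. cis (- l * (y - c)\<^sup>2) * g y - g'' y * e2 y) has_integral \<Psi> R - \<Psi> c) {c..R}"
  proof (intro fundamental_theorem_of_calculus cR)
    fix y assume "y \<in> {c..R}"
    then show "(\<Psi> has_vector_derivative cis (- l * (y - c)\<^sup>2) * g y - g'' y * e2 y) (at y within {c..R})"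
      unfolding \<Psi>_def
      by (intro has_vector_derivative_eq_rhs[OF has_vector_derivative_diff[OF
            has_vector_derivative_mult[OF has_vector_derivative_at_within[OF g] d1]
            has_vector_derivative_mult[OF has_vector_derivative_at_within[OF g'] d2]]]) auto
  qed
  moreover have int: "(\<lambda>y. g'' y * e2 y) integrable_on {c..R}"
    by (intro integrable_continuous_real continuous_intros ce2 continuous_on_subset[OF cont]) auto
  ultimately have "((\<lambda>y. (cis (- l * (y - c)\<^sup>2) * g y - g'' y * e2 y) + g'' y * e2 y) has_integral
      (\<Psi> R - \<Psi> c) + integral {c..R} (\<lambda>y. g'' y * e2 y)) {c..R}"
    by (intro has_integral_add) auto
  then have eq: "integral {c..R} (\<lambda>y. cis (- l * (y - c)\<^sup>2) * g y)
      = (fresnel_end / sqrt l * g c + fresnel2 0 / l * g' c) + integral {c..R} (\<lambda>y. g'' y * e2 y)"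
    using R by (simp add: \<Psi>_def e1_def e2_def fresnel_def integral_unique mult.commute)
  have G0: "0 \<le> G" using G[of 0] norm_ge_zero order_trans by blast
  \<comment> \<open>The majorant of \<open>e2\<close> integrates to an arctangent, bounded by pi/2
    independently of R; this gives the constant 7 pi / 2 and the power l^(-3/2).\<close>
  have at: "((\<lambda>y. G * (7 / l) / (1 + (sqrt l * (y - c))\<^sup>2)) has_integral
       G * (7 / l) * arctan (sqrt l * (R - c)) / sqrt l - G * (7 / l) * arctan (sqrt l * (c - c)) / sqrt l) {c..R}"
  proof (intro fundamental_theorem_of_calculus cR)
    fix y assume "y \<in> {c..R}"
    have "((\<lambda>y. G * (7 / l) * arctan (sqrt l * (y - c)) / sqrt l) has_real_derivative
        G * (7 / l) / (1 + (sqrt l * (y - c))\<^sup>2)) (at y within {c..R})"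
      using l by (auto intro!: derivative_eq_intros simp: divide_inverse)
    then show "((\<lambda>y. G * (7 / l) * arctan (sqrt l * (y - c)) / sqrt l) has_vector_derivative
        G * (7 / l) / (1 + (sqrt l * (y - c))\<^sup>2)) (at y within {c..R})"
      by (simp add: has_real_derivative_iff_has_vector_derivative)
  qed
  have "norm (integral {c..R} (\<lambda>y. g'' y * e2 y))
      \<le> integral {c..R} (\<lambda>y. G * (7 / l) / (1 + (sqrt l * (y - c))\<^sup>2))"
  proof (rule integral_norm_bound_integral[OF int])
    show "(\<lambda>y. G * (7 / l) / (1 + (sqrt l * (y - c))\<^sup>2)) integrable_on {c..R}"
      using at by blast
    fix y assume y: "y \<in> {c..R}"
    have "norm (g'' y) * norm (e2 y) \<le> G * (7 / (1 + (sqrt l * (y - c))\<^sup>2) / l)"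
      unfolding e2_def norm_divide using l y
      by (intro mult_mono G norm_fresnel2_le G0 divide_mono) auto
    then show "norm (g'' y * e2 y) \<le> G * (7 / l) / (1 + (sqrt l * (y - c))\<^sup>2)"
      by (simp add: norm_mult mult.commute)
  qed
  also have "\<dots> = G * (7 / l) / sqrt l * arctan (sqrt l * (R - c))"
    using at by (simp add: integral_unique)
  also have "\<dots> \<le> G * (7 / l) / sqrt l * (pi / 2)"
    using l G0 arctan_ubound[of "sqrt l * (R - c)"] by (intro mult_left_mono) auto
  finally show ?thesis
    unfolding eq by (simp add: mult_ac)
qed

text \<open>The interval is enlarged to [-R, R] with R = 1 + |c|, where g contributes nothing new,
  so that the stationary point lies inside wherever it is. For |c| >= 1 the main term is then 0 by
  itself, and no separate argument is required for a phase without stationary point in (-1, 1).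
  Reflecting the left half changes the sign of g', which cancels the two first-derivative
  terms.\<close>

lemma stationary_phase:
  fixes g g' g'' :: "real \<Rightarrow> complex"
  assumes l: "0 < l"
    and g: "\<And>y. (g has_vector_derivative g' y) (at y)"
    and g': "\<And>y. (g' has_vector_derivative g'' y) (at y)"
    and cont: "continuous_on UNIV g''" and G: "\<And>y. norm (g'' y) \<le> G"
    and zero: "\<And>y. 1 \<le> \<bar>y\<bar> \<Longrightarrow> g y = 0" "\<And>y. 1 \<le> \<bar>y\<bar> \<Longrightarrow> g' y = 0"
  shows "norm (integral {-1..1} (\<lambda>y. cis (- l * (y - c)\<^sup>2) * g y) - 2 * fresnel_end / sqrt l * g c)
      \<le> 7 * pi * G / (l * sqrt l)"
proof -
  define R where "R = 1 + \<bar>c\<bar>"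
  define f where "f y = cis (- l * (y - c)\<^sup>2) * g y" for y
  have cg: "continuous_on A g" for A
    by (auto intro!: continuous_at_imp_continuous_on has_vector_derivative_continuous g)
  have cf: "continuous_on A f" for A
    unfolding f_def by (intro continuous_intros cg)
  have "(f has_integral integral {-1..1} f) {-R..R}"
    by (rule has_integral_on_superset[OF integrable_integral[OF integrable_continuous_real[OF cf]]])
       (auto simp: f_def R_def zero)
  then have "integral {-1..1} f = integral {-R..R} f" by (simp add: integral_unique)
  also have "\<dots> = integral {-R..c} f + integral {c..R} f"
    by (intro Henstock_Kurzweil_Integration.integral_combine[symmetric] integrable_continuous_real cf) (auto simp: R_def)
  also have "integral {-R..c} f = integral {-c..R} (\<lambda>y. cis (- l * (y - - c)\<^sup>2) * g (- y))"
  proof -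
    have "integral {-R..c} f = integral {-c..R} (\<lambda>y. f (- y))"
      using Henstock_Kurzweil_Integration.integral_reflect_real[where f = "\<lambda>y. f (- y)" and a = "-c" and b = R] by simp
    moreover have "f (- y) = cis (- l * (y - - c)\<^sup>2) * g (- y)" for y
      proof -
      have "(- y - c)\<^sup>2 = (y - - c)\<^sup>2" by (simp add: power2_eq_square algebra_simps)
      then show ?thesis by (simp only: f_def)
    qed
    ultimately show ?thesis by simp
  qed
  finally have eq: "integral {-1..1} f = integral {-c..R} (\<lambda>y. cis (- l * (y - - c)\<^sup>2) * g (- y))
     + integral {c..R} f" .
  have um: "(uminus has_vector_derivative - 1) (at y)" for y :: real
    by (auto intro!: derivative_eq_intros simp flip: has_real_derivative_iff_has_vector_derivative)
  have gm: "((\<lambda>y. g (- y)) has_vector_derivative - g' (- y)) (at y)" for y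
    using vector_diff_chain_at[OF um, of g] g by (simp add: o_def)
  have gm': "((\<lambda>y. - g' (- y)) has_vector_derivative g'' (- y)) (at y)" for y
    using has_vector_derivative_minus[OF vector_diff_chain_at[OF um, of g']] g' by (simp add: o_def)
  have A: "norm (integral {-c..R} (\<lambda>y. cis (- l * (y - - c)\<^sup>2) * g (- y))
      - (fresnel_end / sqrt l * g (- (- c)) + fresnel2 0 / l * (- g' (- (- c))))) \<le> 7 * pi / 2 * G / (l * sqrt l)"
    by (rule stationary_phase_half_line[OF l _ gm gm'])
       (auto simp: R_def G zero intro!: continuous_on_compose2[OF cont] continuous_intros)
  have B: "norm (integral {c..R} (\<lambda>y. cis (- l * (y - c)\<^sup>2) * g y)
      - (fresnel_end / sqrt l * g c + fresnel2 0 / l * g' c)) \<le> 7 * pi / 2 * G / (l * sqrt l)"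
    by (rule stationary_phase_half_line[OF l _ g g' cont G]) (auto simp: R_def zero)
  have "integral {-1..1} f - 2 * fresnel_end / sqrt l * g c
    = (integral {-c..R} (\<lambda>y. cis (- l * (y - - c)\<^sup>2) * g (- y))
      - (fresnel_end / sqrt l * g (- (- c)) + fresnel2 0 / l * (- g' (- (- c)))))
     + (integral {c..R} (\<lambda>y. cis (- l * (y - c)\<^sup>2) * g y)
      - (fresnel_end / sqrt l * g c + fresnel2 0 / l * g' c))"
    unfolding eq by (simp add: f_def[abs_def] algebra_simps)
  then have "norm (integral {-1..1} f - 2 * fresnel_end / sqrt l * g c)
     \<le> 7 * pi / 2 * G / (l * sqrt l) + 7 * pi / 2 * G / (l * sqrt l)"
    by (simp only:) (rule norm_triangle_mono[OF A B])
  then show ?thesis by (simp add: f_def[abs_def] mult_ac)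
qed

section \<open>Weights\<close>

lemma vderiv_Suc: "vderiv (Suc j) w x = vector_derivative (vderiv j w) (at x)"
  by (simp add: vderiv_def)

lemma vderiv_0 [simp]: "vderiv 0 w = w"
  by (simp add: vderiv_def)

lemma weight_deriv:
  assumes "weight C K w"
  shows "(vderiv j w has_vector_derivative vderiv (Suc j) w x) (at x within A)"
  using assms unfolding weight_def smooth_fun_def vderiv_Suc
  by (auto simp: vector_derivative_works intro: has_vector_derivative_at_within)

lemma weight_continuous:
  assumes "weight C K w"
  shows "continuous_on A (vderiv j w)"
  by (rule continuous_on_vector_derivative[OF weight_deriv[OF assms]])

text \<open>Outside [K, 2K] derivatives vanish by locality, and continuity carries this to the end
  points. The closed inequalities matter: they remove the boundary terms in the integration by parts
  for the transform.\<close>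

lemma weight_zero:
  assumes w: "weight C K w" and x: "x \<le> K \<or> 2 * K \<le> x"
  shows "vderiv j w x = 0"
proof -
  have z: "vderiv j w x = 0" if "x < K \<or> 2 * K < x" for x
    using that
  proof (induction j arbitrary: x)
    case 0
    then show ?case using w by (auto simp: weight_def)
  next
    case (Suc j)
    have "open ({..<K} \<union> {2 * K<..})" by auto
    moreover have "x \<in> {..<K} \<union> {2 * K<..}" using Suc.prems by auto
    ultimately have "(vderiv j w has_vector_derivative 0) (at x)"
      using has_vector_derivative_transform_within_open[of "\<lambda>_. 0" 0 x "{..<K} \<union> {2 * K<..}" "vderiv j w"]
        Suc.IH by (auto simp: has_vector_derivative_const)
    then show ?case using vector_derivative_unique_at weight_deriv[OF w, of j x UNIV] by blast
  qed
  have c: "isCont (vderiv j w) x" for x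
    using weight_continuous[OF w, of UNIV] by (simp add: continuous_on_eq_continuous_at)
  have "vderiv j w K = 0"
  proof (rule tendsto_unique)
    show "(vderiv j w \<longlongrightarrow> vderiv j w K) (at_left K)"
      using c[of K] by (simp add: isCont_def filterlim_at_split)
    show "(vderiv j w \<longlongrightarrow> 0) (at_left K)"
      by (rule tendsto_eventually) (auto simp: z eventually_at_filter)
  qed simp
  moreover have "vderiv j w (2 * K) = 0"
  proof (rule tendsto_unique)
    show "(vderiv j w \<longlongrightarrow> vderiv j w (2 * K)) (at_right (2 * K))"
      using c[of "2 * K"] by (simp add: isCont_def filterlim_at_split)
    show "(vderiv j w \<longlongrightarrow> 0) (at_right (2 * K))"
      by (rule tendsto_eventually) (auto simp: z eventually_at_filter)
  qed simp
  ultimately show ?thesis using x z by (cases "x = K \<or> x = 2 * K") auto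
qed

lemma weight_bound:
  assumes "weight C K w" "0 < K"
  shows "norm (vderiv j w x) \<le> C j / K ^ j" "0 \<le> C j"
proof -
  have "K powr - real j = 1 / K ^ j"
    using assms by (simp add: powr_minus powr_realpow divide_inverse)
  then show *: "norm (vderiv j w x) \<le> C j / K ^ j"
    using assms unfolding weight_def by (metis mult_1_right times_divide_eq_right)
  then have "0 \<le> C j / K ^ j" using norm_ge_zero order_trans by blast
  moreover have "0 < K ^ j" using assms by simp
  ultimately show "0 \<le> C j" by (smt (verit) divide_neg_pos)
qed

section \<open>Moments of the Fourier transform of a weight, and inversion\<close>

lemma inverse_1_plus_square_integral:
  assumes "0 < K"
  shows "integrable lborel (\<lambda>t. K / (1 + (K * t)\<^sup>2))"
    and "(LINT t|lborel. K / (1 + (K * t)\<^sup>2)) = pi"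
proof -
  have i: "integrable lborel (\<lambda>x::real. inverse (1 + x\<^sup>2))"
    using integrable_inverse_1_plus_square by (simp add: set_integrable_def)
  have e: "(LINT x|lborel. inverse (1 + x\<^sup>2)) = pi"
    using LBINT_inverse_1_plus_square
    by (simp add: interval_lebesgue_integral_def set_lebesgue_integral_def)
  have "integrable lborel (\<lambda>t. K * inverse (1 + (0 + K * t)\<^sup>2))"
    using assms by (intro integrable_mult_right lborel_integrable_real_affine i) auto
  then show "integrable lborel (\<lambda>t. K / (1 + (K * t)\<^sup>2))" by (simp add: divide_inverse)
  have "pi = \<bar>K\<bar> *\<^sub>R (LINT t|lborel. inverse (1 + (0 + K * t)\<^sup>2))"
    unfolding e[symmetric] by (rule lborel_integral_real_affine) (use assms in auto)
  then show "(LINT t|lborel. K / (1 + (K * t)\<^sup>2)) = pi"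
    using assms by (simp add: divide_inverse)
qed

text \<open>Four moments, together with the integrable weight 1/(1 + s^2), call for decay of order
  s^6. This is why the sixth derivative, hence \<open>C 6\<close>, enters the estimates.\<close>

lemma power_le_decay:
  fixes s :: real
  assumes "0 \<le> s" "m \<le> 4"
  shows "s ^ m * (1 + s ^ 2) \<le> 3 * (1 + s ^ 6)"
proof -
  have p: "s ^ i \<le> 1 + s ^ 6" if "i \<le> 6" for i
  proof (cases "s \<le> 1")
    case True
    then show ?thesis using assms by (smt (verit) power_le_one zero_le_power)
  next
    case False
    then have "s ^ i \<le> s ^ 6" using that by (intro power_increasing) auto
    then show ?thesis by simp
  qed
  have eq: "s ^ m * (1 + s ^ 2) = s ^ m + s ^ (m + 2)" by (simp add: power_add distrib_left power2_eq_square)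
  have "s ^ m \<le> 1 + s ^ 6" "s ^ (m + 2) \<le> 1 + s ^ 6" "0 \<le> s ^ 6"
    using p[of m] p[of "m + 2"] assms by auto
  then have "s ^ m + s ^ (m + 2) \<le> (1 + s ^ 6) + (1 + s ^ 6)" by (intro add_mono)
  also have "\<dots> \<le> 3 * (1 + s ^ 6)" using \<open>0 \<le> s ^ 6\<close> by simp
  finally show ?thesis unfolding eq .
qed

lemma fourier_weight_deriv:
  assumes w: "weight C K w" and K: "0 < K"
  shows "fourier_Icc K (2 * K) (vderiv j w) t = (\<i> * of_real t) ^ j * fourier_Icc K (2 * K) w t"
proof (induction j)
  case (Suc j)
  have "fourier_Icc K (2 * K) (vderiv (Suc j) w) t = \<i> * of_real t * fourier_Icc K (2 * K) (vderiv j w) t"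
    by (rule fourier_Icc_deriv[OF _ weight_deriv[OF w] weight_continuous[OF w]])
       (use K in \<open>auto simp: weight_zero[OF w]\<close>)
  then show ?case using Suc by simp
qed simp

text \<open>The transform is O(K) and, by six integrations by parts, O(K (K |t|)^(-6)); so it has
  mass O(1) on the scale |t| = 1/K, and every factor t is worth 1/K. The order 4 is what the term
  b^2 t^4 in the expansion of the shifted phase demands.\<close>

lemma fourier_weight_moment:
  assumes w: "weight C K w" and K: "0 < K" and m: "m \<le> 4"
  shows "integrable lborel (\<lambda>t. \<bar>t\<bar> ^ m * norm (fourier_Icc K (2 * K) w t))" (is ?i)
    and "(LINT t|lborel. \<bar>t\<bar> ^ m * norm (fourier_Icc K (2 * K) w t)) \<le> 2 * (C 0 + C 6) / K ^ m" (is ?e)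
proof -
  define D where "D = (C 0 + C 6) / (2 * pi)"
  have C: "0 \<le> C j" for j by (rule weight_bound(2)[OF w K])
  have D: "0 \<le> D" using C by (simp add: D_def)
  have le: "norm (fourier_Icc K (2 * K) w t) * \<bar>t\<bar> ^ j \<le> C j / K ^ j * K / (2 * pi)" for j t
  proof -
    have "norm (fourier_Icc K (2 * K) (vderiv j w) t) \<le> C j / K ^ j * (2 * K - K) / (2 * pi)"
      by (rule norm_fourier_Icc_le[OF _ weight_continuous[OF w] weight_bound(1)[OF w K]]) (use K in simp)
    then show ?thesis
      unfolding fourier_weight_deriv[OF w K] norm_mult norm_power by (simp add: mult_ac)
  qed
  have dec: "norm (fourier_Icc K (2 * K) w t) * (1 + (K * \<bar>t\<bar>) ^ 6) \<le> D * K" for t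
    using add_mono[OF le[of t 0] mult_left_mono[OF le[of t 6], of "K ^ 6"]] K
    by (simp add: D_def algebra_simps power_mult_distrib add_divide_distrib)
  have bd: "\<bar>t\<bar> ^ m * norm (fourier_Icc K (2 * K) w t) \<le> 3 * D / K ^ m * (K / (1 + (K * t)\<^sup>2))" for t
  proof -
    define s where "s = K * \<bar>t\<bar>"
    have s: "0 \<le> s" "(K * t)\<^sup>2 = s ^ 2" using K by (auto simp: s_def power_mult_distrib)
    have "s ^ m * norm (fourier_Icc K (2 * K) w t) * (1 + s ^ 2)
       = norm (fourier_Icc K (2 * K) w t) * (s ^ m * (1 + s ^ 2))" by (simp add: mult_ac)
    also have "\<dots> \<le> norm (fourier_Icc K (2 * K) w t) * (3 * (1 + s ^ 6))"
      by (intro mult_left_mono power_le_decay s m) auto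
    also have "\<dots> \<le> 3 * (D * K)" using mult_left_mono[OF dec[of t], of 3] by (simp add: s_def mult_ac del: distrib_left_numeral)
    finally have "s ^ m * norm (fourier_Icc K (2 * K) w t) \<le> 3 * (D * K) / (1 + s ^ 2)"
      by (simp add: pos_le_divide_eq add_pos_nonneg)
    then have "K ^ m * (\<bar>t\<bar> ^ m * norm (fourier_Icc K (2 * K) w t)) \<le> 3 * (D * K) / (1 + s ^ 2)"
      by (simp add: s_def power_mult_distrib mult_ac)
    then have "\<bar>t\<bar> ^ m * norm (fourier_Icc K (2 * K) w t) \<le> 3 * (D * K) / (1 + s ^ 2) / K ^ m"
      using K by (subst pos_le_divide_eq) (auto simp: mult.commute)
    then show ?thesis
      unfolding s(2) by (simp add: mult_ac)
  qed
  have cF: "continuous_on UNIV (fourier_Icc K (2 * K) w)"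
    using continuous_fourier_Icc[OF weight_continuous[OF w, of "{K..2*K}" 0]] by simp
  have i3: "integrable lborel (\<lambda>t. 3 * D / K ^ m * (K / (1 + (K * t)\<^sup>2)))"
    by (intro integrable_mult_right inverse_1_plus_square_integral K)
  show i: ?i
  proof (rule Bochner_Integration.integrable_bound[OF i3])
    show "(\<lambda>t. \<bar>t\<bar> ^ m * norm (fourier_Icc K (2 * K) w t)) \<in> borel_measurable lborel"
      by (simp, intro borel_measurable_continuous_onI continuous_intros cF)
    show "AE t in lborel. norm (\<bar>t\<bar> ^ m * norm (fourier_Icc K (2 * K) w t))
        \<le> norm (3 * D / K ^ m * (K / (1 + (K * t)\<^sup>2)))"
      using bd D K by (intro AE_I2) (simp add: abs_mult order_trans[OF bd abs_ge_self])
  qed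
  have "(LINT t|lborel. \<bar>t\<bar> ^ m * norm (fourier_Icc K (2 * K) w t))
      \<le> (LINT t|lborel. 3 * D / K ^ m * (K / (1 + (K * t)\<^sup>2)))"
    by (rule integral_mono[OF i i3 bd])
  also have "\<dots> = 3 / 2 * (C 0 + C 6) / K ^ m"
    unfolding integral_mult_right_zero inverse_1_plus_square_integral(2)[OF K] by (simp add: D_def)
  also have "\<dots> \<le> 2 * (C 0 + C 6) / K ^ m"
    using C[of 0] C[of 6] K by (intro divide_right_mono mult_right_mono) auto
  finally show ?e .
qed

text \<open>Inversion for the j-th derivative requires two moments beyond j, so j <= 2 is what the
  four available moments give. The Lipschitz constant is the bound for the next derivative.\<close>

lemma fourier_weight_inversion:
  assumes w: "weight C K w" and K: "0 < K" and j: "j \<le> 2"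
  shows "integrable lborel (\<lambda>t. (\<i> * of_real t) ^ j * fourier_Icc K (2 * K) w t)"
    and "(LINT t|lborel. (\<i> * of_real t) ^ j * fourier_Icc K (2 * K) w t * cis (t * x)) = vderiv j w x"
proof -
  let ?F = "fourier_Icc K (2 * K) (vderiv j w)"
  have nF: "norm (?F t) = \<bar>t\<bar> ^ j * norm (fourier_Icc K (2 * K) w t)" for t
    by (simp add: fourier_weight_deriv[OF w K] norm_mult norm_power)
  have i: "integrable lborel ?F"
  proof (rule Bochner_Integration.integrable_bound[OF fourier_weight_moment(1)[OF w K, of j]])
    show "?F \<in> borel_measurable lborel"
      using borel_measurable_continuous_onI[OF continuous_fourier_Icc[OF weight_continuous[OF w]]] by simp
  qed (use j nF in auto)
  then show "integrable lborel (\<lambda>t. (\<i> * of_real t) ^ j * fourier_Icc K (2 * K) w t)"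
    by (simp add: fourier_weight_deriv[OF w K, abs_def])
  have "(LINT t|lborel. ?F t * cis (t * x)) = vderiv j w x"
  proof (rule fourier_inversion[OF weight_continuous[OF w] _ _ i])
    show "vderiv j w y = 0" if "y \<notin> {K..2 * K}" for y
      using that by (intro weight_zero[OF w]) auto
    show "norm (vderiv j w x - vderiv j w y) \<le> C (Suc j) / K ^ Suc j * \<bar>x - y\<bar>" for x y
      unfolding real_norm_def[symmetric]
    proof (rule differentiable_bound[OF convex_UNIV])
      fix x
      show "(vderiv j w has_derivative (\<lambda>h. h *\<^sub>R vderiv (Suc j) w x)) (at x within UNIV)"
        using weight_deriv[OF w, of j x UNIV] by (simp add: has_vector_derivative_def)
      show "onorm (\<lambda>h::real. h *\<^sub>R vderiv (Suc j) w x) \<le> C (Suc j) / K ^ Suc j"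
        using weight_bound(1)[OF w K, of "Suc j" x] by (simp add: onorm_scaleR_left onorm_id)
    qed auto
    have "integrable lborel (\<lambda>t. \<bar>t\<bar> ^ (j + 2) * norm (fourier_Icc K (2 * K) w t))"
      using j by (intro fourier_weight_moment(1)[OF w K]) auto
    moreover have "t\<^sup>2 * norm (?F t) = \<bar>t\<bar> ^ (j + 2) * norm (fourier_Icc K (2 * K) w t)" for t
      unfolding nF power_add power2_abs by (simp add: mult_ac)
    ultimately show "integrable lborel (\<lambda>t. t\<^sup>2 * norm (?F t))" by simp
  qed
  then show "(LINT t|lborel. (\<i> * of_real t) ^ j * fourier_Icc K (2 * K) w t * cis (t * x)) = vderiv j w x"
    by (simp add: fourier_weight_deriv[OF w K])
qed

section \<open>Reduction to an oscillatory integral\<close>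

lemma continuous_LINT:
  fixes k :: "real \<Rightarrow> real \<Rightarrow> complex"
  assumes \<phi>: "integrable lborel \<phi>" and k: "continuous_on UNIV (\<lambda>(y, t). k y t)"
    and B: "\<And>y t. norm (k y t) \<le> B"
  shows "continuous_on A (\<lambda>y. LINT t|lborel. \<phi> t * k y t)"
proof -
  have c1: "continuous_on UNIV (\<lambda>t. k y t)" and c2: "continuous_on UNIV (\<lambda>y. k y t)" for y t
    by (rule continuous_on_compose2[OF k, of _ "\<lambda>t. (y, t)", simplified]; intro continuous_intros)
       (rule continuous_on_compose2[OF k, of _ "\<lambda>y. (y, t)", simplified]; intro continuous_intros)
  have [measurable]: "k y \<in> borel_measurable borel" for y
    using c1 by (rule borel_measurable_continuous_onI)
  have [measurable]: "\<phi> \<in> borel_measurable borel" using \<phi> by auto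
  have "isCont (\<lambda>y. LINT t|lborel. \<phi> t * k y t) y" for y
  proof (rule continuous_at_sequentiallyI)
    fix u assume u: "u \<longlonglongrightarrow> y"
    show "(\<lambda>n. LINT t|lborel. \<phi> t * k (u n) t) \<longlonglongrightarrow> (LINT t|lborel. \<phi> t * k y t)"
    proof (rule integral_dominated_convergence[where w = "\<lambda>t. norm (\<phi> t * of_real B)"])
      show "integrable lborel (\<lambda>t. norm (\<phi> t * of_real B))"
        by (intro integrable_norm integrable_mult_left \<phi>)
      show "AE t in lborel. (\<lambda>n. \<phi> t * k (u n) t) \<longlonglongrightarrow> \<phi> t * k y t"
      proof (rule AE_I2)
        fix t
        have "isCont (\<lambda>y. k y t) y"
          using c2[of t] by (simp add: continuous_on_eq_continuous_at)
        then show "(\<lambda>n. \<phi> t * k (u n) t) \<longlonglongrightarrow> \<phi> t * k y t"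
          by (intro tendsto_intros isCont_tendsto_compose[OF _ u])
      qed
      show "AE t in lborel. norm (\<phi> t * k (u n) t) \<le> norm (\<phi> t * of_real B)" for n
        using B[of "u n"] by (intro AE_I2) (auto simp: norm_mult intro!: mult_left_mono order_trans[OF B abs_ge_self])
    qed measurable
  qed
  then show ?thesis by (simp add: continuous_at_imp_continuous_on)
qed

text \<open>In terms of an antiderivative G the shifted integral is G(r + pi) - G(r - pi), whose
  derivative in r is 0 by periodicity. The bound R only provides a compact interval of shifts
  containing both 0 and s.\<close>

lemma integral_periodic_shift:
  fixes h :: "real \<Rightarrow> complex"
  assumes h: "continuous_on UNIV h" and per: "\<And>x. h (x + 2 * pi) = h x"
  shows "integral {-pi..pi} (\<lambda>x. h (x + s)) = integral {-pi..pi} h"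
proof -
  define R where "R = \<bar>s\<bar> + 1"
  obtain G where G: "\<And>x. x \<in> {- R - pi..R + pi} \<Longrightarrow>
      (G has_vector_derivative h x) (at x within {- R - pi..R + pi})"
    using antiderivative_continuous[OF continuous_on_subset[OF h subset_UNIV]] by metis
  have G': "((\<lambda>x. G (x + c)) has_vector_derivative h (x + c)) (at x within A)"
    if "(\<lambda>x. x + c) ` A \<subseteq> {- R - pi..R + pi}" "x \<in> A" for x c A
  proof -
    have "((\<lambda>x. x + c) has_vector_derivative 1) (at x within A)"
      by (auto intro!: derivative_eq_intros simp flip: has_real_derivative_iff_has_vector_derivative)
    moreover have "(G has_vector_derivative h (x + c)) (at (x + c) within (\<lambda>x. x + c) ` A)"
      by (rule has_vector_derivative_within_subset[OF G]) (use that in auto)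
    ultimately show ?thesis
      using vector_diff_chain_within[of "\<lambda>x. x + c" 1 x A G] by (simp add: o_def)
  qed
  have I: "integral {-pi..pi} (\<lambda>x. h (x + r)) = G (r + pi) - G (r - pi)" if "r \<in> {-R..R}" for r
  proof -
    have "((\<lambda>x. h (x + r)) has_integral G (pi + r) - G (- pi + r)) {-pi..pi}"
      by (rule fundamental_theorem_of_calculus[OF _ G']) (use that in \<open>auto simp: algebra_simps\<close>)
    then show ?thesis by (simp add: integral_unique algebra_simps)
  qed
  have "((\<lambda>r. G (r + pi) - G (r + - pi)) has_vector_derivative 0) (at r within {-R..R})"
    if "r \<in> {-R..R}" for r
  proof -
    have "h (r + pi) = h (r + - pi)" using per[of "r - pi"] by (simp add: algebra_simps)
    then show ?thesis
      by (intro has_vector_derivative_eq_rhs[OF has_vector_derivative_diff[OF G' G']])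
         (use that in auto)
  qed
  then obtain c where c: "\<And>r. r \<in> {-R..R} \<Longrightarrow> G (r + pi) - G (r + - pi) = c"
    using has_vector_derivative_zero_constant[of "{-R..R}" "\<lambda>r. G (r + pi) - G (r + - pi)"] by auto
  moreover have "s \<in> {-R..R}" "0 \<in> {-R..R}" by (auto simp: R_def)
  ultimately have "G (s + pi) - G (s - pi) = G (0 + pi) - G (0 - pi)"
    by (metis diff_conv_add_uminus)
  then show ?thesis
    using I[OF \<open>s \<in> {-R..R}\<close>] I[OF \<open>0 \<in> {-R..R}\<close>] by simp
qed

text \<open>Generating function of the Bessel functions J_n(b), with the frequency raised by one:
  its coefficient at frequency 2k is J_(2k-1)(b).\<close>

definition bphase :: "real \<Rightarrow> real \<Rightarrow> complex" where
  "bphase b \<theta> = cis (b * sin \<theta> + \<theta>)"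

text \<open>The Fourier multiplier \<open>w\<close> applied to \<open>bphase b\<close>: frequency \<open>n\<close> is multiplied by \<open>w (n / 2)\<close>.\<close>

definition multiplier :: "real \<Rightarrow> (real \<Rightarrow> complex) \<Rightarrow> real \<Rightarrow> real \<Rightarrow> complex" where
  "multiplier K w b \<theta> = (LINT t|lborel. fourier_Icc K (2 * K) w t * bphase b (\<theta> + t / 2))"

lemma continuous_bphase:
  fixes f :: "'a::t2_space \<Rightarrow> real"
  shows "continuous_on A f \<Longrightarrow> continuous_on A (\<lambda>x. bphase b (f x))"
  unfolding bphase_def by (intro continuous_intros)

lemma norm_bphase [simp]: "norm (bphase b \<theta>) = 1"
  by (simp add: bphase_def)

context
  fixes C K w
  assumes w: "weight C K w" and K: "0 < K"
begin

lemma integrable_fourier_weight: "integrable lborel (fourier_Icc K (2 * K) w)"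
  using fourier_weight_inversion(1)[OF w K, of 0] by simp

lemma continuous_multiplier: "continuous_on A (multiplier K w b)"
  unfolding multiplier_def
  by (rule continuous_LINT[OF integrable_fourier_weight, where B = 1])
     (auto simp: case_prod_beta intro!: continuous_bphase continuous_intros)

text \<open>Translating by t/2 multiplies the coefficient of frequency -2m by
  \<open>cis (- (m * t))\<close>. Integrating these factors against the transform of w gives w(-m)
  by Fourier inversion.\<close>

lemma multiplier_coeff:
  "integral {-pi..pi} (\<lambda>\<theta>. cis (of_int m * (2 * \<theta>)) * multiplier K w b \<theta>)
     = w (- of_int m) * integral {-pi..pi} (\<lambda>\<theta>. cis (of_int m * (2 * \<theta>)) * bphase b \<theta>)"
proof -
  define c where "c = integral {-pi..pi} (\<lambda>\<theta>. cis (of_int m * (2 * \<theta>)) * bphase b \<theta>)"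
  have shift: "integral {-pi..pi} (\<lambda>\<theta>. cis (of_int m * (2 * (\<theta> + s))) * bphase b (\<theta> + s)) = c" for s
    unfolding c_def
  proof (rule integral_periodic_shift[where h = "\<lambda>\<theta>. cis (of_int m * (2 * \<theta>)) * bphase b \<theta>"])
    fix x
    have "cis (of_int m * (2 * (x + 2 * pi))) = cis (of_int m * (2 * x)) * cis (2 * pi * of_int (2 * m))"
      unfolding cis_mult by (rule arg_cong) (simp add: algebra_simps)
    moreover have "bphase b (x + 2 * pi) = bphase b x"
    proof -
      have "bphase b (x + 2 * pi) = bphase b x * cis (2 * pi)"
        unfolding bphase_def cis_mult sin_periodic by (rule arg_cong) simp
      then show ?thesis by simp
    qed
    ultimately show "cis (of_int m * (2 * (x + 2 * pi))) * bphase b (x + 2 * pi)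
        = cis (of_int m * (2 * x)) * bphase b x"
      by (simp only: cis_multiple_2pi[OF Ints_of_int] mult_1_right)
  qed (intro continuous_intros continuous_bphase)
  let ?F = "fourier_Icc K (2 * K) w"
  have "integral {-pi..pi} (\<lambda>\<theta>. cis (of_int m * (2 * \<theta>)) * multiplier K w b \<theta>)
     = integral {-pi..pi} (\<lambda>\<theta>. LINT t|lborel. ?F t * (cis (of_int m * (2 * \<theta>)) * bphase b (\<theta> + t / 2)))"
    unfolding multiplier_def integral_mult_right_zero[symmetric] by (simp only: mult.left_commute)
  also have "\<dots> = (LINT t|lborel. ?F t * integral {-pi..pi} (\<lambda>\<theta>. cis (of_int m * (2 * \<theta>)) * bphase b (\<theta> + t / 2)))"
    by (rule fubini_Icc_lborel[OF integrable_fourier_weight, where B = 1])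
       (auto simp: case_prod_beta norm_mult intro!: continuous_bphase continuous_intros)
  also have "\<dots> = (LINT t|lborel. c * (?F t * cis (t * - of_int m)))"
  proof (intro Bochner_Integration.integral_cong refl)
    fix t
    have "integral {-pi..pi} (\<lambda>\<theta>. cis (of_int m * (2 * \<theta>)) * bphase b (\<theta> + t / 2))
      = integral {-pi..pi} (\<lambda>\<theta>. cis (t * - of_int m) * (cis (of_int m * (2 * (\<theta> + t / 2))) * bphase b (\<theta> + t / 2)))"
    proof (intro integral_cong)
      fix \<theta>
      have "cis (of_int m * (2 * \<theta>)) = cis (t * - of_int m) * cis (of_int m * (2 * (\<theta> + t / 2)))"
        unfolding cis_mult by (rule arg_cong) (simp add: algebra_simps)
      then show "cis (of_int m * (2 * \<theta>)) * bphase b (\<theta> + t / 2)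
         = cis (t * - of_int m) * (cis (of_int m * (2 * (\<theta> + t / 2))) * bphase b (\<theta> + t / 2))"
        by (simp only: mult.assoc)
    qed
    also have "\<dots> = cis (t * - of_int m) * c"
      unfolding integral_mult_right shift by (rule refl)
    finally show "?F t * integral {-pi..pi} (\<lambda>\<theta>. cis (of_int m * (2 * \<theta>)) * bphase b (\<theta> + t / 2))
        = c * (?F t * cis (t * - of_int m))" by simp
  qed
  also have "\<dots> = c * w (- of_int m)"
    unfolding integral_mult_right_zero
    using fourier_weight_inversion(2)[OF w K, of 0 "- of_int m"] by simp
  finally show ?thesis by (simp add: c_def)
qed

lemma bphase_coeff:
  assumes "1 \<le> k"
  shows "integral {-pi..pi} (\<lambda>\<theta>. cis (- (real k * (2 * \<theta>))) * bphase b \<theta>)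
     = 2 * of_real pi * of_real (bessel_int (2 * k - 1) b)"
proof -
  have "cis (- (real k * (2 * \<theta>))) * bphase b \<theta> = cis (b * sin \<theta> - real (2 * k - 1) * \<theta>)" for \<theta>
    unfolding bphase_def cis_mult using assms by (intro arg_cong[where f = cis]) (simp add: of_nat_diff algebra_simps)
  then show ?thesis by (simp add: bessel_int_integral)
qed

lemma S_finite_sum:
  assumes "0 < \<alpha>" "0 < \<beta>"
  shows "S w \<alpha> \<beta> = (\<Sum>k | K \<le> real k \<and> real k \<le> 2 * K \<and> odd k. \<i> ^ k *
      of_real (bessel_int k (4 * pi * \<alpha>)) * of_real (bessel_int (2 * k - 1) (4 * pi * \<beta>)) * w (real k))"
proof -
  let ?N = "{k. K \<le> real k \<and> real k \<le> 2 * K \<and> odd k}"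
  have fin: "finite ?N"
    by (rule finite_subset[of _ "{..nat \<lceil>2 * K\<rceil>}"]) (auto, linarith)
  have eq: "\<i> ^ k * of_real (bessel_J (real k) (4 * pi * \<alpha>)) * of_real (bessel_J (2 * real k - 1) (4 * pi * \<beta>)) * w (real k)
     = \<i> ^ k * of_real (bessel_int k (4 * pi * \<alpha>)) * of_real (bessel_int (2 * k - 1) (4 * pi * \<beta>)) * w (real k)"
    if "odd k" for k
  proof -
    \<comment> \<open>An odd k is at least 1, so the truncated subtraction on naturals agrees with
      the real one.\<close>
    have "2 * real k - 1 = real (2 * k - 1)" using that by (cases k) (auto simp: of_nat_diff)
    then show ?thesis
      using assms by (simp only: bessel_J_nat mult_pos_pos zero_less_numeral pi_gt_zero)
  qed
  have "S w \<alpha> \<beta> = (\<Sum>\<^sub>\<infinity>k\<in>?N. \<i> ^ k *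
      of_real (bessel_int k (4 * pi * \<alpha>)) * of_real (bessel_int (2 * k - 1) (4 * pi * \<beta>)) * w (real k))"
    unfolding S_def
    by (rule infsum_cong_neutral) (use weight_zero[OF w, of _ 0] in \<open>auto simp: eq\<close>)
  then show ?thesis using fin by simp
qed

text \<open>Each integral is 2 pi times the sum over all integers k in the support of w. Changing
  the sign of a multiplies the k-th term by (-1)^k, so the difference kills even k and doubles odd
  k, whence the factor 4 pi.\<close>

lemma S_eq_integral:
  assumes "0 < \<alpha>" "0 < \<beta>"
  shows "4 * of_real pi * S w \<alpha> \<beta>
     = integral {-pi..pi} (\<lambda>\<theta>. cis (4 * pi * \<alpha> * cos (2 * \<theta>)) * multiplier K w (4 * pi * \<beta>) \<theta>)
     - integral {-pi..pi} (\<lambda>\<theta>. cis (- (4 * pi * \<alpha>) * cos (2 * \<theta>)) * multiplier K w (4 * pi * \<beta>) \<theta>)"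
proof -
  let ?N = "{k. K \<le> real k \<and> real k \<le> 2 * K}"
  define a b where "a = 4 * pi * \<alpha>" and "b = 4 * pi * \<beta>"
  have fin: "finite ?N"
    by (rule finite_subset[of _ "{..nat \<lceil>2 * K\<rceil>}"]) (auto, linarith)
  have T: "integral {-pi..pi} (\<lambda>\<theta>. cis (s * cos (2 * \<theta>)) * multiplier K w b \<theta>)
      = (\<Sum>k\<in>?N. 2 * of_real pi * (\<i> ^ k * of_real (bessel_int k s) * of_real (bessel_int (2 * k - 1) b) * w (real k)))" for s
  proof -
    have "integral {-pi..pi} (\<lambda>\<theta>. cis (s * cos (2 * \<theta>)) * multiplier K w b \<theta>)
      = (\<Sum>k\<in>?N. \<i> ^ k * of_real (bessel_int k s)
          * integral {-pi..pi} (\<lambda>\<theta>. cis (- (real k * (2 * \<theta>))) * multiplier K w b \<theta>))"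
    proof (rule jacobi_anger_integral[OF _ continuous_multiplier fin])
      fix m :: int assume m: "m \<notin> (\<lambda>k. - int k) ` ?N"
      \<comment> \<open>As K > 0, the support condition on -m forces m to be negative, so every
        surviving frequency is -k for a natural k in the range.\<close>
      have "w (- of_int m) = 0"
      proof (rule ccontr)
        assume "w (- of_int m) \<noteq> 0"
        then have "K < - of_int m \<and> - of_int m < 2 * K"
          using weight_zero[OF w, of "- of_int m" 0] by force
        then have "nat (- m) \<in> ?N" "m = - int (nat (- m))" using K by auto
        then show False using m by blast
      qed
      then show "integral {-pi..pi} (\<lambda>\<theta>. cis (of_int m * (2 * \<theta>)) * multiplier K w b \<theta>) = 0"
        by (simp only: multiplier_coeff mult_zero_left)
    qed (intro continuous_intros)
    also have "\<dots> = (\<Sum>k\<in>?N. 2 * of_real pi * (\<i> ^ k * of_real (bessel_int k s) * of_real (bessel_int (2 * k - 1) b) * w (real k)))"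
    proof (intro sum.cong refl)
      fix k assume "k \<in> ?N"
      then have "1 \<le> k" using K by (cases k) auto
      then show "\<i> ^ k * of_real (bessel_int k s) * integral {-pi..pi} (\<lambda>\<theta>. cis (- (real k * (2 * \<theta>))) * multiplier K w b \<theta>)
        = 2 * of_real pi * (\<i> ^ k * of_real (bessel_int k s) * of_real (bessel_int (2 * k - 1) b) * w (real k))"
        using multiplier_coeff[of "- int k" b] bphase_coeff[of k b] by simp
    qed
    finally show ?thesis .
  qed
  have "integral {-pi..pi} (\<lambda>\<theta>. cis (a * cos (2 * \<theta>)) * multiplier K w b \<theta>)
     - integral {-pi..pi} (\<lambda>\<theta>. cis (- a * cos (2 * \<theta>)) * multiplier K w b \<theta>)
     = (\<Sum>k\<in>?N. if odd k then 4 * of_real pi * (\<i> ^ k * of_real (bessel_int k a) * of_real (bessel_int (2 * k - 1) b) * w (real k)) else 0)"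
    unfolding T sum_subtractf[symmetric] by (intro sum.cong refl) (simp add: bessel_int_minus)
  also have "\<dots> = (\<Sum>k\<in>{k\<in>?N. odd k}. 4 * of_real pi * (\<i> ^ k * of_real (bessel_int k a) * of_real (bessel_int (2 * k - 1) b) * w (real k)))"
    by (rule sum.inter_filter[OF fin, symmetric])
  also have "\<dots> = 4 * of_real pi * S w \<alpha> \<beta>"
    unfolding S_finite_sum[OF assms] sum_distrib_left a_def b_def by (intro sum.cong) auto
  finally show ?thesis by (simp add: a_def b_def)
qed

lemma card_real_Icc_le: "card {k. K \<le> real k \<and> real k \<le> 2 * K \<and> odd k} \<le> K + 1"
proof -
  have "{k. K \<le> real k \<and> real k \<le> 2 * K \<and> odd k} \<subseteq> {nat \<lceil>K\<rceil>..nat \<lfloor>2 * K\<rfloor>}"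
    by (auto simp: nat_le_iff le_nat_iff ceiling_le_iff le_floor_iff)
  from card_mono[OF _ this] have "card {k. K \<le> real k \<and> real k \<le> 2 * K \<and> odd k} \<le> Suc (nat \<lfloor>2 * K\<rfloor>) - nat \<lceil>K\<rceil>"
    by simp
  then show ?thesis using K by linarith
qed

text \<open>One Bessel factor is at most e^(-K), since 7 times 4 pi K / 100 stays below K; the other
  is at most 1. The number of terms, at most K + 1, is absorbed by 4 e^(K/2), which leaves
  e^(-K/2).\<close>

lemma S_small:
  assumes "1 \<le> K" "0 < \<alpha>" "0 < \<beta>" "\<alpha> < K / 100 \<or> \<beta> < K / 100"
  shows "norm (S w \<alpha> \<beta>) \<le> 4 * C 0 * exp (- K / 2)"
proof -
  have C: "0 \<le> C 0" by (rule weight_bound(2)[OF w K])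
  have pi: "pi < 3.5" using pi_less_4 pi_approx by simp
  have small: "\<bar>bessel_int n (4 * pi * x)\<bar> \<le> exp (- K)" if "0 < x" "x < K / 100" "K \<le> real n" for n x
  proof -
    have "7 * (4 * pi * x) \<le> 7 * (4 * 3.5 * (K / 100))"
      using that pi by (intro mult_mono) auto
    also have "\<dots> \<le> real n" using that K by simp
    finally have "\<bar>bessel_int n (4 * pi * x)\<bar> \<le> exp (- real n)"
      using that by (intro abs_bessel_int_le_exp) auto
    also have "\<dots> \<le> exp (- K)" using that by simp
    finally show ?thesis .
  qed
  have "norm (S w \<alpha> \<beta>) \<le> (\<Sum>k | K \<le> real k \<and> real k \<le> 2 * K \<and> odd k. exp (- K) * C 0)"
    unfolding S_finite_sum[OF assms(2,3)]
  proof (rule sum_norm_le)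
    fix k assume k: "k \<in> {k. K \<le> real k \<and> real k \<le> 2 * K \<and> odd k}"
    then have k2: "K \<le> real (2 * k - 1)" using \<open>1 \<le> K\<close> by (cases k) auto
    have "\<bar>bessel_int k (4 * pi * \<alpha>)\<bar> * \<bar>bessel_int (2 * k - 1) (4 * pi * \<beta>)\<bar> \<le> exp (- K)"
    proof (cases "\<alpha> < K / 100")
      case True
      then have "\<bar>bessel_int k (4 * pi * \<alpha>)\<bar> * \<bar>bessel_int (2 * k - 1) (4 * pi * \<beta>)\<bar> \<le> exp (- K) * 1"
        using k assms by (intro mult_mono small abs_bessel_int_le_1) auto
      then show ?thesis by simp
    next
      case False
      then have "\<bar>bessel_int k (4 * pi * \<alpha>)\<bar> * \<bar>bessel_int (2 * k - 1) (4 * pi * \<beta>)\<bar> \<le> 1 * exp (- K)"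
        using k2 assms by (intro mult_mono small abs_bessel_int_le_1) auto
      then show ?thesis by simp
    qed
    moreover have "norm (w (real k)) \<le> C 0"
      using weight_bound(1)[OF w K, of 0] by simp
    ultimately have "(\<bar>bessel_int k (4 * pi * \<alpha>)\<bar> * \<bar>bessel_int (2 * k - 1) (4 * pi * \<beta>)\<bar>) * norm (w (real k)) \<le> exp (- K) * C 0"
      by (intro mult_mono) auto
    then show "norm (\<i> ^ k * of_real (bessel_int k (4 * pi * \<alpha>)) * of_real (bessel_int (2 * k - 1) (4 * pi * \<beta>)) * w (real k))
        \<le> exp (- K) * C 0"
      by (simp add: norm_mult norm_power)
  qed
  also have "\<dots> = real (card {k. K \<le> real k \<and> real k \<le> 2 * K \<and> odd k}) * (exp (- K) * C 0)" by simp
  also have "\<dots> \<le> (K + 1) * (exp (- K) * C 0)"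
    using card_real_Icc_le C by (intro mult_right_mono) auto
  also have "\<dots> \<le> (4 * exp (K / 2)) * (exp (- K) * C 0)"
  proof (intro mult_right_mono)
    have "1 + K / 2 \<le> exp (K / 2)" by (rule exp_ge_add_one_self)
    then show "K + 1 \<le> 4 * exp (K / 2)" using K by linarith
  qed (use C in auto)
  also have "exp (K / 2) * exp (- K) = exp (- K / 2)" by (simp add: mult_exp_exp)
  then have "(4 * exp (K / 2)) * (exp (- K) * C 0) = 4 * C 0 * exp (- K / 2)"
    by (metis (no_types, lifting) mult.assoc mult.commute)
  finally show ?thesis .
qed

end

section \<open>Second order expansion of the multiplier\<close>

lemma norm_cis_approx:
  shows "norm (cis x - 1 - \<i> * x) \<le> x\<^sup>2 / 2"
    and "norm (cis x - 1 - \<i> * x + x\<^sup>2 / 2) \<le> \<bar>x\<bar> ^ 3 / 6"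
proof -
  show "norm (cis x - 1 - \<i> * x) \<le> x\<^sup>2 / 2"
    using iexp_approx1[of x 1] by (simp add: cis_conv_exp diff_diff_eq numeral_eq_Suc)
  show "norm (cis x - 1 - \<i> * x + x\<^sup>2 / 2) \<le> \<bar>x\<bar> ^ 3 / 6"
    using iexp_approx1[of x 2] by (simp add: cis_conv_exp algebra_simps numeral_eq_Suc)
qed

text \<open>Both are imaginary parts of \<open>cis \<theta>\<close> times a Taylor remainder of
  \<open>cis h\<close>, so the bounds are uniform in theta.\<close>

lemma sin_taylor_shift:
  fixes \<theta> h :: real
  shows "\<bar>sin (\<theta> + h) - sin \<theta> - h * cos \<theta>\<bar> \<le> h\<^sup>2 / 2"
    and "\<bar>sin (\<theta> + h) - sin \<theta> - h * cos \<theta> + h\<^sup>2 / 2 * sin \<theta>\<bar> \<le> \<bar>h\<bar> ^ 3 / 6"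
proof -
  have "sin (\<theta> + h) - sin \<theta> - h * cos \<theta> = Im (cis \<theta> * (cis h - 1 - \<i> * h))"
    by (simp add: sin_add algebra_simps)
  also have "\<bar>\<dots>\<bar> \<le> norm (cis \<theta> * (cis h - 1 - \<i> * h))" by (rule abs_Im_le_cmod)
  also have "\<dots> \<le> h\<^sup>2 / 2" using norm_cis_approx(1)[of h] by (simp add: norm_mult)
  finally show "\<bar>sin (\<theta> + h) - sin \<theta> - h * cos \<theta>\<bar> \<le> h\<^sup>2 / 2" .
  have "sin (\<theta> + h) - sin \<theta> - h * cos \<theta> + h\<^sup>2 / 2 * sin \<theta> = Im (cis \<theta> * (cis h - 1 - \<i> * h + h\<^sup>2 / 2))"
    by (simp add: sin_add algebra_simps power2_eq_square)
  also have "\<bar>\<dots>\<bar> \<le> norm (cis \<theta> * (cis h - 1 - \<i> * h + h\<^sup>2 / 2))" by (rule abs_Im_le_cmod)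
  also have "\<dots> \<le> \<bar>h\<bar> ^ 3 / 6" using norm_cis_approx(2)[of h] by (simp add: norm_mult)
  finally show "\<bar>sin (\<theta> + h) - sin \<theta> - h * cos \<theta> + h\<^sup>2 / 2 * sin \<theta>\<bar> \<le> \<bar>h\<bar> ^ 3 / 6" .
qed

text \<open>Serves to turn a small cosine into a small distance from pi/2.\<close>

lemma half_le_sin:
  fixes x :: real
  assumes "0 \<le> x" "x \<le> pi / 2"
  shows "x / 2 \<le> sin x"
proof -
  have "\<bar>sin x - x\<bar> \<le> x ^ 3 / 6"
    using sin_taylor_shift(2)[of 0 x] assms by simp
  moreover have "x ^ 3 / 6 \<le> x / 2"
  proof -
    have "x \<le> 1.6" using assms pi_approx by simp
    then have "x * x \<le> 1.6 * 1.6" using assms by (intro mult_mono) auto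
    then have "x * (x * x) \<le> x * 3" using assms by (intro mult_left_mono) auto
    then show ?thesis by (simp add: power3_eq_cube)
  qed
  ultimately show ?thesis by linarith
qed

text \<open>The phase increment linear in b t stays in the exponent because it need not be small.
  The rest r is the shift h = t/2 of the extra theta, minus b h^2 sin(theta)/2, plus a cubic
  remainder r1. Expanding \<open>cis r\<close> to first order gives the polynomial in t, with error
  r^2/2 + |r1|. As t is worth 1/K, the three error terms are worth 1/K^2, b/K^3 and b^2/K^4.\<close>

lemma bphase_shift_approx:
  assumes b: "0 \<le> b"
  shows "norm (bphase b (\<theta> + t / 2) - bphase b \<theta> * cis (t * (b / 2 * cos \<theta>)) *
      (1 + \<i> * of_real t / 2 - \<i> * of_real (b * sin \<theta>) / 8 * of_real t ^ 2))
    \<le> \<bar>t\<bar> ^ 2 + b * \<bar>t\<bar> ^ 3 + b\<^sup>2 * \<bar>t\<bar> ^ 4"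
proof -
  define h where "h = t / 2"
  define r where "r = b * (sin (\<theta> + h) - sin \<theta> - h * cos \<theta>) + h"
  define r1 where "r1 = b * (sin (\<theta> + h) - sin \<theta> - h * cos \<theta> + h\<^sup>2 / 2 * sin \<theta>)"
  have r1: "\<bar>r1\<bar> \<le> b * (\<bar>h\<bar> ^ 3 / 6)"
    unfolding r1_def abs_mult using b by (simp only: abs_of_nonneg) (intro mult_left_mono sin_taylor_shift)
  have "\<bar>r\<bar> \<le> \<bar>b * (sin (\<theta> + h) - sin \<theta> - h * cos \<theta>)\<bar> + \<bar>h\<bar>"
    unfolding r_def by (rule abs_triangle_ineq)
  also have "\<dots> \<le> b * (h\<^sup>2 / 2) + \<bar>h\<bar>"
    unfolding abs_mult using b
    by (simp only: abs_of_nonneg) (intro add_right_mono mult_left_mono sin_taylor_shift)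
  finally have "r\<^sup>2 \<le> (b * (h\<^sup>2 / 2) + \<bar>h\<bar>)\<^sup>2"
    by (simp add: abs_le_square_iff[symmetric])
  also have "\<dots> \<le> 2 * (b * (h\<^sup>2 / 2))\<^sup>2 + 2 * \<bar>h\<bar>\<^sup>2"
    using zero_le_power2[of "b * (h\<^sup>2 / 2) - \<bar>h\<bar>"] by (simp add: power2_eq_square algebra_simps)
  finally have r2: "r\<^sup>2 / 2 \<le> (b * (h\<^sup>2 / 2))\<^sup>2 + h\<^sup>2" by simp
  have "bphase b (\<theta> + t / 2) = bphase b \<theta> * cis (t * (b / 2 * cos \<theta>)) * cis r"
    unfolding bphase_def cis_mult r_def h_def by (rule arg_cong) (simp add: algebra_simps)
  moreover have "cis r - (1 + \<i> * of_real t / 2 - \<i> * of_real (b * sin \<theta>) / 8 * of_real t ^ 2)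
      = (cis r - 1 - \<i> * r) + \<i> * r1"
    unfolding r_def r1_def h_def by (simp add: algebra_simps power2_eq_square)
  ultimately have "bphase b (\<theta> + t / 2) - bphase b \<theta> * cis (t * (b / 2 * cos \<theta>)) *
      (1 + \<i> * of_real t / 2 - \<i> * of_real (b * sin \<theta>) / 8 * of_real t ^ 2)
     = bphase b \<theta> * cis (t * (b / 2 * cos \<theta>)) * ((cis r - 1 - \<i> * r) + \<i> * r1)"
    by (simp only: right_diff_distrib[symmetric])
  then have "norm (bphase b (\<theta> + t / 2) - bphase b \<theta> * cis (t * (b / 2 * cos \<theta>)) *
      (1 + \<i> * of_real t / 2 - \<i> * of_real (b * sin \<theta>) / 8 * of_real t ^ 2))
     = norm ((cis r - 1 - \<i> * r) + \<i> * r1)"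
    by (simp only: norm_mult norm_bphase norm_cis mult_1_left)
  also have "\<dots> \<le> norm (cis r - 1 - \<i> * r) + norm (\<i> * r1)" by (rule norm_triangle_ineq)
  also have "\<dots> \<le> r\<^sup>2 / 2 + \<bar>r1\<bar>"
    using norm_cis_approx(1)[of r] by (simp add: norm_mult)
  also have "\<dots> \<le> ((b * (h\<^sup>2 / 2))\<^sup>2 + h\<^sup>2) + b * (\<bar>h\<bar> ^ 3 / 6)"
    using r2 r1 by (rule add_mono)
  also have "\<dots> = t\<^sup>2 / 4 + b * \<bar>t\<bar> ^ 3 / 48 + b\<^sup>2 * t ^ 4 / 64"
    by (simp add: h_def power_mult_distrib power_divide power2_eq_square power3_eq_cube power4_eq_xxxx)
  also have "\<dots> \<le> \<bar>t\<bar> ^ 2 + b * \<bar>t\<bar> ^ 3 + b\<^sup>2 * \<bar>t\<bar> ^ 4"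
    using b by (intro add_mono) auto
  finally show ?thesis .
qed

context
  fixes C K w
  assumes w: "weight C K w" and K: "0 < K"
begin

text \<open>Integrate the expansion of the shift against the transform of w: powers of i t become
  derivatives of w at b cos(theta)/2 by inversion, and the error is controlled by the moments of
  order 2, 3 and 4.\<close>

lemma multiplier_approx:
  assumes b: "0 \<le> b"
  shows "norm (multiplier K w b \<theta> - bphase b \<theta> * (w (b / 2 * cos \<theta>) + vderiv 1 w (b / 2 * cos \<theta>) / 2
        + \<i> * of_real (b * sin \<theta>) / 8 * vderiv 2 w (b / 2 * cos \<theta>)))
    \<le> 2 * (C 0 + C 6) * (1 / K ^ 2 + b / K ^ 3 + b\<^sup>2 / K ^ 4)"
proof -
  let ?F = "fourier_Icc K (2 * K) w"
  define X where "X = b / 2 * cos \<theta>"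
  define q where "q t = 1 + \<i> * of_real t / 2 - \<i> * of_real (b * sin \<theta>) / 8 * of_real t ^ 2" for t :: real
  define g where "g j t = (\<i> * of_real t) ^ j * ?F t * cis (t * X)" for j t
  have ig: "integrable lborel (g j)" if "j \<le> 2" for j
  proof (rule Bochner_Integration.integrable_bound[OF fourier_weight_inversion(1)[OF w K that]])
    have [measurable]: "?F \<in> borel_measurable borel"
      using integrable_fourier_weight[OF w K] by auto
    have [measurable]: "(\<lambda>t. cis (t * X)) \<in> borel_measurable borel"
      by (intro borel_measurable_continuous_onI continuous_intros)
    show "g j \<in> borel_measurable lborel" unfolding g_def by measurable
  qed (simp add: g_def norm_mult)
  have vg: "(LINT t|lborel. g j t) = vderiv j w X" if "j \<le> 2" for j
    unfolding g_def by (rule fourier_weight_inversion(2)[OF w K that])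
  \<comment> \<open>Since t^2 = -(i t)^2, the sign of the quadratic term changes here.\<close>
  have q: "?F t * (bphase b \<theta> * cis (t * X) * q t)
      = bphase b \<theta> * g 0 t + bphase b \<theta> / 2 * g 1 t + bphase b \<theta> * (\<i> * of_real (b * sin \<theta>) / 8) * g 2 t" for t
    by (simp add: q_def g_def algebra_simps power2_eq_square)
  have iq: "integrable lborel (\<lambda>t. ?F t * (bphase b \<theta> * cis (t * X) * q t))"
    unfolding q by (intro Bochner_Integration.integrable_add integrable_mult_right ig) auto
  have vq: "(LINT t|lborel. ?F t * (bphase b \<theta> * cis (t * X) * q t))
     = bphase b \<theta> * (w X + vderiv 1 w X / 2 + \<i> * of_real (b * sin \<theta>) / 8 * vderiv 2 w X)"
    unfolding q
    by (simp add: Bochner_Integration.integral_add ig vg integrable_mult_right algebra_simps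
         del: of_real_mult)
  have im: "integrable lborel (\<lambda>t. ?F t * bphase b (\<theta> + t / 2))"
  proof (rule Bochner_Integration.integrable_bound[OF integrable_fourier_weight[OF w K]])
    have [measurable]: "?F \<in> borel_measurable borel"
      using integrable_fourier_weight[OF w K] by auto
    have [measurable]: "(\<lambda>t. bphase b (\<theta> + t / 2)) \<in> borel_measurable borel"
      by (intro borel_measurable_continuous_onI continuous_bphase continuous_intros) auto
    show "(\<lambda>t. ?F t * bphase b (\<theta> + t / 2)) \<in> borel_measurable lborel" by measurable
  qed (simp add: norm_mult)
  note mom = fourier_weight_moment[OF w K]
  let ?m = "\<lambda>j t. \<bar>t\<bar> ^ j * norm (?F t)"
  have "norm (multiplier K w b \<theta> - bphase b \<theta> * (w X + vderiv 1 w X / 2 + \<i> * of_real (b * sin \<theta>) / 8 * vderiv 2 w X))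
     = norm (LINT t|lborel. ?F t * bphase b (\<theta> + t / 2) - ?F t * (bphase b \<theta> * cis (t * X) * q t))"
    unfolding multiplier_def vq[symmetric] by (simp only: Bochner_Integration.integral_diff[OF im iq])
  also have "\<dots> \<le> (LINT t|lborel. ?m 2 t + b * ?m 3 t + b\<^sup>2 * ?m 4 t)"
  proof (rule Bochner_Integration.integral_norm_bound_integral)
    show "integrable lborel (\<lambda>t. ?F t * bphase b (\<theta> + t / 2) - ?F t * (bphase b \<theta> * cis (t * X) * q t))"
      by (rule Bochner_Integration.integrable_diff[OF im iq])
    show "integrable lborel (\<lambda>t. ?m 2 t + b * ?m 3 t + b\<^sup>2 * ?m 4 t)"
      by (intro Bochner_Integration.integrable_add integrable_mult_right mom) auto
    fix t
    have "norm (?F t * bphase b (\<theta> + t / 2) - ?F t * (bphase b \<theta> * cis (t * X) * q t))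
       = norm (?F t) * norm (bphase b (\<theta> + t / 2) - bphase b \<theta> * cis (t * X) * q t)"
      by (simp only: right_diff_distrib[symmetric] norm_mult)
    also have "\<dots> \<le> norm (?F t) * (\<bar>t\<bar> ^ 2 + b * \<bar>t\<bar> ^ 3 + b\<^sup>2 * \<bar>t\<bar> ^ 4)"
      unfolding X_def q_def by (intro mult_left_mono bphase_shift_approx b norm_ge_zero)
    also have "\<dots> = ?m 2 t + b * ?m 3 t + b\<^sup>2 * ?m 4 t" by (simp only: distrib_left mult_ac)
    finally show "norm (?F t * bphase b (\<theta> + t / 2) - ?F t * (bphase b \<theta> * cis (t * X) * q t))
       \<le> ?m 2 t + b * ?m 3 t + b\<^sup>2 * ?m 4 t" .
  qed
  also have "\<dots> = (LINT t|lborel. ?m 2 t) + b * (LINT t|lborel. ?m 3 t) + b\<^sup>2 * (LINT t|lborel. ?m 4 t)"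
    by (subst Bochner_Integration.integral_add, intro Bochner_Integration.integrable_add integrable_mult_right mom, simp, simp,
        intro integrable_mult_right mom, simp,
        subst Bochner_Integration.integral_add, rule mom, simp, intro integrable_mult_right mom, simp, simp only: integral_mult_right_zero)
  also have "\<dots> \<le> 2 * (C 0 + C 6) / K ^ 2 + b * (2 * (C 0 + C 6) / K ^ 3) + b\<^sup>2 * (2 * (C 0 + C 6) / K ^ 4)"
    using b by (intro add_mono mult_left_mono mom(2)) auto
  finally show ?thesis
    by (simp add: X_def algebra_simps add_divide_distrib)
qed

text \<open>A nonzero value forces 0 < cos(theta) < 4K/b, so theta is within 8K/b of pi/2 or of
  -pi/2. Multiplying C 2 / K^2 by the total length 16K/b gives a bound which, after the factor b/8
  of the expansion, is 2 C 2 / K with no dependence on b.\<close>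

lemma integral_vderiv2_le:
  assumes b: "0 < b"
  shows "integral {-pi..pi} (\<lambda>\<theta>. norm (vderiv 2 w (b / 2 * cos \<theta>))) \<le> 16 * C 2 / (K * b)"
proof -
  define \<eta> where "\<eta> = 8 * K / b"
  have eta: "0 < \<eta>" using b K by (simp add: \<eta>_def)
  have C: "0 \<le> C 2" by (rule weight_bound(2)[OF w K])
  let ?I = "\<lambda>\<theta>. (if \<theta> \<in> {pi / 2 - \<eta>..pi / 2} then C 2 / K ^ 2 else 0) + (if \<theta> \<in> {- pi / 2..- pi / 2 + \<eta>} then C 2 / K ^ 2 else 0)"
  have i1: "(?I has_integral \<eta> * (C 2 / K ^ 2) + \<eta> * (C 2 / K ^ 2)) UNIV"
  proof (rule has_integral_add)
    show "((\<lambda>\<theta>. if \<theta> \<in> {pi / 2 - \<eta>..pi / 2} then C 2 / K ^ 2 else 0) has_integral \<eta> * (C 2 / K ^ 2)) UNIV"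
      using has_integral_const_real[of "C 2 / K ^ 2" "pi / 2 - \<eta>" "pi / 2"] eta
      by (subst has_integral_restrict_UNIV) simp
    show "((\<lambda>\<theta>. if \<theta> \<in> {- pi / 2..- pi / 2 + \<eta>} then C 2 / K ^ 2 else 0) has_integral \<eta> * (C 2 / K ^ 2)) UNIV"
      using has_integral_const_real[of "C 2 / K ^ 2" "- pi / 2" "- pi / 2 + \<eta>"] eta
      by (subst has_integral_restrict_UNIV) simp
  qed
  have "(\<lambda>\<theta>. norm (vderiv 2 w (b / 2 * cos \<theta>))) integrable_on {-pi..pi}"
    by (intro integrable_continuous_real continuous_on_norm continuous_on_compose2[OF weight_continuous[OF w]])
       (auto intro!: continuous_intros)
  then have i2: "((\<lambda>\<theta>. if \<theta> \<in> {-pi..pi} then norm (vderiv 2 w (b / 2 * cos \<theta>)) else 0) has_integral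
      integral {-pi..pi} (\<lambda>\<theta>. norm (vderiv 2 w (b / 2 * cos \<theta>)))) UNIV"
    by (subst has_integral_restrict_UNIV) (simp add: has_integral_integral)
  have "integral {-pi..pi} (\<lambda>\<theta>. norm (vderiv 2 w (b / 2 * cos \<theta>))) \<le> \<eta> * (C 2 / K ^ 2) + \<eta> * (C 2 / K ^ 2)"
  proof (rule has_integral_le[OF i2 i1])
    fix \<theta> :: real
    have I0: "0 \<le> ?I \<theta>" using C by auto
    show "(if \<theta> \<in> {-pi..pi} then norm (vderiv 2 w (b / 2 * cos \<theta>)) else 0) \<le> ?I \<theta>"
    proof (cases "\<theta> \<in> {-pi..pi} \<and> vderiv 2 w (b / 2 * cos \<theta>) \<noteq> 0")
      case False
      then show ?thesis using I0 by auto
    next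
      case True
      then have "K < b / 2 * cos \<theta>" "b / 2 * cos \<theta> < 2 * K"
        using weight_zero[OF w, of "b / 2 * cos \<theta>" 2] by force+
      then have c: "0 < cos \<theta>" "cos \<theta> < 4 * K / b"
        using b K by (auto simp: field_simps zero_less_mult_iff) (smt (verit) mult_nonneg_nonpos)
      have th: "\<bar>\<theta>\<bar> < pi / 2"
      proof (rule ccontr)
        assume "\<not> \<bar>\<theta>\<bar> < pi / 2"
        then have "cos \<bar>\<theta>\<bar> \<le> cos (pi / 2)" using True by (intro cos_monotone_0_pi_le) auto
        then show False using c by simp
      qed
      have "(pi / 2 - \<bar>\<theta>\<bar>) / 2 \<le> sin (pi / 2 - \<bar>\<theta>\<bar>)" using th by (intro half_le_sin) auto
      also have "\<dots> = cos \<theta>" by (simp add: sin_diff)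
      finally have "pi / 2 - \<bar>\<theta>\<bar> \<le> \<eta>" using c by (simp add: \<eta>_def)
      then have "\<theta> \<in> {pi / 2 - \<eta>..pi / 2} \<or> \<theta> \<in> {- pi / 2..- pi / 2 + \<eta>}" using th by auto
      then have "C 2 / K ^ 2 \<le> ?I \<theta>" using C by auto
      then show ?thesis using weight_bound(1)[OF w K, of 2 "b / 2 * cos \<theta>"] True by auto
    qed
  qed
  also have "\<dots> = 16 * C 2 / (K * b)"
    using K b by (simp add: \<eta>_def power2_eq_square)
  finally show ?thesis .
qed

lemma integral_multiplier_approx:
  assumes b: "0 < b"
  shows "norm (integral {-pi..pi} (\<lambda>\<theta>. cis (s * cos (2 * \<theta>)) * multiplier K w b \<theta>)
      - integral {-pi..pi} (\<lambda>\<theta>. cis (s * cos (2 * \<theta>)) * (bphase b \<theta> * w (b / 2 * cos \<theta>))))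
    \<le> 4 * pi * (C 0 + C 6) * (1 / K ^ 2 + b / K ^ 3 + b\<^sup>2 / K ^ 4) + (pi * C 1 + 2 * C 2) / K"
proof -
  \<comment> \<open>\<open>E\<close> collects what is bounded pointwise: the expansion error and the
    term with w'. Only the term with w'' has to wait for the integral.\<close>
  define E where "E = 2 * (C 0 + C 6) * (1 / K ^ 2 + b / K ^ 3 + b\<^sup>2 / K ^ 4) + C 1 / (2 * K)"
  have cw: "continuous_on A (\<lambda>\<theta>. vderiv j w (b / 2 * cos \<theta>))" for A j
    by (intro continuous_on_compose2[OF weight_continuous[OF w]]) (auto intro!: continuous_intros)
  have i1: "(\<lambda>\<theta>. cis (s * cos (2 * \<theta>)) * multiplier K w b \<theta>) integrable_on {-pi..pi}"
    by (intro integrable_continuous_real continuous_intros continuous_multiplier[OF w K])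
  have i2: "(\<lambda>\<theta>. cis (s * cos (2 * \<theta>)) * (bphase b \<theta> * w (b / 2 * cos \<theta>))) integrable_on {-pi..pi}"
    using cw[of _ 0] by (intro integrable_continuous_real continuous_intros continuous_bphase) auto
  have i3: "(\<lambda>\<theta>. E + b / 8 * norm (vderiv 2 w (b / 2 * cos \<theta>))) integrable_on {-pi..pi}"
    by (intro integrable_continuous_real continuous_intros cw)
  have i4: "(\<lambda>\<theta>. b / 8 * norm (vderiv 2 w (b / 2 * cos \<theta>))) integrable_on {-pi..pi}"
    by (intro integrable_continuous_real continuous_intros cw)
  have "norm (integral {-pi..pi} (\<lambda>\<theta>. cis (s * cos (2 * \<theta>)) * multiplier K w b \<theta>)
      - integral {-pi..pi} (\<lambda>\<theta>. cis (s * cos (2 * \<theta>)) * (bphase b \<theta> * w (b / 2 * cos \<theta>))))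
    = norm (integral {-pi..pi} (\<lambda>\<theta>. cis (s * cos (2 * \<theta>)) * multiplier K w b \<theta>
       - cis (s * cos (2 * \<theta>)) * (bphase b \<theta> * w (b / 2 * cos \<theta>))))"
    by (simp only: Henstock_Kurzweil_Integration.integral_diff[OF i1 i2])
  also have "\<dots> \<le> integral {-pi..pi} (\<lambda>\<theta>. E + b / 8 * norm (vderiv 2 w (b / 2 * cos \<theta>)))"
  proof (rule integral_norm_bound_integral[OF integrable_diff[OF i1 i2] i3])
    fix \<theta> :: real
    define X where "X = b / 2 * cos \<theta>"
    define A where "A = vderiv 1 w X / 2 + \<i> * of_real (b * sin \<theta>) / 8 * vderiv 2 w X"
    define D where "D = multiplier K w b \<theta> - bphase b \<theta> * (w X + A)"
    have "norm (\<i> * of_real (b * sin \<theta>) / 8 * vderiv 2 w X) = b * \<bar>sin \<theta>\<bar> / 8 * norm (vderiv 2 w X)"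
      using b by (simp add: norm_mult norm_divide abs_mult)
    also have "\<dots> \<le> b * 1 / 8 * norm (vderiv 2 w X)"
      using b by (intro mult_right_mono divide_right_mono mult_left_mono) auto
    finally have "norm A \<le> norm (vderiv 1 w X) / 2 + b / 8 * norm (vderiv 2 w X)"
      unfolding A_def using norm_triangle_ineq[of "vderiv 1 w X / 2" "\<i> * of_real (b * sin \<theta>) / 8 * vderiv 2 w X"]
      by (simp add: norm_divide)
    moreover have "norm (vderiv 1 w X) \<le> C 1 / K" using weight_bound(1)[OF w K, of 1 X] by simp
    moreover have "norm D \<le> 2 * (C 0 + C 6) * (1 / K ^ 2 + b / K ^ 3 + b\<^sup>2 / K ^ 4)"
      using multiplier_approx[of b \<theta>] b unfolding D_def A_def X_def by (simp add: add.assoc)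
    moreover have "multiplier K w b \<theta> - bphase b \<theta> * w X = D + bphase b \<theta> * A"
      by (simp add: D_def algebra_simps)
    then have "norm (multiplier K w b \<theta> - bphase b \<theta> * w X) \<le> norm D + norm A"
      using norm_triangle_ineq[of D "bphase b \<theta> * A"] by (simp add: norm_mult)
    moreover have "norm (cis (s * cos (2 * \<theta>)) * multiplier K w b \<theta> - cis (s * cos (2 * \<theta>)) * (bphase b \<theta> * w X))
        = norm (multiplier K w b \<theta> - bphase b \<theta> * w X)"
      by (simp only: right_diff_distrib[symmetric] norm_mult norm_cis mult_1_left)
    ultimately show "norm (cis (s * cos (2 * \<theta>)) * multiplier K w b \<theta> - cis (s * cos (2 * \<theta>)) * (bphase b \<theta> * w (b / 2 * cos \<theta>)))
        \<le> E + b / 8 * norm (vderiv 2 w (b / 2 * cos \<theta>))"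
      unfolding E_def X_def[symmetric] by simp
  qed
  also have "\<dots> = 2 * pi * E + b / 8 * integral {-pi..pi} (\<lambda>\<theta>. norm (vderiv 2 w (b / 2 * cos \<theta>)))"
    unfolding Henstock_Kurzweil_Integration.integral_add[OF integrable_const_ivl i4] integral_mult_right by simp
  also have "\<dots> \<le> 2 * pi * E + b / 8 * (16 * C 2 / (K * b))"
    using b by (intro add_left_mono mult_left_mono integral_vderiv2_le) auto
  also have "\<dots> = 4 * pi * (C 0 + C 6) * (1 / K ^ 2 + b / K ^ 3 + b\<^sup>2 / K ^ 4) + (pi * C 1 + 2 * C 2) / K"
  proof -
    define Z where "Z = 1 / K ^ 2 + b / K ^ 3 + b\<^sup>2 / K ^ 4"
    show ?thesis
      unfolding E_def Z_def[symmetric] using b K by (simp add: algebra_simps add_divide_distrib)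
  qed
  finally show ?thesis .
qed

end

section \<open>The amplitude\<close>

text \<open>Completing the square: the phase equals sigma (a + b^2/(8a)) - 2 a sigma (y - c)^2 with
  c = sigma b/(4a). For sigma = 1 this is the case l = 2a of the previous estimate; for sigma = -1
  one conjugates, which also conjugates the Fresnel constant.\<close>

lemma stationary_phase_signed:
  fixes g g' g'' :: "real \<Rightarrow> complex"
  assumes a: "0 < a" and \<sigma>: "\<sigma> \<in> {1, -1}"
    and g: "\<And>y. (g has_vector_derivative g' y) (at y)"
    and g': "\<And>y. (g' has_vector_derivative g'' y) (at y)"
    and cont: "continuous_on UNIV g''" and G: "\<And>y. norm (g'' y) \<le> G"
    and zero: "\<And>y. 1 \<le> \<bar>y\<bar> \<Longrightarrow> g y = 0" "\<And>y. 1 \<le> \<bar>y\<bar> \<Longrightarrow> g' y = 0"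
  shows "norm (integral {-1..1} (\<lambda>y. cis (\<sigma> * a * (1 - 2 * y\<^sup>2) + b * y) * g y)
      - cis (\<sigma> * (a + b\<^sup>2 / (8 * a))) * (2 * (if \<sigma> = 1 then fresnel_end else cnj fresnel_end) / sqrt (2 * a))
          * g (\<sigma> * b / (4 * a)))
      \<le> 7 * pi * G / (2 * a * sqrt (2 * a))"
proof -
  define c where "c = \<sigma> * b / (4 * a)"
  have ph: "\<sigma> * a * (1 - 2 * y\<^sup>2) + b * y = \<sigma> * (a + b\<^sup>2 / (8 * a)) + - \<sigma> * (2 * a) * (y - c)\<^sup>2" for y
    using a \<sigma> by (auto simp: c_def power2_eq_square field_simps)
  have "integral {-1..1} (\<lambda>y. cis (\<sigma> * a * (1 - 2 * y\<^sup>2) + b * y) * g y)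
      = cis (\<sigma> * (a + b\<^sup>2 / (8 * a))) * integral {-1..1} (\<lambda>y. cis (- \<sigma> * (2 * a) * (y - c)\<^sup>2) * g y)"
  proof -
    have "cis (\<sigma> * a * (1 - 2 * y\<^sup>2) + b * y) * g y
        = cis (\<sigma> * (a + b\<^sup>2 / (8 * a))) * (cis (- \<sigma> * (2 * a) * (y - c)\<^sup>2) * g y)" for y
    proof -
      have "cis (\<sigma> * a * (1 - 2 * y\<^sup>2) + b * y)
          = cis (\<sigma> * (a + b\<^sup>2 / (8 * a))) * cis (- \<sigma> * (2 * a) * (y - c)\<^sup>2)"
        by (simp only: ph[of y] cis_mult)
      then show ?thesis by (simp only: mult.assoc)
    qed
    then show ?thesis by (simp only: integral_mult_right)
  qed
  then have "norm (integral {-1..1} (\<lambda>y. cis (\<sigma> * a * (1 - 2 * y\<^sup>2) + b * y) * g y)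
      - cis (\<sigma> * (a + b\<^sup>2 / (8 * a))) * (2 * (if \<sigma> = 1 then fresnel_end else cnj fresnel_end) / sqrt (2 * a)) * g c)
    = norm (integral {-1..1} (\<lambda>y. cis (- \<sigma> * (2 * a) * (y - c)\<^sup>2) * g y)
       - 2 * (if \<sigma> = 1 then fresnel_end else cnj fresnel_end) / sqrt (2 * a) * g c)"
    by (simp only: mult.assoc right_diff_distrib[symmetric] norm_mult norm_cis mult_1_left)
  also have "\<dots> \<le> 7 * pi * G / (2 * a * sqrt (2 * a))"
  proof (cases "\<sigma> = 1")
    case True
    then show ?thesis
      using stationary_phase[OF _ g g' cont G zero, of "2 * a" c] a by simp
  next
    case False
    with \<sigma> have s: "\<sigma> = -1" by simp
    have "norm (integral {-1..1} (\<lambda>y. cis (- (2 * a) * (y - c)\<^sup>2) * cnj (g y)) - 2 * fresnel_end / sqrt (2 * a) * cnj (g c))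
      \<le> 7 * pi * G / (2 * a * sqrt (2 * a))"
      by (rule stationary_phase[of _ "\<lambda>y. cnj (g y)" "\<lambda>y. cnj (g' y)" "\<lambda>y. cnj (g'' y)"])
         (use a G zero in \<open>auto intro!: has_vector_derivative_cnj g g' continuous_intros cont\<close>)
    also have "integral {-1..1} (\<lambda>y. cis (- (2 * a) * (y - c)\<^sup>2) * cnj (g y))
       = cnj (integral {-1..1} (\<lambda>y. cis (- \<sigma> * (2 * a) * (y - c)\<^sup>2) * g y))"
      unfolding s by (subst Henstock_Kurzweil_Integration.integral_cnj) (simp add: cis_cnj)
    also have "2 * fresnel_end / sqrt (2 * a) * cnj (g c) = cnj (2 * cnj fresnel_end / sqrt (2 * a) * g c)"
      by simp
    finally show ?thesis
      unfolding complex_cnj_diff[symmetric] complex_mod_cnj using s by simp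
  qed
  finally show ?thesis by (simp only: c_def)
qed

text \<open>The amplitude after the substitution \<open>y = sin \<theta>\<close>.\<close>

definition ampl :: "(real \<Rightarrow> complex) \<Rightarrow> real \<Rightarrow> real \<Rightarrow> complex" where
  "ampl w B y = (let c = sqrt (1 - y\<^sup>2) in
     if \<bar>y\<bar> < 1 then w (B * c) * (1 + \<i> * of_real (y / c)) else 0)"

text \<open>First derivative in closed form, extended by 0. With c = sqrt(1 - y^2) the rules behind
  it and behind the second derivative are c' = -y/c, (y/c)' = 1/c^3 and (1/c^3)' = 3y/c^5.\<close>

definition ampl' :: "(real \<Rightarrow> complex) \<Rightarrow> real \<Rightarrow> real \<Rightarrow> complex" where
  "ampl' w B y = (let c = sqrt (1 - y\<^sup>2) in
     if \<bar>y\<bar> < 1 then of_real (- B * y / c) * vderiv 1 w (B * c) * (1 + \<i> * of_real (y / c))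
       + w (B * c) * (\<i> * of_real (1 / c ^ 3)) else 0)"

definition ampl'' :: "(real \<Rightarrow> complex) \<Rightarrow> real \<Rightarrow> real \<Rightarrow> complex" where
  "ampl'' w B y = (let c = sqrt (1 - y\<^sup>2) in
     if \<bar>y\<bar> < 1 then (of_real ((B * y / c)\<^sup>2) * vderiv 2 w (B * c) + of_real (- B / c ^ 3) * vderiv 1 w (B * c)) * (1 + \<i> * of_real (y / c))
       + 2 * (of_real (- B * y / c) * vderiv 1 w (B * c)) * (\<i> * of_real (1 / c ^ 3))
       + w (B * c) * (\<i> * of_real (3 * y / c ^ 5)) else 0)"

context
  fixes C K w and B :: real
  assumes w: "weight C K w" and K: "0 < K" and B: "0 < B"
begin

text \<open>There B c <= K, so w and its derivatives vanish. The condition is open and contains all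
  |y| >= 1, hence the singularities of 1/c at y = 1 and y = -1 are never met.\<close>

lemma ampl_zero:
  assumes "1 - (K / B)\<^sup>2 < y\<^sup>2"
  shows "ampl w B y = 0" "ampl' w B y = 0" "ampl'' w B y = 0"
proof -
  have "sqrt (1 - y\<^sup>2) \<le> sqrt ((K / B)\<^sup>2)" using assms by (intro real_sqrt_le_mono) simp
  then have "sqrt (1 - y\<^sup>2) \<le> K / B" using K B by simp
  then have "B * sqrt (1 - y\<^sup>2) \<le> K" using B by (simp add: pos_le_divide_eq mult.commute)
  then have "vderiv j w (B * sqrt (1 - y\<^sup>2)) = 0" for j by (intro weight_zero[OF w]) simp
  from this this[of 0] show "ampl w B y = 0" "ampl' w B y = 0" "ampl'' w B y = 0"
    by (simp_all add: ampl_def ampl'_def ampl''_def Let_def)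
qed

lemma sqrt_deriv:
  assumes "\<bar>y\<bar> < 1"
  shows "((\<lambda>y. sqrt (1 - y\<^sup>2)) has_real_derivative - y / sqrt (1 - y\<^sup>2)) (at y)"
proof -
  have "0 < 1 - y\<^sup>2" using assms by (simp add: abs_square_less_1)
  then show ?thesis by (auto intro!: derivative_eq_intros simp: field_simps)
qed

lemma vderiv_sqrt_deriv:
  assumes "\<bar>y\<bar> < 1"
  shows "((\<lambda>y. vderiv j w (B * sqrt (1 - y\<^sup>2))) has_vector_derivative
      of_real (- B * y / sqrt (1 - y\<^sup>2)) * vderiv (Suc j) w (B * sqrt (1 - y\<^sup>2))) (at y)"
proof -
  have "((\<lambda>y. B * sqrt (1 - y\<^sup>2)) has_vector_derivative - B * y / sqrt (1 - y\<^sup>2)) (at y)"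
    using DERIV_cmult[OF sqrt_deriv[OF assms], of B]
    by (simp add: has_real_derivative_iff_has_vector_derivative)
  from vector_diff_chain_at[OF this weight_deriv[OF w, of j "B * sqrt (1 - y\<^sup>2)" UNIV]] show ?thesis
    by (simp add: o_def scaleR_conv_of_real)
qed

text \<open>Two open sets cover the line: (-1, 1), where the formulas are differentiated, and the
  set of \<open>ampl_zero\<close>, where everything is locally 0. Continuity of the second
  derivative uses the same cover.\<close>

lemma ampl_deriv:
  shows "(ampl w B has_vector_derivative ampl' w B y) (at y)"
    and "(ampl' w B has_vector_derivative ampl'' w B y) (at y)"
proof -
  have *: "(ampl w B has_vector_derivative ampl' w B y) (at y) \<and> (ampl' w B has_vector_derivative ampl'' w B y) (at y)"
  proof (cases "\<bar>y\<bar> < 1")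
    case False
    let ?O = "{y. 1 - (K / B)\<^sup>2 < y\<^sup>2}"
    have o: "open ?O" by (intro open_Collect_less continuous_intros)
    have "1\<^sup>2 \<le> \<bar>y\<bar>\<^sup>2" using False by (intro power_mono) auto
    moreover have "0 < (K / B)\<^sup>2" using K B by simp
    ultimately have "1 - (K / B)\<^sup>2 < y\<^sup>2" unfolding power2_abs one_power2 by linarith
    then have y: "y \<in> ?O" by simp
    have "(g has_vector_derivative 0) (at y)" if "\<And>x. x \<in> ?O \<Longrightarrow> g x = 0" for g :: "real \<Rightarrow> complex"
      by (rule has_vector_derivative_transform_within_open[OF has_vector_derivative_const[of 0] o y])
         (use that in simp)
    from this[of "ampl w B"] this[of "ampl' w B"] show ?thesis
      using ampl_zero y by simp
  next
    case True
    let ?c = "\<lambda>y. sqrt (1 - y\<^sup>2)"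
    let ?O = "{-1<..<1::real}"
    have o: "open ?O" "y \<in> ?O" using True by auto
    have c0: "0 < ?c y" using True by (simp add: abs_square_less_1)
    have c2: "(?c y)\<^sup>2 = 1 - y\<^sup>2" using True by (simp add: abs_square_le_1 less_imp_le)
    note dc = sqrt_deriv[OF True]
    have q: "((\<lambda>y. 1 + \<i> * of_real (y / ?c y)) has_vector_derivative \<i> * of_real (1 / ?c y ^ 3)) (at y)"
    proof -
      have "((\<lambda>y. y / ?c y) has_real_derivative (1 * ?c y - y * (- y / ?c y)) / (?c y * ?c y)) (at y)"
        using c0 by (intro DERIV_divide DERIV_ident dc) auto
      moreover have "(1 * ?c y - y * (- y / ?c y)) / (?c y * ?c y) = 1 / ?c y ^ 3"
      proof -
        have "1 * ?c y - y * (- y / ?c y) = ((?c y)\<^sup>2 + y\<^sup>2) / ?c y"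
          using c0 by (simp add: field_simps power2_eq_square)
        then show ?thesis unfolding c2 by (simp add: power3_eq_cube)
      qed
      ultimately have "((\<lambda>y. y / ?c y) has_real_derivative 1 / ?c y ^ 3) (at y)"
        by (simp only:)
      from has_vector_derivative_add[OF has_vector_derivative_const[of 1] has_vector_derivative_mult_right[OF has_vector_derivative_of_real[OF this], of \<i>]]
      show ?thesis by simp
    qed
    have r: "((\<lambda>y. of_real (- B * y / ?c y)) has_vector_derivative complex_of_real (- B / ?c y ^ 3)) (at y)"
    proof -
      have "((\<lambda>y. - B * y / ?c y) has_real_derivative (- B * 1 * ?c y - - B * y * (- y / ?c y)) / (?c y * ?c y)) (at y)"
        using c0 by (intro DERIV_divide DERIV_cmult DERIV_ident dc) auto
      moreover have "(- B * 1 * ?c y - - B * y * (- y / ?c y)) / (?c y * ?c y) = - B / ?c y ^ 3"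
      proof -
        have "- B * 1 * ?c y - - B * y * (- y / ?c y) = - B * (((?c y)\<^sup>2 + y\<^sup>2) / ?c y)"
          using c0 by (simp add: field_simps power2_eq_square)
        then show ?thesis unfolding c2 by (simp add: power3_eq_cube)
      qed
      ultimately have "((\<lambda>y. - B * y / ?c y) has_real_derivative - B / ?c y ^ 3) (at y)"
        by (simp only:)
      then show ?thesis by (rule has_vector_derivative_of_real)
    qed
    have t: "((\<lambda>y. \<i> * of_real (1 / ?c y ^ 3)) has_vector_derivative \<i> * of_real (3 * y / ?c y ^ 5)) (at y)"
    proof -
      have "((\<lambda>y. 1 / ?c y ^ 3) has_real_derivative (0 * ?c y ^ 3 - 1 * (3 * ?c y ^ 2 * (- y / ?c y))) / (?c y ^ 3 * ?c y ^ 3)) (at y)"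
      proof (intro DERIV_divide DERIV_const)
        have "real 3 * (d * c ^ (3 - Suc 0)) = 3 * c ^ 2 * d" for c d :: real by simp
        then show "((\<lambda>y. ?c y ^ 3) has_real_derivative 3 * ?c y ^ 2 * (- y / ?c y)) (at y)"
          by (rule DERIV_cong[OF DERIV_power[OF dc, of 3]])
      qed (use c0 in simp)
      moreover have "(0 * ?c y ^ 3 - 1 * (3 * ?c y ^ 2 * (- y / ?c y))) / (?c y ^ 3 * ?c y ^ 3) = 3 * y / ?c y ^ 5"
      proof -
        have "(0 * c ^ 3 - 1 * (3 * c ^ 2 * (- y / c))) / (c ^ 3 * c ^ 3) = 3 * y / c ^ 5" if "0 < c" for c
          using that by (simp add: field_simps eval_nat_numeral)
        then show ?thesis using c0 by blast
      qed
      ultimately have "((\<lambda>y. 1 / ?c y ^ 3) has_real_derivative 3 * y / ?c y ^ 5) (at y)"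
        by (simp only:)
      from has_vector_derivative_mult_right[OF has_vector_derivative_of_real[OF this], of \<i>]
      show ?thesis by simp
    qed
    note w0 = vderiv_sqrt_deriv[OF True, of 0, simplified vderiv_0 One_nat_def[symmetric]]
    note w1 = vderiv_sqrt_deriv[OF True, of 1, simplified Suc_1]
    have "((\<lambda>y. w (B * ?c y) * (1 + \<i> * of_real (y / ?c y))) has_vector_derivative ampl' w B y) (at y)"
      by (rule has_vector_derivative_eq_rhs[OF has_vector_derivative_mult[OF w0 q]])
         (use True in \<open>simp add: ampl'_def Let_def\<close>)
    then have 1: "(ampl w B has_vector_derivative ampl' w B y) (at y)"
      by (rule has_vector_derivative_transform_within_open[OF _ o]) (auto simp: ampl_def Let_def)
    have "((\<lambda>y. of_real (- B * y / ?c y) * vderiv 1 w (B * ?c y) * (1 + \<i> * of_real (y / ?c y))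
       + w (B * ?c y) * (\<i> * of_real (1 / ?c y ^ 3))) has_vector_derivative ampl'' w B y) (at y)"
      by (rule has_vector_derivative_eq_rhs[OF has_vector_derivative_add[OF
            has_vector_derivative_mult[OF has_vector_derivative_mult[OF r w1] q]
            has_vector_derivative_mult[OF w0 t]]])
         (use True in \<open>simp add: ampl''_def Let_def power2_eq_square algebra_simps\<close>)
    then have 2: "(ampl' w B has_vector_derivative ampl'' w B y) (at y)"
      by (rule has_vector_derivative_transform_within_open[OF _ o]) (auto simp: ampl'_def Let_def)
    from 1 2 show ?thesis ..
  qed
  from * show "(ampl w B has_vector_derivative ampl' w B y) (at y)"
    "(ampl' w B has_vector_derivative ampl'' w B y) (at y)" by auto
qed

lemma ampl''_continuous: "continuous_on UNIV (ampl'' w B)"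
proof -
  let ?O1 = "{-1<..<1::real}" and ?O2 = "{y. 1 - (K / B)\<^sup>2 < y\<^sup>2}"
  have "continuous_on (?O1 \<union> ?O2) (ampl'' w B)"
  proof (rule continuous_on_open_Un)
    show "open ?O2" by (intro open_Collect_less continuous_intros)
    have nz: "sqrt (1 - y\<^sup>2) \<noteq> 0" if "y \<in> ?O1" for y
    proof -
      have "y\<^sup>2 < 1" using that by (simp add: abs_square_less_1 abs_less_iff)
      then show ?thesis by simp
    qed
    have cv: "continuous_on ?O1 (\<lambda>y. vderiv j w (B * sqrt (1 - y\<^sup>2)))" for j
      by (intro continuous_on_compose2[OF weight_continuous[OF w]]) (auto intro!: continuous_intros)
    have "continuous_on ?O1 (\<lambda>y. let c = sqrt (1 - y\<^sup>2) in
       (of_real ((B * y / c)\<^sup>2) * vderiv 2 w (B * c) + of_real (- B / c ^ 3) * vderiv 1 w (B * c)) * (1 + \<i> * of_real (y / c))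
       + 2 * (of_real (- B * y / c) * vderiv 1 w (B * c)) * (\<i> * of_real (1 / c ^ 3))
       + w (B * c) * (\<i> * of_real (3 * y / c ^ 5)))"
      unfolding Let_def using cv[of 0] nz
      by (intro continuous_intros cv) (auto simp del: real_sqrt_eq_0_iff)
    then show "continuous_on ?O1 (ampl'' w B)"
      by (rule continuous_on_eq) (auto simp: ampl''_def Let_def)
    show "continuous_on ?O2 (ampl'' w B)"
      by (rule continuous_on_eq[OF continuous_on_const[of _ 0]]) (auto simp: ampl_zero)
  qed auto
  moreover have "y \<in> ?O1 \<union> ?O2" for y
  proof (cases "\<bar>y\<bar> < 1")
    case False
    then have "1\<^sup>2 \<le> \<bar>y\<bar>\<^sup>2" by (intro power_mono) auto
    moreover have "0 < (K / B)\<^sup>2" using K B by simp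
    ultimately have "1 - (K / B)\<^sup>2 < y\<^sup>2" unfolding power2_abs one_power2 by linarith
    then show ?thesis by simp
  qed auto
  then have "?O1 \<union> ?O2 = UNIV" by blast
  ultimately show ?thesis by simp
qed

text \<open>On the support B c > K, so 1/c is at most tau = B/K. Every term then costs tau^5,
  because each factor B is accompanied by a derivative of w worth 1/K and so counts as one
  tau.\<close>

lemma norm_ampl''_le:
  "norm (ampl'' w B y) \<le> (3 * C 0 + 3 * C 1 + C 2) * (B / K) ^ 5"
proof (cases "\<bar>y\<bar> < 1 \<and> K < B * sqrt (1 - y\<^sup>2)")
  case False
  have "ampl'' w B y = 0"
  proof (cases "\<bar>y\<bar> < 1")
    case True
    with False have "vderiv j w (B * sqrt (1 - y\<^sup>2)) = 0" for j by (intro weight_zero[OF w]) simp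
    from this this[of 0] show ?thesis by (simp add: ampl''_def Let_def)
  qed (simp add: ampl''_def Let_def)
  then show ?thesis
    using weight_bound(2)[OF w K] K B by simp
next
  case True
  define c where "c = sqrt (1 - y\<^sup>2)"
  define \<tau> where "\<tau> = B / K"
  have y1: "y\<^sup>2 < 1" using True by (simp add: abs_square_less_1)
  have c: "0 < c" "c\<^sup>2 = 1 - y\<^sup>2" using y1 by (auto simp: c_def)
  have \<tau>: "0 < \<tau>" using K B by (simp add: \<tau>_def)
  have ct: "1 / c \<le> \<tau>"
    using True K c by (simp add: \<tau>_def c_def field_simps)
  have W: "norm (vderiv j w x) \<le> C j / K ^ j" for j x by (rule weight_bound(1)[OF w K])
  have C: "0 \<le> C j" for j by (rule weight_bound(2)[OF w K])
  have cp: "1 / c ^ n \<le> \<tau> ^ n" for n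
    using power_mono[OF ct, of n] c by (simp add: power_divide)
  have Byc: "\<bar>B * y / c\<bar> \<le> K * \<tau> ^ 2"
  proof -
    have "\<bar>B * y / c\<bar> = B * \<bar>y\<bar> * (1 / c)" using B c by (simp add: abs_mult)
    also have "\<dots> \<le> B * 1 * \<tau>" using B c ct True by (intro mult_mono) auto
    also have "\<dots> = K * \<tau> ^ 2" using K by (simp add: \<tau>_def power2_eq_square)
    finally show ?thesis .
  qed
  \<comment> \<open>The norm is exactly 1/c, since c^2 + y^2 = 1.\<close>
  have q: "norm (1 + \<i> * of_real (y / c)) \<le> \<tau>"
  proof -
    have "norm (1 + \<i> * of_real (y / c)) = sqrt ((c\<^sup>2 + y\<^sup>2) / c\<^sup>2)"
      using c(1) unfolding cmod_def by (simp add: power_divide add_divide_distrib)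
    also have "(c\<^sup>2 + y\<^sup>2) / c\<^sup>2 = (1 / c)\<^sup>2"
    proof -
      have "c\<^sup>2 + y\<^sup>2 = 1" using c(2) by simp
      then show ?thesis by (simp only: power_divide one_power2)
    qed
    also have "sqrt ((1 / c)\<^sup>2) = 1 / c"
      unfolding real_sqrt_abs using c(1) by simp
    finally show ?thesis using ct by simp
  qed
  have t1: "norm (of_real ((B * y / c)\<^sup>2) * vderiv 2 w (B * c) + of_real (- B / c ^ 3) * vderiv 1 w (B * c)) \<le> (C 2 + C 1) * \<tau> ^ 4"
  proof -
    have "norm (of_real ((B * y / c)\<^sup>2) * vderiv 2 w (B * c)) \<le> (K * \<tau> ^ 2)\<^sup>2 * (C 2 / K ^ 2)"
      unfolding norm_mult norm_of_real power_abs
      using Byc by (intro mult_mono power_mono W) auto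
    moreover have "norm (of_real (- B / c ^ 3) * vderiv 1 w (B * c)) \<le> (B * \<tau> ^ 3) * (C 1 / K ^ 1)"
    proof -
      have "\<bar>- B / c ^ 3\<bar> \<le> B * \<tau> ^ 3" using mult_left_mono[OF cp[of 3], of B] B c by simp
      then show ?thesis unfolding norm_mult norm_of_real
        using B \<tau> by (intro mult_mono W) auto
    qed
    ultimately have "norm (of_real ((B * y / c)\<^sup>2) * vderiv 2 w (B * c) + of_real (- B / c ^ 3) * vderiv 1 w (B * c))
       \<le> (K * \<tau> ^ 2)\<^sup>2 * (C 2 / K ^ 2) + (B * \<tau> ^ 3) * (C 1 / K ^ 1)"
      by (rule norm_triangle_mono)
    also have "\<dots> = (C 2 + C 1) * \<tau> ^ 4"
      using K by (simp add: \<tau>_def field_simps eval_nat_numeral)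
    finally show ?thesis .
  qed
  have t2: "norm (2 * (of_real (- B * y / c) * vderiv 1 w (B * c)) * (\<i> * of_real (1 / c ^ 3))) \<le> 2 * (K * \<tau> ^ 2 * (C 1 / K ^ 1)) * \<tau> ^ 3"
  proof -
    have "\<bar>- B * y / c\<bar> \<le> K * \<tau> ^ 2" using Byc by simp
    moreover have "\<bar>1 / c ^ 3\<bar> \<le> \<tau> ^ 3" using cp[of 3] c by simp
    ultimately have "2 * (\<bar>- B * y / c\<bar> * norm (vderiv 1 w (B * c))) * \<bar>1 / c ^ 3\<bar> \<le> 2 * (K * \<tau> ^ 2 * (C 1 / K ^ 1)) * \<tau> ^ 3"
      using \<tau> K C by (intro mult_mono W) auto
    then show ?thesis by (simp only: norm_mult norm_of_real norm_ii mult_1_left norm_numeral)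
  qed
  have t3: "norm (w (B * c) * (\<i> * of_real (3 * y / c ^ 5))) \<le> C 0 * (3 * \<tau> ^ 5)"
  proof -
    have "\<bar>3 * y / c ^ 5\<bar> = 3 * \<bar>y\<bar> * (1 / c ^ 5)" using c by (simp add: abs_mult)
    also have "\<dots> \<le> 3 * 1 * \<tau> ^ 5" using True c cp[of 5] by (intro mult_mono) auto
    finally have "\<bar>3 * y / c ^ 5\<bar> \<le> 3 * \<tau> ^ 5" by simp
    moreover have "norm (w (B * c)) \<le> C 0" using W[of 0 "B * c"] by simp
    ultimately have "norm (w (B * c)) * \<bar>3 * y / c ^ 5\<bar> \<le> C 0 * (3 * \<tau> ^ 5)"
      using C by (intro mult_mono) auto
    then show ?thesis by (simp only: norm_mult norm_of_real norm_ii mult_1_left)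
  qed
  have "ampl'' w B y = (of_real ((B * y / c)\<^sup>2) * vderiv 2 w (B * c) + of_real (- B / c ^ 3) * vderiv 1 w (B * c)) * (1 + \<i> * of_real (y / c))
       + 2 * (of_real (- B * y / c) * vderiv 1 w (B * c)) * (\<i> * of_real (1 / c ^ 3))
       + w (B * c) * (\<i> * of_real (3 * y / c ^ 5))"
    using True by (simp add: ampl''_def Let_def c_def)
  also have "norm \<dots> \<le> (C 2 + C 1) * \<tau> ^ 4 * \<tau> + 2 * (K * \<tau> ^ 2 * (C 1 / K ^ 1)) * \<tau> ^ 3 + C 0 * (3 * \<tau> ^ 5)"
  proof (intro norm_triangle_mono t2 t3)
    show "norm ((of_real ((B * y / c)\<^sup>2) * vderiv 2 w (B * c) + of_real (- B / c ^ 3) * vderiv 1 w (B * c)) * (1 + \<i> * of_real (y / c)))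
       \<le> (C 2 + C 1) * \<tau> ^ 4 * \<tau>"
      unfolding norm_mult using t1 q C \<tau> by (intro mult_mono) auto
  qed
  also have "\<dots> = (3 * C 0 + 3 * C 1 + C 2) * \<tau> ^ 5"
    using K by (simp add: algebra_simps eval_nat_numeral)
  finally show ?thesis by (simp only: \<tau>_def)
qed

text \<open>Only theta in (-pi/2, pi/2) matters, because w(B cos theta) = 0 when the cosine is not
  positive. There sin is injective, and cos(2 theta) = 1 - 2 sin(theta)^2 makes the phase quadratic
  in y.\<close>

lemma integral_sin_substitution:
  "integral {-pi..pi} (\<lambda>\<theta>. cis (s * cos (2 * \<theta>)) * (bphase b \<theta> * w (B * cos \<theta>)))
   = integral {-1..1} (\<lambda>y. cis (s * (1 - 2 * y\<^sup>2) + b * y) * ampl w B y)"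
proof -
  define f where "f y = cis (s * (1 - 2 * y\<^sup>2) + b * y) * ampl w B y" for y
  define h where "h \<theta> = cis (s * cos (2 * \<theta>)) * (bphase b \<theta> * w (B * cos \<theta>))" for \<theta>
  have ca: "continuous_on A (ampl w B)" for A
    by (auto intro!: continuous_at_imp_continuous_on has_vector_derivative_continuous ampl_deriv)
  have w0: "w (B * x) = 0" if "x \<le> 0" for x
    using weight_zero[OF w, of "B * x" 0] that B K by (simp add: mult_nonneg_nonpos order_trans[of _ 0])
  have "((\<lambda>\<theta>. cos \<theta> *\<^sub>R f (sin \<theta>)) has_integral integral {sin (- (pi / 2))..sin (pi / 2)} f) {-(pi / 2)..pi / 2}"
    by (rule has_integral_substitution[where c = "-1" and d = 1])
       (auto simp: f_def intro!: continuous_intros ca derivative_eq_intros)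
  moreover have "cos \<theta> *\<^sub>R f (sin \<theta>) = h \<theta>" if "\<theta> \<in> {-(pi / 2)..pi / 2}" for \<theta>
  proof (cases "\<theta> = pi / 2 \<or> \<theta> = - (pi / 2)")
    \<comment> \<open>At the end points both sides are 0: the Jacobian cos(theta) vanishes on one
      side, w(0) on the other.\<close>
    case True
    then have "cos \<theta> = 0" using cos_minus cos_pi_half by metis
    then show ?thesis using w0[of 0] by (simp add: h_def)
  next
    case False
    then have c: "0 < cos \<theta>" using that by (intro cos_gt_zero_pi) auto
    have "(sin \<theta>)\<^sup>2 < 1" using c by (simp add: sin_squared_eq)
    then have s1: "\<bar>sin \<theta>\<bar> < 1" by (simp add: abs_square_less_1)
    have sc: "sqrt (1 - (sin \<theta>)\<^sup>2) = cos \<theta>" using c by (simp add: cos_squared_eq[symmetric])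
    \<comment> \<open>This is the origin of the factor 1 + i y/c: it is \<open>cis \<theta>\<close>
      from \<open>bphase\<close> divided by the Jacobian cos(theta).\<close>
    have "of_real (cos \<theta>) * (1 + \<i> * of_real (sin \<theta> / cos \<theta>)) = cis \<theta>"
      using c by (simp add: complex_eq_iff)
    moreover have "bphase b \<theta> = cis (b * sin \<theta>) * cis \<theta>" by (simp add: bphase_def cis_mult)
    moreover have "cis (s * (1 - 2 * (sin \<theta>)\<^sup>2) + b * sin \<theta>) = cis (s * cos (2 * \<theta>)) * cis (b * sin \<theta>)"
      by (simp add: cis_mult cos_double_sin)
    ultimately show ?thesis
      unfolding f_def h_def ampl_def Let_def sc scaleR_conv_of_real using s1 by (simp add: mult_ac)
  qed
  ultimately have "(h has_integral integral {-1..1} f) {-(pi / 2)..pi / 2}"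
    by (subst has_integral_cong[symmetric]) auto
  \<comment> \<open>The cut-off makes the integrand 0 at every point outside the smaller interval,
    as the extension rule demands; without it the cosine would become positive again beyond
    [-pi, pi].\<close>
  then have "((\<lambda>\<theta>. if \<theta> \<in> {-pi..pi} then h \<theta> else 0) has_integral integral {-1..1} f) {-(pi / 2)..pi / 2}"
    by (rule has_integral_eq[rotated]) auto
  then have "((\<lambda>\<theta>. if \<theta> \<in> {-pi..pi} then h \<theta> else 0) has_integral integral {-1..1} f) {-pi..pi}"
  proof (rule has_integral_on_superset)
    fix \<theta> :: real assume t: "\<theta> \<notin> {-(pi / 2)..pi / 2}"
    show "(if \<theta> \<in> {-pi..pi} then h \<theta> else 0) = 0"
    proof (cases "\<theta> \<in> {-pi..pi}")
      case True
      then have "cos \<bar>\<theta>\<bar> \<le> cos (pi / 2)" using t by (intro cos_monotone_0_pi_le) auto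
      then show ?thesis using w0[of "cos \<theta>"] by (simp add: h_def)
    qed auto
  qed auto
  then have "(h has_integral integral {-1..1} f) {-pi..pi}"
    by (rule has_integral_eq[rotated]) auto
  then show ?thesis by (simp add: f_def[abs_def] h_def[abs_def] integral_unique)
qed

end

section \<open>The amplitude on the strip and its partial derivatives\<close>

text \<open>The \<open>i\<close>-th derivative of \<open>vderiv j w (2 * pi * x) / x ^ m\<close> in \<open>x\<close>.\<close>

fun quot_deriv :: "(real \<Rightarrow> complex) \<Rightarrow> nat \<Rightarrow> nat \<Rightarrow> nat \<Rightarrow> real \<Rightarrow> complex" where
  "quot_deriv w 0 j m x = vderiv j w (2 * pi * x) / of_real x ^ m"
| "quot_deriv w (Suc i) j m x = 2 * of_real pi * quot_deriv w i (Suc j) m x - of_nat m * quot_deriv w i j (Suc m) x"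

text \<open>Constants obeying the recursion of \<open>quot_deriv\<close>; (2 pi)^m stems from 1/x <=
  2 pi / K on the support.\<close>

fun quot_bound :: "(nat \<Rightarrow> real) \<Rightarrow> nat \<Rightarrow> nat \<Rightarrow> nat \<Rightarrow> real" where
  "quot_bound C 0 j m = C j * (2 * pi) ^ m"
| "quot_bound C (Suc i) j m = 2 * pi * quot_bound C i (Suc j) m + real m * quot_bound C i j (Suc m)"

text \<open>The function kappa w(2 pi x) (1 + i r y / x) with r = sigma beta. It arises from
  \<open>ampl\<close> at y = sigma gamma on writing x = beta c with c = sqrt(1 - gamma^2), since
  gamma / c = beta gamma / x.\<close>

definition strip_amp :: "complex \<Rightarrow> (real \<Rightarrow> complex) \<Rightarrow> real \<Rightarrow> real \<Rightarrow> real \<Rightarrow> complex" where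
  "strip_amp \<kappa> w r x y = (if y \<in> {0..1}
     then \<kappa> * (quot_deriv w 0 0 0 x + of_real y * (\<i> * of_real r) * quot_deriv w 0 0 1 x) else 0)"

text \<open>The j-th derivative of the coordinate y.\<close>

definition y_coeff :: "nat \<Rightarrow> real \<Rightarrow> complex" where
  "y_coeff j y = (if j = 0 then of_real y else if j = 1 then 1 else 0)"

lemma y_coeff_deriv: "(y_coeff j has_vector_derivative y_coeff (Suc j) y) (at y within A)"
proof (cases "j = 0")
  case True
  have "(of_real has_vector_derivative (1::complex)) (at y within A)"
    using has_vector_derivative_of_real[OF DERIV_ident] by simp
  then show ?thesis using True by (simp add: y_coeff_def[abs_def])
next
  case False
  then show ?thesis by (auto simp: y_coeff_def[abs_def])
qed

context
  fixes C K w
  assumes w: "weight C K w" and K: "0 < K"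
begin

lemma quot_deriv_zero:
  assumes "2 * pi * x \<le> K \<or> 2 * K \<le> 2 * pi * x"
  shows "quot_deriv w i j m x = 0"
  using weight_zero[OF w assms] by (induction i arbitrary: j m) auto

text \<open>For 2 pi x < K the function vanishes near x, which disposes of x <= 0 and of the
  division by 0 at the origin. Otherwise x > 0 and the quotient rule applies; higher orders follow
  by linearity from the recursion.\<close>

lemma quot_deriv_deriv:
  "(quot_deriv w i j m has_vector_derivative quot_deriv w (Suc i) j m x) (at x within A)"
proof -
  have "(quot_deriv w i j m has_vector_derivative quot_deriv w (Suc i) j m x) (at x)"
  proof (induction i arbitrary: j m)
    case 0
    show ?case
    proof (cases "2 * pi * x < K")
      case True
      let ?O = "{x. 2 * pi * x < K}"
      have "(quot_deriv w 0 j m has_vector_derivative 0) (at x)"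
      proof (rule has_vector_derivative_transform_within_open[OF has_vector_derivative_const[of 0]])
        show "open ?O" by (intro open_Collect_less continuous_intros)
        show "x \<in> ?O" using True by simp
        fix y assume "y \<in> ?O"
        then show "0 = quot_deriv w 0 j m y" using quot_deriv_zero[of y 0 j m] by simp
      qed
      moreover have "quot_deriv w (Suc 0) j m x = 0" using True by (intro quot_deriv_zero) simp
      ultimately show ?thesis by (simp only:)
    next
      case False
      then have "0 < 2 * pi * x" using K by linarith
      then have x: "0 < x" by (simp add: zero_less_mult_iff)
      have "((\<lambda>x. 2 * pi * x) has_vector_derivative 2 * pi) (at x)"
        by (auto intro!: derivative_eq_intros simp flip: has_real_derivative_iff_has_vector_derivative)
      from vector_diff_chain_at[OF this weight_deriv[OF w, of j "2 * pi * x" UNIV]]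
      have 1: "((\<lambda>x. vderiv j w (2 * pi * x)) has_vector_derivative 2 * of_real pi * vderiv (Suc j) w (2 * pi * x)) (at x)"
        by (simp add: o_def scaleR_conv_of_real)
      have "((\<lambda>x. inverse (x ^ m)) has_real_derivative - (real m * inverse (x ^ Suc m))) (at x)"
      proof (rule DERIV_cong[OF DERIV_inverse'[OF DERIV_pow]])
        show "- (inverse (x ^ m) * (real m * x ^ (m - Suc 0)) * inverse (x ^ m)) = - (real m * inverse (x ^ Suc m))"
          using x by (cases m) (auto simp: field_simps)
      qed (use x in simp)
      from has_vector_derivative_of_real[OF this, where 'a = complex]
      have 2: "((\<lambda>x. inverse (of_real x ^ m)) has_vector_derivative - (of_nat m * inverse (of_real x ^ Suc m) :: complex)) (at x)"
        by simp
      have f: "quot_deriv w 0 j m = (\<lambda>x. vderiv j w (2 * pi * x) * inverse (of_real x ^ m))"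
        by (rule ext) (simp add: divide_inverse)
      show ?thesis
        unfolding f by (rule has_vector_derivative_eq_rhs[OF has_vector_derivative_mult[OF 1 2]])
          (simp add: divide_inverse algebra_simps)
    qed
  next
    case (Suc i)
    have f: "quot_deriv w (Suc i) j m = (\<lambda>x. 2 * of_real pi * quot_deriv w i (Suc j) m x - of_nat m * quot_deriv w i j (Suc m) x)"
      by (rule ext) simp
    show ?case
      unfolding f
      by (rule has_vector_derivative_eq_rhs[OF has_vector_derivative_diff[OF
            has_vector_derivative_mult_right[OF Suc.IH] has_vector_derivative_mult_right[OF Suc.IH]]]) simp
  qed
  then show ?thesis by (rule has_vector_derivative_at_within)
qed

lemma quot_bound_nonneg: "0 \<le> quot_bound C i j m"
  using weight_bound(2)[OF w K] by (induction i arbitrary: j m) auto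

text \<open>Differentiating w and dividing by x both cost 1/K, the latter because x >= K/(2 pi) on
  the support; hence only the total i + j + m counts.\<close>

lemma norm_quot_deriv_le:
  "norm (quot_deriv w i j m x) \<le> quot_bound C i j m / K ^ (i + j + m)"
proof (induction i arbitrary: j m)
  case 0
  show ?case
  proof (cases "2 * pi * x \<le> K")
    case True
    then show ?thesis
      using quot_deriv_zero[of x 0 j m] quot_bound_nonneg[of 0 j m] K by (simp del: quot_deriv.simps quot_bound.simps)
  next
    case False
    then have "0 < 2 * pi * x" using K by linarith
    then have x: "0 < x" by (simp add: zero_less_mult_iff)
    have "1 / x \<le> 2 * pi / K" using False x K by (simp add: field_simps)
    then have "(1 / x) ^ m \<le> (2 * pi / K) ^ m" using x by (intro power_mono) auto
    then have "norm (vderiv j w (2 * pi * x)) * (1 / x) ^ m \<le> C j / K ^ j * (2 * pi / K) ^ m"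
      using x weight_bound(2)[OF w K, of j] K by (intro mult_mono weight_bound(1)[OF w K]) auto
    then show ?thesis
      using x by (simp add: norm_divide norm_power power_divide power_add)
  qed
next
  case (Suc i)
  have "norm (quot_deriv w (Suc i) j m x)
     \<le> norm (2 * of_real pi * quot_deriv w i (Suc j) m x) + norm (of_nat m * quot_deriv w i j (Suc m) x)"
    unfolding quot_deriv.simps by (rule norm_triangle_ineq4)
  also have "\<dots> = 2 * pi * norm (quot_deriv w i (Suc j) m x) + real m * norm (quot_deriv w i j (Suc m) x)"
    by (simp add: norm_mult)
  also have "\<dots> \<le> 2 * pi * (quot_bound C i (Suc j) m / K ^ (i + Suc j + m)) + real m * (quot_bound C i j (Suc m) / K ^ (i + j + Suc m))"
    by (intro add_mono mult_left_mono Suc.IH) auto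
  also have "\<dots> = quot_bound C (Suc i) j m / K ^ (Suc i + j + m)"
    by (simp add: add_divide_distrib)
  finally show ?case .
qed

text \<open>As the amplitude is affine in y, derivatives in y act only on \<open>y_coeff\<close> and
  remove the first summand, after which derivatives in x act only on the quotients.\<close>

lemma partial_strip_amp:
  assumes "y \<in> {0..1}"
  shows "partial i j (strip_amp \<kappa> w r) x y = \<kappa> * ((if j = 0 then quot_deriv w i 0 0 x else 0)
      + y_coeff j y * (\<i> * of_real r) * quot_deriv w i 0 1 x)"
proof -
  have dy: "(d_y ^^ j) (strip_amp \<kappa> w r) x y = \<kappa> * ((if j = 0 then quot_deriv w 0 0 0 x else 0)
      + y_coeff j y * (\<i> * of_real r) * quot_deriv w 0 0 1 x)" if "y \<in> {0..1}" for x y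
    using that
  proof (induction j arbitrary: y)
    case 0
    then show ?case by (simp add: strip_amp_def y_coeff_def)
  next
    case (Suc j)
    let ?e = "\<lambda>j y. \<kappa> * ((if j = 0 then quot_deriv w 0 0 0 x else 0)
      + y_coeff j y * (\<i> * of_real r) * quot_deriv w 0 0 1 x)"
    have "(?e j has_vector_derivative \<kappa> * (0 + y_coeff (Suc j) y * (\<i> * of_real r) * quot_deriv w 0 0 1 x)) (at y within {0..1})"
      by (intro has_vector_derivative_mult_right has_vector_derivative_add has_vector_derivative_const
          has_vector_derivative_mult_left y_coeff_deriv)
    then have "((\<lambda>t. (d_y ^^ j) (strip_amp \<kappa> w r) x t) has_vector_derivative ?e (Suc j) y) (at y within {0..1})"
      by (subst has_vector_derivative_cong_ev[where g = "?e j", OF _ _ ])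
         (use Suc in \<open>auto intro!: always_eventually\<close>)
    then have "vector_derivative (\<lambda>t. (d_y ^^ j) (strip_amp \<kappa> w r) x t) (at y within {0..1}) = ?e (Suc j) y"
      using Suc.prems by (intro vector_derivative_within_closed_interval) auto
    then show ?case
      by (simp only: funpow.simps o_apply d_y_def[of "(d_y ^^ j) (strip_amp \<kappa> w r)" x y])
  qed
  show ?thesis
    unfolding partial_def
  proof (induction i arbitrary: x)
    case 0
    then show ?case using dy[OF assms] by simp
  next
    case (Suc i)
    let ?e = "\<lambda>i x. \<kappa> * ((if j = 0 then quot_deriv w i 0 0 x else 0)
      + y_coeff j y * (\<i> * of_real r) * quot_deriv w i 0 1 x)"
    have "((\<lambda>x. if j = 0 then quot_deriv w i 0 0 x else 0) has_vector_derivative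
         (if j = 0 then quot_deriv w (Suc i) 0 0 x else 0)) (at x)"
      using quot_deriv_deriv[of i 0 0 x UNIV] by (cases "j = 0") auto
    then have "(?e i has_vector_derivative ?e (Suc i) x) (at x)"
      by (intro has_vector_derivative_mult_right has_vector_derivative_add quot_deriv_deriv)
    then have "vector_derivative (?e i) (at x) = ?e (Suc i) x" by (rule vector_derivative_at)
    then show ?case
      by (simp only: funpow.simps o_apply d_x_def[of "(d_x ^^ i) ((d_y ^^ j) (strip_amp \<kappa> w r))" x y] Suc.IH)
  qed
qed

lemma continuous_quot_deriv: "continuous_on A (quot_deriv w i j m)"
  by (rule continuous_on_vector_derivative[OF quot_deriv_deriv])

lemma smooth_strip_amp: "smooth_on_strip (strip_amp \<kappa> w r)"
  unfolding smooth_on_strip_def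
proof (intro allI conjI ballI)
  fix i j :: nat
  have cy: "continuous_on A (y_coeff j)" for A
    by (rule continuous_on_vector_derivative[OF y_coeff_deriv])
  have "continuous_on (UNIV \<times> {0..1}) (\<lambda>p. \<kappa> * ((if j = 0 then quot_deriv w i 0 0 (fst p) else 0)
      + y_coeff j (snd p) * (\<i> * of_real r) * quot_deriv w i 0 1 (fst p)))"
  proof -
    have q: "continuous_on (UNIV \<times> {0..1::real}) (\<lambda>p. quot_deriv w i 0 m (fst p))" for m
      by (rule continuous_on_compose2[OF continuous_quot_deriv]) (auto intro!: continuous_intros)
    have y: "continuous_on (UNIV \<times> {0..1}) (\<lambda>p::real \<times> real. y_coeff j (snd p))"
      by (rule continuous_on_compose2[OF cy]) (auto intro!: continuous_intros)
    have "continuous_on (UNIV \<times> {0..1::real}) (\<lambda>p. if j = 0 then quot_deriv w i 0 0 (fst p) else 0)"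
      using q[of 0] by (cases "j = 0") auto
    then show ?thesis by (intro continuous_intros q y)
  qed
  then show "continuous_on (UNIV \<times> {0..1}) (\<lambda>(x, y). partial i j (strip_amp \<kappa> w r) x y)"
    by (rule continuous_on_eq) (auto simp: partial_strip_amp)
next
  fix i j :: nat and x y :: real assume y: "y \<in> {0..1}"
  have "((\<lambda>x. if j = 0 then quot_deriv w i 0 0 x else 0) has_vector_derivative
         (if j = 0 then quot_deriv w (Suc i) 0 0 x else 0)) (at x)"
    using quot_deriv_deriv[of i 0 0 x UNIV] by (cases "j = 0") auto
  then have "((\<lambda>s. \<kappa> * ((if j = 0 then quot_deriv w i 0 0 s else 0)
      + y_coeff j y * (\<i> * of_real r) * quot_deriv w i 0 1 s)) has_vector_derivative
      \<kappa> * ((if j = 0 then quot_deriv w (Suc i) 0 0 x else 0)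
      + y_coeff j y * (\<i> * of_real r) * quot_deriv w (Suc i) 0 1 x)) (at x)"
    by (intro has_vector_derivative_mult_right has_vector_derivative_add quot_deriv_deriv)
  then show "(\<lambda>s. partial i j (strip_amp \<kappa> w r) s y) differentiable (at x)"
    unfolding partial_strip_amp[OF y] by (rule differentiableI_vector)
  have "((\<lambda>t. \<kappa> * ((if j = 0 then quot_deriv w i 0 0 x else 0)
      + y_coeff j t * (\<i> * of_real r) * quot_deriv w i 0 1 x)) has_vector_derivative
      \<kappa> * (0 + y_coeff (Suc j) y * (\<i> * of_real r) * quot_deriv w i 0 1 x)) (at y within {0..1})"
    by (intro has_vector_derivative_mult_right has_vector_derivative_add has_vector_derivative_const
          has_vector_derivative_mult_left y_coeff_deriv)
  then have "((\<lambda>t. partial i j (strip_amp \<kappa> w r) x t) has_vector_derivative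
      \<kappa> * (0 + y_coeff (Suc j) y * (\<i> * of_real r) * quot_deriv w i 0 1 x)) (at y within {0..1})"
    by (rule has_vector_derivative_transform[OF y, rotated]) (simp only: partial_strip_amp)
  then show "(\<lambda>t. partial i j (strip_amp \<kappa> w r) x t) differentiable (at y within {0..1})"
    by (rule differentiableI_vector)
qed

text \<open>The summand with y/x is of size beta/K directly. The summand w(2 pi x) is only O(1), and
  beta >= K/100 pays for it with the factor 100.\<close>

lemma amplitude_strip_amp:
  assumes \<beta>: "K / 100 \<le> \<beta>" and r: "\<bar>r\<bar> = \<beta>" and \<kappa>: "norm \<kappa> \<le> k"
  shows "amplitude (\<lambda>i j. k * (100 * quot_bound C i 0 0 + quot_bound C i 0 1)) K \<beta> (strip_amp \<kappa> w r)"
  unfolding amplitude_def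
proof (intro conjI allI impI ballI smooth_strip_amp)
  fix x y assume "strip_amp \<kappa> w r x y \<noteq> 0"
  then have *: "y \<in> {0..1}" "quot_deriv w 0 0 0 x \<noteq> 0 \<or> quot_deriv w 0 0 1 x \<noteq> 0"
    by (auto simp: strip_amp_def simp del: quot_deriv.simps split: if_splits)
  then show "0 \<le> y" "y \<le> 1" by auto
  show "K \<le> 2 * pi * x" "2 * pi * x \<le> 2 * K"
    using *(2) quot_deriv_zero[of x 0 0] by force+
next
  fix i j :: nat and x y :: real assume y: "y \<in> {0..1}"
  have b0: "0 < \<beta>" using \<beta> K by simp
  have q: "0 \<le> quot_bound C i' j' m'" for i' j' m' by (rule quot_bound_nonneg)
  have 1: "norm (if j = 0 then quot_deriv w i 0 0 x else 0) \<le> 100 * quot_bound C i 0 0 * (\<beta> / K) / K ^ i"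
  proof -
    have "norm (if j = 0 then quot_deriv w i 0 0 x else 0) \<le> 1 * (quot_bound C i 0 0 / K ^ i)"
      using norm_quot_deriv_le[of i 0 0 x] q[of i 0 0] K by (auto simp del: quot_deriv.simps quot_bound.simps)
    also have "\<dots> \<le> (100 * (\<beta> / K)) * (quot_bound C i 0 0 / K ^ i)"
      using \<beta> K q[of i 0 0] by (intro mult_right_mono) (auto simp: field_simps)
    finally show ?thesis by (simp add: mult_ac)
  qed
  have yc: "norm (y_coeff j y) \<le> 1" using y by (auto simp: y_coeff_def)
  have "norm (y_coeff j y * (\<i> * of_real r)) \<le> 1 * \<beta>"
    unfolding norm_mult[of "y_coeff j y"] using yc r b0 by (intro mult_mono) (auto simp: norm_mult)
  then have 2: "norm (y_coeff j y * (\<i> * of_real r) * quot_deriv w i 0 1 x) \<le> (1 * \<beta>) * (quot_bound C i 0 1 / K ^ (i + 0 + 1))"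
    unfolding norm_mult[of _ "quot_deriv w i 0 1 x"] using b0 by (intro mult_mono norm_quot_deriv_le) auto
  have "norm (partial i j (strip_amp \<kappa> w r) x y) \<le> k * (100 * quot_bound C i 0 0 * (\<beta> / K) / K ^ i + (1 * \<beta>) * (quot_bound C i 0 1 / K ^ (i + 0 + 1)))"
    unfolding partial_strip_amp[OF y] norm_mult[of \<kappa>]
    by (intro mult_mono \<kappa> norm_triangle_mono 1 2 norm_ge_zero order_trans[OF norm_ge_zero \<kappa>])
  also have "\<dots> = k * (100 * quot_bound C i 0 0 + quot_bound C i 0 1) * (\<beta> / K) * K powr (- real i)"
    using K by (simp add: powr_minus powr_realpow field_simps)
  finally show "norm (partial i j (strip_amp \<kappa> w r) x y)
      \<le> k * (100 * quot_bound C i 0 0 + quot_bound C i 0 1) * (\<beta> / K) * K powr (- real i)" .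
qed

end

section \<open>The asymptotic formula\<close>

definition fresnel_sign :: "real \<Rightarrow> complex" where
  "fresnel_sign \<sigma> = (if \<sigma> = 1 then fresnel_end else cnj fresnel_end)"

text \<open>For each sign the integral T sigma is first replaced by the integral with
  \<open>ampl\<close> (error E1) and then by its stationary phase term (error E2). Nothing is
  assumed on the size of beta against K yet.\<close>

lemma S_approx:
  assumes w: "weight C K w" and K: "0 < K" and pos: "0 < \<alpha>" "0 < \<beta>"
  shows "norm (S w \<alpha> \<beta> - (\<Sum>\<sigma>\<in>{1, -1}. of_real \<sigma> / (4 * of_real pi)
        * (cis (\<sigma> * (4 * pi * \<alpha> + (4 * pi * \<beta>)\<^sup>2 / (8 * (4 * pi * \<alpha>))))
        * (2 * fresnel_sign \<sigma> / sqrt (2 * (4 * pi * \<alpha>))) * ampl w (2 * pi * \<beta>) (\<sigma> * \<beta> / (4 * \<alpha>)))))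
    \<le> 4 * pi * (C 0 + C 6) * (1 / K ^ 2 + 4 * pi * \<beta> / K ^ 3 + (4 * pi * \<beta>)\<^sup>2 / K ^ 4) + (pi * C 1 + 2 * C 2) / K
      + 7 * pi * ((3 * C 0 + 3 * C 1 + C 2) * (2 * pi * \<beta> / K) ^ 5) / (2 * (4 * pi * \<alpha>) * sqrt (2 * (4 * pi * \<alpha>)))"
    (is "norm (_ - (\<Sum>\<sigma>\<in>_. _ / _ * ?m \<sigma>)) \<le> ?E1 + ?E2")
proof -
  define a b where "a = 4 * pi * \<alpha>" and "b = 4 * pi * \<beta>"
  have ab: "0 < a" "0 < b" "b / 2 = 2 * pi * \<beta>" "b / (4 * a) = \<beta> / (4 * \<alpha>)" "0 < b / 2"
    using pos by (auto simp: a_def b_def)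
  define T where "T \<sigma> = integral {-pi..pi} (\<lambda>\<theta>. cis (\<sigma> * a * cos (2 * \<theta>)) * multiplier K w b \<theta>)" for \<sigma>
  have T: "norm (T \<sigma> - ?m \<sigma>) \<le> ?E1 + ?E2" if \<sigma>: "\<sigma> \<in> {1, -1}" for \<sigma> :: real
  proof -
    define I where "I = integral {-1..1} (\<lambda>y. cis (\<sigma> * a * (1 - 2 * y\<^sup>2) + b * y) * ampl w (b / 2) y)"
    have "norm (T \<sigma> - I) \<le> ?E1"
      using integral_multiplier_approx[OF w K ab(2), of "\<sigma> * a"]
      unfolding T_def I_def integral_sin_substitution[OF w K ab(5)] by (simp only: b_def)
    moreover have "norm (I - ?m \<sigma>) \<le> ?E2"
    proof -
      have z: "ampl w (b / 2) y = 0" "ampl' w (b / 2) y = 0" if "1 \<le> \<bar>y\<bar>" for y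
        using that by (auto simp: ampl_def ampl'_def Let_def)
      have "norm (I - cis (\<sigma> * (a + b\<^sup>2 / (8 * a))) * (2 * (if \<sigma> = 1 then fresnel_end else cnj fresnel_end) / sqrt (2 * a))
          * ampl w (b / 2) (\<sigma> * b / (4 * a)))
        \<le> 7 * pi * ((3 * C 0 + 3 * C 1 + C 2) * (b / 2 / K) ^ 5) / (2 * a * sqrt (2 * a))"
        unfolding I_def
        by (rule stationary_phase_signed[OF ab(1) \<sigma> ampl_deriv[OF w K ab(5)] ampl''_continuous[OF w K ab(5)]
              norm_ampl''_le[OF w K ab(5)] z])
      moreover have "\<sigma> * b / (4 * a) = \<sigma> * \<beta> / (4 * \<alpha>)" using ab(4) by (metis times_divide_eq_right)
      ultimately show ?thesis
        unfolding ab(3) fresnel_sign_def by (simp only: a_def b_def)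
    qed
    ultimately have "norm ((T \<sigma> - I) + (I - ?m \<sigma>)) \<le> ?E1 + ?E2" by (rule norm_triangle_mono)
    then show ?thesis by simp
  qed
  have "4 * of_real pi * S w \<alpha> \<beta> = T 1 - T (-1)"
    using S_eq_integral[OF w K pos] unfolding T_def a_def b_def by simp
  then have S: "S w \<alpha> \<beta> = (T 1 - T (-1)) / (4 * of_real pi)" by (simp add: field_simps)
  have "S w \<alpha> \<beta> - (\<Sum>\<sigma>\<in>{1, -1}. of_real \<sigma> / (4 * of_real pi) * ?m \<sigma>)
     = ((T 1 - ?m 1) - (T (-1) - ?m (-1))) / (4 * of_real pi)"
  proof -
    have gen: "(t1 - t2) / p - (\<Sum>\<sigma>\<in>{1, -1::real}. of_real \<sigma> / p * f \<sigma>) = ((t1 - f 1) - (t2 - f (-1))) / p"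
      for t1 t2 p :: complex and f
      by (simp add: diff_divide_distrib add_divide_distrib)
    show ?thesis unfolding S by (rule gen)
  qed
  moreover have "norm ((x - y) / (4 * of_real pi)) \<le> E" if "norm x \<le> E" "norm y \<le> E" for x y :: complex and E :: real
  proof -
    have "0 \<le> E" using that(1) norm_ge_zero order_trans by blast
    \<comment> \<open>The two errors, one per sign, fit into a single one because 2 <= 4 pi.\<close>
    then have "E * 2 \<le> E * (4 * pi)" using pi_ge_two by (intro mult_left_mono) auto
    moreover have "norm (x - y) \<le> E * 2" using norm_triangle_ineq4[of x y] that by linarith
    ultimately have "norm (x - y) \<le> E * (4 * pi)" by linarith
    then show ?thesis by (simp add: norm_divide norm_mult pos_divide_le_eq)
  qed
  ultimately show ?thesis using T[of 1] T[of "-1"] by (simp only: insert_iff simp_thms)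
qed

text \<open>The amplitude is quantified before alpha: \<open>strip_amp\<close> sees alpha only
  through its two arguments, so one pair of functions serves all alpha. The constants work from K =
  1 on.\<close>

theorem theorem5p1:
  shows "\<exists>\<epsilon>\<^sub>0>0. \<forall>\<epsilon>::real. 0 < \<epsilon> \<and> \<epsilon> < \<epsilon>\<^sub>0 \<longrightarrow>
    (\<forall>(C :: nat \<Rightarrow> real) (A :: real).
     \<exists>(K\<^sub>0 :: real) (M :: real) (B :: nat \<Rightarrow> nat \<Rightarrow> real).
     \<forall>K\<ge>K\<^sub>0. \<forall>w :: real \<Rightarrow> complex. weight C K w \<longrightarrow>
       (\<forall>\<alpha>>0. \<forall>\<beta>>0. \<alpha> < K / 100 \<or> \<beta> < K / 100 \<longrightarrow>
          norm (S w \<alpha> \<beta>) \<le> M * exp (- K / 2)) \<and>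
       (\<forall>\<beta>. K / 100 \<le> \<beta> \<and> \<beta> \<le> A * K powr (1 + \<epsilon>) \<longrightarrow>
          (\<exists>H :: real \<Rightarrow> real \<Rightarrow> real \<Rightarrow> complex.
             (\<forall>\<sigma>\<in>{1, -1}. amplitude B K \<beta> (H \<sigma>)) \<and>
             (\<forall>\<alpha>. K / 100 \<le> \<alpha> \<and> \<alpha> \<le> A * K powr (2 + \<epsilon>) \<longrightarrow>
                (let \<gamma> = \<beta> / (4 * \<alpha>) in
                   (\<gamma> \<ge> 1 \<longrightarrow> norm (S w \<alpha> \<beta>) \<le> M * K powr (-1)) \<and>
                   (\<gamma> < 1 \<longrightarrow>
                      norm (S w \<alpha> \<beta> -
                        (\<Sum>\<sigma>\<in>{1, -1}. H \<sigma> (\<beta> * sqrt (1 - \<gamma>\<^sup>2)) \<gamma> / of_real (sqrt \<alpha>)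
                            * e (\<sigma> * (2 * \<alpha> + \<beta>\<^sup>2 / (4 * \<alpha>)))))
                      \<le> M * K powr (-1 + \<epsilon>)))))))"
proof (rule exI[of _ "1 / 10"], intro conjI allI impI)
  fix \<epsilon> A :: real and C :: "nat \<Rightarrow> real"
  assume \<epsilon>: "0 < \<epsilon> \<and> \<epsilon> < 1 / 10"
  \<comment> \<open>The three summands bound K times the expansion error, the terms with w' and w'',
    and the stationary phase error. In the last, 56 = 7 times 8, where 8 comes from 8 pi alpha >=
    K/4 raised to the power 3/2.\<close>
  define M1 where "M1 = 4 * pi * (C 0 + C 6) * (1 + 4 * pi * A + (4 * pi * A)\<^sup>2) + (pi * C 1 + 2 * C 2)
    + 56 * pi * (3 * C 0 + 3 * C 1 + C 2) * (2 * pi * A) ^ 5"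
  define M where "M = max (4 * C 0) M1"
  \<comment> \<open>\<open>k\<close> is the norm of \<open>\<kappa> \<sigma>\<close>. That factor
    gathers sigma/(4 pi) from the representation of S and 2 \<open>fresnel_sign \<sigma>\<close> /
    sqrt(8 pi alpha) from stationary phase, with 1/sqrt(alpha) split off.\<close>
  define k where "k = norm fresnel_end / (2 * pi * sqrt (8 * pi))"
  define \<kappa> where "\<kappa> \<sigma> = of_real \<sigma> * fresnel_sign \<sigma> / (2 * of_real pi * of_real (sqrt (8 * pi)))" for \<sigma> :: real
  let ?B = "\<lambda>i j :: nat. k * (100 * quot_bound C i 0 0 + quot_bound C i 0 1)"
  have main: "(\<forall>\<alpha>>0. \<forall>\<beta>>0. \<alpha> < K / 100 \<or> \<beta> < K / 100 \<longrightarrow>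
          norm (S w \<alpha> \<beta>) \<le> M * exp (- K / 2)) \<and>
       (\<forall>\<beta>. K / 100 \<le> \<beta> \<and> \<beta> \<le> A * K powr (1 + \<epsilon>) \<longrightarrow>
          (\<exists>H :: real \<Rightarrow> real \<Rightarrow> real \<Rightarrow> complex.
             (\<forall>\<sigma>\<in>{1, -1}. amplitude ?B K \<beta> (H \<sigma>)) \<and>
             (\<forall>\<alpha>. K / 100 \<le> \<alpha> \<and> \<alpha> \<le> A * K powr (2 + \<epsilon>) \<longrightarrow>
                (let \<gamma> = \<beta> / (4 * \<alpha>) in
                   (\<gamma> \<ge> 1 \<longrightarrow> norm (S w \<alpha> \<beta>) \<le> M * K powr (-1)) \<and>
                   (\<gamma> < 1 \<longrightarrow>
                      norm (S w \<alpha> \<beta> -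
                        (\<Sum>\<sigma>\<in>{1, -1}. H \<sigma> (\<beta> * sqrt (1 - \<gamma>\<^sup>2)) \<gamma> / of_real (sqrt \<alpha>)
                            * e (\<sigma> * (2 * \<alpha> + \<beta>\<^sup>2 / (4 * \<alpha>)))))
                      \<le> M * K powr (-1 + \<epsilon>))))))"
    if K1: "1 \<le> K" and w: "weight C K w" for K w
  proof (intro conjI allI impI)
    have K: "0 < K" using K1 by simp
    have C: "0 \<le> C j" for j by (rule weight_bound(2)[OF w K])
    {
      fix \<alpha> \<beta> :: real assume "0 < \<alpha>" "0 < \<beta>" "\<alpha> < K / 100 \<or> \<beta> < K / 100"
      then have "norm (S w \<alpha> \<beta>) \<le> 4 * C 0 * exp (- K / 2)" by (rule S_small[OF w K K1])
      also have "\<dots> \<le> M * exp (- K / 2)" by (intro mult_right_mono) (auto simp: M_def)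
      finally show "norm (S w \<alpha> \<beta>) \<le> M * exp (- K / 2)" .
    }
    fix \<beta> assume \<beta>: "K / 100 \<le> \<beta> \<and> \<beta> \<le> A * K powr (1 + \<epsilon>)"
    have b0: "0 < \<beta>" using \<beta> K by simp
    define H where "H \<sigma> = strip_amp (\<kappa> \<sigma>) w (\<sigma> * \<beta>)" for \<sigma>
    have amp: "amplitude ?B K \<beta> (H \<sigma>)" if "\<sigma> \<in> {1, -1}" for \<sigma>
      unfolding H_def
      by (rule amplitude_strip_amp[OF w K])
         (use that \<beta> b0 in \<open>auto simp: \<kappa>_def k_def fresnel_sign_def norm_divide norm_mult\<close>)
    have "\<beta> / K \<le> A * K powr \<epsilon>"
      using \<beta> K by (simp add: powr_add pos_divide_le_eq mult_ac)
    define q where "q = K powr \<epsilon>"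
    have q1: "1 \<le> q" using K1 \<epsilon> by (simp add: q_def ge_one_powr_ge_zero)
    have bq: "\<beta> / K \<le> A * q" using \<open>\<beta> / K \<le> A * K powr \<epsilon>\<close> by (simp add: q_def)
    \<comment> \<open>Positivity of A is forced by the existence of an admissible beta.\<close>
    have A: "0 < A"
    proof -
      have "0 < A * q" using bq b0 K by (meson divide_pos_pos less_le_trans)
      then show ?thesis using q1 by (simp add: zero_less_mult_iff)
    qed
    \<comment> \<open>The decisive use of epsilon < 1/10: the fifth power of beta/K must not exceed
      a constant times sqrt K, the surplus of alpha^(-3/2) over 1/K.\<close>
    have q5: "q ^ 5 \<le> sqrt K"
    proof -
      have "q ^ 5 = K powr (5 * \<epsilon>)" using K by (simp add: q_def powr_power mult.commute)
      also have "\<dots> \<le> K powr (1 / 2)" using K1 \<epsilon> by (intro powr_mono) auto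
      finally show ?thesis using K by (simp add: powr_half_sqrt)
    qed
    have qK: "q ^ 5 \<le> K"
    proof -
      have "sqrt K * 1 \<le> sqrt K * sqrt K" using K1 by (intro mult_left_mono) auto
      then show ?thesis using q5 K by simp
    qed
    have qK': "q ^ n \<le> K" if "n \<le> 5" for n
      using power_increasing[OF that q1] qK by simp
    have est: "4 * pi * (C 0 + C 6) * (1 / K ^ 2 + 4 * pi * \<beta> / K ^ 3 + (4 * pi * \<beta>)\<^sup>2 / K ^ 4) + (pi * C 1 + 2 * C 2) / K
      + 7 * pi * ((3 * C 0 + 3 * C 1 + C 2) * (2 * pi * \<beta> / K) ^ 5) / (2 * (4 * pi * \<alpha>) * sqrt (2 * (4 * pi * \<alpha>)))
      \<le> M / K" if \<alpha>: "K / 100 \<le> \<alpha>" for \<alpha>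
    proof -
      have t: "(\<beta> / K) ^ n \<le> A ^ n * q ^ n" for n
        using power_mono[OF bq, of n] b0 K by (simp add: power_mult_distrib)
      have "1 / K ^ 2 \<le> 1 / K"
        using K1 K by (simp add: power2_eq_square divide_le_eq_1 field_simps)
      moreover have "4 * pi * \<beta> / K ^ 3 \<le> 4 * pi * A / K"
      proof -
        have "\<beta> / K \<le> A * K"
          by (rule order_trans[OF bq]) (use qK'[of 1] A in simp)
        then have "(\<beta> / K) / K ^ 2 \<le> A * K / K ^ 2" using K by (intro divide_right_mono) auto
        then have "4 * pi * ((\<beta> / K) / K ^ 2) \<le> 4 * pi * (A * K / K ^ 2)" by (intro mult_left_mono) auto
        then show ?thesis using K by (simp add: power2_eq_square power3_eq_cube)
      qed
      moreover have "(4 * pi * \<beta>)\<^sup>2 / K ^ 4 \<le> (4 * pi * A)\<^sup>2 / K"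
      proof -
        have "(\<beta> / K) ^ 2 \<le> A ^ 2 * K"
          by (rule order_trans[OF t[of 2]]) (use qK'[of 2] in \<open>simp add: mult_left_mono\<close>)
        then have "(\<beta> / K) ^ 2 / K ^ 2 \<le> A ^ 2 * K / K ^ 2" using K by (intro divide_right_mono) auto
        then have "(4 * pi)\<^sup>2 * ((\<beta> / K) ^ 2 / K ^ 2) \<le> (4 * pi)\<^sup>2 * (A ^ 2 * K / K ^ 2)" by (intro mult_left_mono) auto
        then show ?thesis using K by (simp add: power_mult_distrib power_divide power2_eq_square power4_eq_xxxx mult_ac)
      qed
      ultimately have "1 / K ^ 2 + 4 * pi * \<beta> / K ^ 3 + (4 * pi * \<beta>)\<^sup>2 / K ^ 4 \<le> 1 / K + 4 * pi * A / K + (4 * pi * A)\<^sup>2 / K"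
        by (intro add_mono)
      also have "\<dots> = (1 + 4 * pi * A + (4 * pi * A)\<^sup>2) / K" by (simp add: add_divide_distrib)
      finally have 1: "4 * pi * (C 0 + C 6) * (1 / K ^ 2 + 4 * pi * \<beta> / K ^ 3 + (4 * pi * \<beta>)\<^sup>2 / K ^ 4)
         \<le> 4 * pi * (C 0 + C 6) * ((1 + 4 * pi * A + (4 * pi * A)\<^sup>2) / K)"
        using C[of 0] C[of 6] by (intro mult_left_mono) auto
      have 2: "7 * pi * ((3 * C 0 + 3 * C 1 + C 2) * (2 * pi * \<beta> / K) ^ 5) / (2 * (4 * pi * \<alpha>) * sqrt (2 * (4 * pi * \<alpha>)))
         \<le> 7 * pi * ((3 * C 0 + 3 * C 1 + C 2) * ((2 * pi * A) ^ 5 * sqrt K)) / (K * sqrt K / 8)"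
      proof (intro frac_le mult_left_mono)
        have "(\<beta> / K) ^ 5 \<le> A ^ 5 * sqrt K"
          by (rule order_trans[OF t[of 5]]) (use q5 A in simp)
        then have "(2 * pi) ^ 5 * (\<beta> / K) ^ 5 \<le> (2 * pi) ^ 5 * (A ^ 5 * sqrt K)" by (intro mult_left_mono) auto
        then show "(2 * pi * \<beta> / K) ^ 5 \<le> (2 * pi * A) ^ 5 * sqrt K"
          by (simp only: power_mult_distrib[symmetric] mult.assoc[symmetric] times_divide_eq_right)
        \<comment> \<open>Here 25 <= 8 pi.\<close>
        have "(25 :: real) * (K / 100) \<le> (2 * (4 * pi)) * \<alpha>"
          using \<alpha> K pi_approx by (intro mult_mono) auto
        then have a4: "K / 4 \<le> 2 * (4 * pi * \<alpha>)" by simp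
        have "sqrt K / 2 = sqrt (K / 4)" by (simp add: real_sqrt_divide)
        also have "\<dots> \<le> sqrt (2 * (4 * pi * \<alpha>))" using a4 by (rule real_sqrt_le_mono)
        finally have "(K / 4) * (sqrt K / 2) \<le> 2 * (4 * pi * \<alpha>) * sqrt (2 * (4 * pi * \<alpha>))"
          using a4 K by (intro mult_mono) auto
        then show "K * sqrt K / 8 \<le> 2 * (4 * pi * \<alpha>) * sqrt (2 * (4 * pi * \<alpha>))" by simp
      qed (use C K A in auto)
      have "4 * pi * (C 0 + C 6) * (1 / K ^ 2 + 4 * pi * \<beta> / K ^ 3 + (4 * pi * \<beta>)\<^sup>2 / K ^ 4) + (pi * C 1 + 2 * C 2) / K
      + 7 * pi * ((3 * C 0 + 3 * C 1 + C 2) * (2 * pi * \<beta> / K) ^ 5) / (2 * (4 * pi * \<alpha>) * sqrt (2 * (4 * pi * \<alpha>)))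
       \<le> 4 * pi * (C 0 + C 6) * ((1 + 4 * pi * A + (4 * pi * A)\<^sup>2) / K) + (pi * C 1 + 2 * C 2) / K
         + 7 * pi * ((3 * C 0 + 3 * C 1 + C 2) * ((2 * pi * A) ^ 5 * sqrt K)) / (K * sqrt K / 8)"
        using 1 2 by (intro add_mono) auto
      also have "\<dots> = M1 / K"
      proof -
        have "7 * pi * ((3 * C 0 + 3 * C 1 + C 2) * ((2 * pi * A) ^ 5 * sqrt K)) / (K * sqrt K / 8)
          = 56 * pi * (3 * C 0 + 3 * C 1 + C 2) * (2 * pi * A) ^ 5 / K"
          using K by simp
        moreover have "X * (Y / K) + Z / K + V / K = (X * Y + Z + V) / K" for X Y Z V
          by (simp add: add_divide_distrib)
        ultimately show ?thesis unfolding M1_def by (simp only:)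
      qed
      also have "\<dots> \<le> M / K" using K by (intro divide_right_mono) (auto simp: M_def)
      finally show ?thesis .
    qed
    show "\<exists>H. (\<forall>\<sigma>\<in>{1, -1}. amplitude ?B K \<beta> (H \<sigma>)) \<and>
             (\<forall>\<alpha>. K / 100 \<le> \<alpha> \<and> \<alpha> \<le> A * K powr (2 + \<epsilon>) \<longrightarrow>
                (let \<gamma> = \<beta> / (4 * \<alpha>) in
                   (\<gamma> \<ge> 1 \<longrightarrow> norm (S w \<alpha> \<beta>) \<le> M * K powr (-1)) \<and>
                   (\<gamma> < 1 \<longrightarrow>
                      norm (S w \<alpha> \<beta> -
                        (\<Sum>\<sigma>\<in>{1, -1}. H \<sigma> (\<beta> * sqrt (1 - \<gamma>\<^sup>2)) \<gamma> / of_real (sqrt \<alpha>)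
                            * e (\<sigma> * (2 * \<alpha> + \<beta>\<^sup>2 / (4 * \<alpha>)))))
                      \<le> M * K powr (-1 + \<epsilon>))))"
    proof (intro exI[of _ H] conjI ballI amp allI impI)
      fix \<alpha> assume "K / 100 \<le> \<alpha> \<and> \<alpha> \<le> A * K powr (2 + \<epsilon>)"
      then have \<alpha>: "K / 100 \<le> \<alpha>" and a0: "0 < \<alpha>" using K by auto
      define \<gamma> where "\<gamma> = \<beta> / (4 * \<alpha>)"
      have g0: "0 < \<gamma>" using a0 b0 by (simp add: \<gamma>_def)
      let ?m = "\<lambda>\<sigma>. of_real \<sigma> / (4 * of_real pi)
        * (cis (\<sigma> * (4 * pi * \<alpha> + (4 * pi * \<beta>)\<^sup>2 / (8 * (4 * pi * \<alpha>))))
        * (2 * fresnel_sign \<sigma> / sqrt (2 * (4 * pi * \<alpha>))) * ampl w (2 * pi * \<beta>) (\<sigma> * \<beta> / (4 * \<alpha>)))"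
      have app: "norm (S w \<alpha> \<beta> - (\<Sum>\<sigma>\<in>{1, -1}. ?m \<sigma>)) \<le> M / K"
        by (rule order_trans[OF S_approx[OF w K a0 b0] est[OF \<alpha>]])
      have MK: "M / K = M * K powr (-1)" using K by (simp add: powr_minus divide_inverse)
      have ag: "\<bar>\<sigma> * \<beta> / (4 * \<alpha>)\<bar> = \<gamma>" if "\<sigma> \<in> {1, -1}" for \<sigma>
        using that a0 b0 by (auto simp: \<gamma>_def)
      have "norm (S w \<alpha> \<beta>) \<le> M * K powr (-1)" if "1 \<le> \<gamma>"
      proof -
        \<comment> \<open>The stationary point sigma gamma lies outside (-1, 1), where
          \<open>ampl\<close> is 0; the error bound is then a bound for S itself.\<close>
        have "?m \<sigma> = 0" if "\<sigma> \<in> {1, -1}" for \<sigma>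
          using ag[OF that] \<open>1 \<le> \<gamma>\<close> by (simp add: ampl_def)
        then have "(\<Sum>\<sigma>\<in>{1, -1}. ?m \<sigma>) = 0" by (intro sum.neutral) blast
        then show ?thesis using app by (simp only: diff_zero MK)
      qed
      moreover have "norm (S w \<alpha> \<beta> -
                        (\<Sum>\<sigma>\<in>{1, -1}. H \<sigma> (\<beta> * sqrt (1 - \<gamma>\<^sup>2)) \<gamma> / of_real (sqrt \<alpha>)
                            * e (\<sigma> * (2 * \<alpha> + \<beta>\<^sup>2 / (4 * \<alpha>)))))
                      \<le> M * K powr (-1 + \<epsilon>)" if "\<gamma> < 1"
      proof -
        define c where "c = sqrt (1 - \<gamma>\<^sup>2)"
        have c0: "0 < c" using that g0 by (simp add: c_def abs_square_less_1)
        have "?m \<sigma> = H \<sigma> (\<beta> * sqrt (1 - \<gamma>\<^sup>2)) \<gamma> / of_real (sqrt \<alpha>)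
                            * e (\<sigma> * (2 * \<alpha> + \<beta>\<^sup>2 / (4 * \<alpha>)))" if \<sigma>: "\<sigma> \<in> {1, -1}" for \<sigma>
        proof -
          have e: "cis (\<sigma> * (4 * pi * \<alpha> + (4 * pi * \<beta>)\<^sup>2 / (8 * (4 * pi * \<alpha>)))) = e (\<sigma> * (2 * \<alpha> + \<beta>\<^sup>2 / (4 * \<alpha>)))"
          proof -
            have "e x = cis (2 * pi * x)" for x
              by (simp add: e_def cis_conv_exp mult_ac)
            moreover have "2 * pi * (\<sigma> * (2 * \<alpha> + \<beta>\<^sup>2 / (4 * \<alpha>))) = \<sigma> * (4 * pi * \<alpha> + (4 * pi * \<beta>)\<^sup>2 / (8 * (4 * pi * \<alpha>)))"
              using a0 by (simp add: field_simps power2_eq_square)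
            ultimately show ?thesis by (simp only:)
          qed
          have s: "sqrt (2 * (4 * pi * \<alpha>)) = sqrt (8 * pi) * sqrt \<alpha>"
            by (simp add: real_sqrt_mult[symmetric])
          have "(\<sigma> * \<beta> / (4 * \<alpha>))\<^sup>2 = \<gamma>\<^sup>2" using ag[OF \<sigma>] power2_abs by metis
          then have am: "ampl w (2 * pi * \<beta>) (\<sigma> * \<beta> / (4 * \<alpha>)) = w (2 * pi * \<beta> * c) * (1 + \<i> * of_real (\<sigma> * \<gamma> / c))"
            using ag[OF \<sigma>] \<open>\<gamma> < 1\<close> unfolding ampl_def Let_def c_def by (simp add: \<gamma>_def)
          \<comment> \<open>With x = beta c the quotient y/x times sigma beta is sigma gamma / c, so
            the amplitude on the strip reproduces \<open>ampl\<close> up to the constant.\<close>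
          have h: "H \<sigma> (\<beta> * c) \<gamma> = \<kappa> \<sigma> * (w (2 * pi * \<beta> * c) * (1 + \<i> * of_real (\<sigma> * \<gamma> / c)))"
            using g0 \<open>\<gamma> < 1\<close> c0 b0 by (simp add: H_def strip_amp_def field_simps)
          show ?thesis
            unfolding e s am c_def[symmetric] h \<kappa>_def by (simp add: mult_ac)
        qed
        then have "(\<Sum>\<sigma>\<in>{1, -1}. ?m \<sigma>) = (\<Sum>\<sigma>\<in>{1, -1}. H \<sigma> (\<beta> * sqrt (1 - \<gamma>\<^sup>2)) \<gamma> / of_real (sqrt \<alpha>)
                            * e (\<sigma> * (2 * \<alpha> + \<beta>\<^sup>2 / (4 * \<alpha>))))"
          by (intro sum.cong refl)
        then have "norm (S w \<alpha> \<beta> -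
                        (\<Sum>\<sigma>\<in>{1, -1}. H \<sigma> (\<beta> * sqrt (1 - \<gamma>\<^sup>2)) \<gamma> / of_real (sqrt \<alpha>)
                            * e (\<sigma> * (2 * \<alpha> + \<beta>\<^sup>2 / (4 * \<alpha>))))) \<le> M / K"
          using app by (simp only:)
        \<comment> \<open>The error M/K is stronger than the one claimed and is weakened by K >=
          1.\<close>
        also have "\<dots> \<le> M * K powr (-1 + \<epsilon>)"
          unfolding MK using K1 \<epsilon> C[of 0] by (intro mult_left_mono powr_mono) (auto simp: M_def le_max_iff_disj)
        finally show ?thesis .
      qed
      ultimately show "let \<gamma> = \<beta> / (4 * \<alpha>) in
                   (\<gamma> \<ge> 1 \<longrightarrow> norm (S w \<alpha> \<beta>) \<le> M * K powr (-1)) \<and>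
                   (\<gamma> < 1 \<longrightarrow>
                      norm (S w \<alpha> \<beta> -
                        (\<Sum>\<sigma>\<in>{1, -1}. H \<sigma> (\<beta> * sqrt (1 - \<gamma>\<^sup>2)) \<gamma> / of_real (sqrt \<alpha>)
                            * e (\<sigma> * (2 * \<alpha> + \<beta>\<^sup>2 / (4 * \<alpha>)))))
                      \<le> M * K powr (-1 + \<epsilon>))"
        unfolding Let_def \<gamma>_def[symmetric] by blast
    qed
  qed
  show "\<exists>(K\<^sub>0 :: real) (M :: real) (B :: nat \<Rightarrow> nat \<Rightarrow> real).
     \<forall>K\<ge>K\<^sub>0. \<forall>w :: real \<Rightarrow> complex. weight C K w \<longrightarrow>
       (\<forall>\<alpha>>0. \<forall>\<beta>>0. \<alpha> < K / 100 \<or> \<beta> < K / 100 \<longrightarrow>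
          norm (S w \<alpha> \<beta>) \<le> M * exp (- K / 2)) \<and>
       (\<forall>\<beta>. K / 100 \<le> \<beta> \<and> \<beta> \<le> A * K powr (1 + \<epsilon>) \<longrightarrow>
          (\<exists>H :: real \<Rightarrow> real \<Rightarrow> real \<Rightarrow> complex.
             (\<forall>\<sigma>\<in>{1, -1}. amplitude B K \<beta> (H \<sigma>)) \<and>
             (\<forall>\<alpha>. K / 100 \<le> \<alpha> \<and> \<alpha> \<le> A * K powr (2 + \<epsilon>) \<longrightarrow>
                (let \<gamma> = \<beta> / (4 * \<alpha>) in
                   (\<gamma> \<ge> 1 \<longrightarrow> norm (S w \<alpha> \<beta>) \<le> M * K powr (-1)) \<and>
                   (\<gamma> < 1 \<longrightarrow>
                      norm (S w \<alpha> \<beta> -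
                        (\<Sum>\<sigma>\<in>{1, -1}. H \<sigma> (\<beta> * sqrt (1 - \<gamma>\<^sup>2)) \<gamma> / of_real (sqrt \<alpha>)
                            * e (\<sigma> * (2 * \<alpha> + \<beta>\<^sup>2 / (4 * \<alpha>)))))
                      \<le> M * K powr (-1 + \<epsilon>))))))"
    by (intro exI[of _ 1] exI[of _ M] exI[of _ ?B] allI impI main)
qed simp

end
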